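(* Consider the sparse linear regression model $Y\sim P_{\theta^*}=N(X\theta^*,I_n)$ with design matrix $X\in\mathbb{R}^{n\times p}$ and $\theta^*\in\Theta_{S^*}$, $S^*\subset[p]$, and the empirical Bayes procedure $\Pi_{\widehat\lambda}(\cdot|Y)$ defined with a Laplace slab for $\tau=p^{-\zeta}\|X\|$ with some constant $\zeta>0$ and weight function $w(\lambda)=\lambda^{\alpha-1}(1-\lambda)^{\beta-1}$ that satisfies $p^{C_1'}\geq\beta/\alpha\geq p^{C_2'}$ for some sufficiently large constants $C_1'>C_2'>0$. As long as $\kappa(S^* )\geq p^{-\zeta}$, the following three conditions are satisfied for some constants $C,C_1,C_2,C_3,C_4,C_5>0$ with $C>2C_5$, some constant $\rho>1$ and some $\lambda^*\in[0,1]$. (1) There exists a testing function $\phi$ such that $P_{\theta^*}\phi\leq\exp(-C_1|S^*|\log p)$ and, for any $\epsilon^2\geq|S^*|\log p$ and any $S\subset[p]$, $$\sup_{\theta\in\Theta_S:\|X(\theta-\theta^* )\|^2\geq\epsilon^2}P_\theta(1-\phi)\leq\exp\left(-C\epsilon^2+C_2(|S|\log p+|S^*|\log p)\right).$$ (2) $\displaystyle\sum_{S\subset[p]}\frac{\gamma(S)}{w(\lambda^* )\nu_{\lambda^*}(S^* )}\exp(2C_2|S|\log p)\leq\exp(C_4|S^*|\log p).$ (3) For any $\epsilon^2\geq|S^*|\log p$ and any $S\subset[p]$, $$\frac{\Gamma_S\left(\{\theta\in\Theta_S:\|X(\theta-\theta^* )\|^2\leq\epsilon^2\}\right)}{\Gamma_{S^*}\left(\{\theta\in\Theta_{S^*}:D_\rho(P_{\theta^*}\|P_\theta)\leq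 C_3|S^*|\log p\}\right)}\leq\exp\left(C_5\epsilon^2+C_2(|S|\log p+|S^*|\log p)\right).$$ As a consequence, $$P_{\theta^*}\Pi_{\widehat{\lambda}}\left(\|X(\theta-\theta^* )\|^2>M|S^*|\log p\,\Big|\,Y\right)\leq4\exp(-C'|S^*|\log p),$$ with some constants $M,C'>0$ uniformly over all $\theta^*\in\Theta_{S^*}$.
   Context: For $S\subset[p]=\{1,\ldots,p\}$, $\Theta_S=\{\theta\in\mathbb{R}^p:\theta_j=0\text{ for all }j\notin S\}$. For the design matrix, $\|X\|=\max_{j\in[p]}\|X_j\|$, where $X_j$ is the $j$th column; for vectors $\|\cdot\|$ is the Euclidean norm and $\|\cdot\|_1$ the $\ell_1$ norm. The compatibility number is $$\kappa(S)=\inf\left\{\frac{\|Xu\||S|^{1/2}}{\|X\|\|u_S\|_1}:\|u_{S^c}\|_1\leq3\|u_S\|_1,\ u_S\neq0\right\},$$ where $u\in\mathbb{R}^p$ and $u_S$ is the subvector of $u$ with coordinates in $S$. For $\lambda\in[0,1]$, the spike-and-slab prior on $\mathbb{R}^p$ is $\Pi_\lambda=\bigotimes_{j=1}^p\left((1-\lambda)\delta_0+\lambda G\right)$, where $\delta_0$ is the point mass at $0$ and $G$ (the slab) is the Laplace distribution with density $g(x)=\frac{\tau}{2}e^{-\tau|x|}$. It decomposes as $\Pi_\lambda=\sum_{S\subset[p]}\nu_\lambda(S)\Gamma_S$ with $$\nu_\lambda(S)=(1-\lambda)^{p-|S|}\lambda^{|S|},\qquad\Gamma_S=\left(\bigotimes_{j\in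 S^c}\delta_0\right)\otimes\left(\bigotimes_{j\in S}G\right).$$ The effective weight is $\gamma(S)=\max_{\lambda\in[0,1]}[w(\lambda)\nu_\lambda(S)]$. With $p(Y|\theta)$ the likelihood of $P_\theta=N(X\theta,I_n)$, the posterior is $d\Pi_\lambda(\theta|Y)\propto p(Y|\theta)\,d\Pi_\lambda(\theta)$, and $\widehat{\lambda}=\mathop{\rm argmax}_{\lambda\in[0,1]}\log\left[w(\lambda)\int p(Y|\theta)\,d\Pi_\lambda(\theta)\right]$; the empirical Bayes posterior is $\Pi_{\widehat\lambda}(\cdot|Y)$. $Pf$ denotes the expectation of $f(Y)$ under $P$; a testing function is a measurable function of $Y$ with values in $[0,1]$; $D_\rho(P\|Q)=\frac{1}{\rho-1}\log\int\left(\frac{dP}{dQ}\right)^{\rho-1}dP$.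
   Formalization: Assumes α ≥ 1 (otherwise γ(∅) is infinite and (2) fails), p ≥ 2 (for p = 1 condition (2) is false) and ‖X‖ > 0 (so that τ > 0); condition (2) is claimed only for nonempty S*, since for empty S* its left side exceeds 1 while its right side equals 1. *)

theory Defs
  imports "HOL-Probability.Probability"
begin

text \<open>
  The constants of the theorem must not depend on \<open>n\<close> and \<open>p\<close>, so the dimensions are natural
  numbers and not types: a vector of dimension \<open>p\<close> is an extensional function on \<open>{1..p}\<close>, i.e. an
  element of \<open>{1..p} \<rightarrow>\<^sub>E UNIV\<close>, and a design matrix is a function \<open>X i j\<close> of which only the values
  at \<open>i \<in> {1..n}\<close>, \<open>j \<in> {1..p}\<close> matter.
\<close>

definition Theta :: "nat \<Rightarrow> nat set \<Rightarrow> (nat \<Rightarrow> real) set" where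
  "Theta p S = {\<theta> \<in> {1..p} \<rightarrow>\<^sub>E UNIV. \<forall>j\<in>{1..p} - S. \<theta> j = 0}"

definition design_mult :: "nat \<Rightarrow> (nat \<Rightarrow> nat \<Rightarrow> real) \<Rightarrow> (nat \<Rightarrow> real) \<Rightarrow> nat \<Rightarrow> real" where
  "design_mult p X u i = (\<Sum>j\<in>{1..p}. X i j * u j)"

definition design_norm :: "nat \<Rightarrow> nat \<Rightarrow> (nat \<Rightarrow> nat \<Rightarrow> real) \<Rightarrow> real" where
  "design_norm n p X = Max ((\<lambda>j. L2_set (\<lambda>i. X i j) {1..n}) ` {1..p})"

definition pred_dist ::
  "nat \<Rightarrow> nat \<Rightarrow> (nat \<Rightarrow> nat \<Rightarrow> real) \<Rightarrow> (nat \<Rightarrow> real) \<Rightarrow> (nat \<Rightarrow> real) \<Rightarrow> real" where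
  "pred_dist n p X \<theta> \<theta>' = L2_set (design_mult p X (\<lambda>j. \<theta> j - \<theta>' j)) {1..n}"

text \<open>
  The compatibility number is extended-real valued, so that the infimum over the empty set, which
  occurs exactly for \<open>S = {}\<close>, is \<open>\<infinity>\<close>.
\<close>

definition compat_number :: "nat \<Rightarrow> nat \<Rightarrow> (nat \<Rightarrow> nat \<Rightarrow> real) \<Rightarrow> nat set \<Rightarrow> ereal" where
  "compat_number n p X S =
     (INF u\<in>{u \<in> {1..p} \<rightarrow>\<^sub>E UNIV.
               (\<Sum>j\<in>{1..p} - S. \<bar>u j\<bar>) \<le> 3 * (\<Sum>j\<in>S. \<bar>u j\<bar>) \<and> (\<exists>j\<in>S. u j \<noteq> 0)}.
        ereal (L2_set (design_mult p X u) {1..n} * sqrt (real (card S)) /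
               (design_norm n p X * (\<Sum>j\<in>S. \<bar>u j\<bar>))))"

definition laplace :: "real \<Rightarrow> real measure" where
  "laplace \<tau> = density lborel (\<lambda>x. ennreal (\<tau> / 2 * exp (- \<tau> * \<bar>x\<bar>)))"

definition spike_slab :: "real \<Rightarrow> real \<Rightarrow> real measure" where
  "spike_slab \<tau> l = measure_of UNIV (sets borel)
     (\<lambda>A. ennreal (1 - l) * emeasure (return borel 0) A + ennreal l * emeasure (laplace \<tau>) A)"

definition prior :: "nat \<Rightarrow> real \<Rightarrow> real \<Rightarrow> (nat \<Rightarrow> real) measure" where
  "prior p \<tau> l = (\<Pi>\<^sub>M j\<in>{1..p}. spike_slab \<tau> l)"

definition nu :: "nat \<Rightarrow> real \<Rightarrow> nat set \<Rightarrow> real" where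
  "nu p l S = (1 - l) ^ (p - card S) * l ^ card S"

definition Gam :: "nat \<Rightarrow> real \<Rightarrow> nat set \<Rightarrow> (nat \<Rightarrow> real) measure" where
  "Gam p \<tau> S = (\<Pi>\<^sub>M j\<in>{1..p}. if j \<in> S then laplace \<tau> else return borel 0)"

text \<open>
  In HOL \<open>0 powr 0 = 0\<close>, whereas the weight function needs \<open>0\<^sup>0 = 1\<close> (it is constant in \<open>l\<close> or
  \<open>1 - l\<close> when \<open>\<alpha> = 1\<close> or \<open>\<beta> = 1\<close>).
\<close>

definition rpow :: "real \<Rightarrow> real \<Rightarrow> real" where
  "rpow x a = (if a = 0 then 1 else x powr a)"

definition weight :: "real \<Rightarrow> real \<Rightarrow> real \<Rightarrow> real" where
  "weight \<alpha> \<beta> l = rpow l (\<alpha> - 1) * rpow (1 - l) (\<beta> - 1)"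

text \<open>For \<open>\<alpha>, \<beta> \<ge> 1\<close> this supremum is a maximum.\<close>

definition eff_weight :: "nat \<Rightarrow> real \<Rightarrow> real \<Rightarrow> nat set \<Rightarrow> real" where
  "eff_weight p \<alpha> \<beta> S = (SUP l\<in>{0..1}. weight \<alpha> \<beta> l * nu p l S)"

definition sampling ::
  "nat \<Rightarrow> nat \<Rightarrow> (nat \<Rightarrow> nat \<Rightarrow> real) \<Rightarrow> (nat \<Rightarrow> real) \<Rightarrow> (nat \<Rightarrow> real) measure" where
  "sampling n p X \<theta> =
     (\<Pi>\<^sub>M i\<in>{1..n}. density lborel (\<lambda>y. ennreal (normal_density (design_mult p X \<theta> i) 1 y)))"

definition likelihood ::
  "nat \<Rightarrow> nat \<Rightarrow> (nat \<Rightarrow> nat \<Rightarrow> real) \<Rightarrow> (nat \<Rightarrow> real) \<Rightarrow> (nat \<Rightarrow> real) \<Rightarrow> real" where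
  "likelihood n p X \<theta> y = (\<Prod>i\<in>{1..n}. normal_density (design_mult p X \<theta> i) 1 (y i))"

definition marginal ::
  "nat \<Rightarrow> nat \<Rightarrow> (nat \<Rightarrow> nat \<Rightarrow> real) \<Rightarrow> real \<Rightarrow> real \<Rightarrow> (nat \<Rightarrow> real) \<Rightarrow> real" where
  "marginal n p X \<tau> l y = (\<integral>\<theta>. likelihood n p X \<theta> y \<partial>prior p \<tau> l)"

definition posterior ::
  "nat \<Rightarrow> nat \<Rightarrow> (nat \<Rightarrow> nat \<Rightarrow> real) \<Rightarrow> real \<Rightarrow> real \<Rightarrow> (nat \<Rightarrow> real) \<Rightarrow> (nat \<Rightarrow> real) measure" where
  "posterior n p X \<tau> l y =
     density (prior p \<tau> l) (\<lambda>\<theta>. ennreal (likelihood n p X \<theta> y / marginal n p X \<tau> l y))"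

text \<open>The logarithm on \<open>[0, \<infinity>]\<close>; in HOL \<open>ln 0 = 0\<close>, so \<open>ln\<close> itself cannot be used.\<close>

definition eln :: "ennreal \<Rightarrow> ereal" where
  "eln x = (if x = 0 then - \<infinity> else if x = \<infinity> then \<infinity> else ereal (ln (enn2real x)))"

text \<open>
  The maximizer need not be unique; an empirical Bayes estimator is any measurable selection.
\<close>

definition eb_estimator ::
  "nat \<Rightarrow> nat \<Rightarrow> (nat \<Rightarrow> nat \<Rightarrow> real) \<Rightarrow> real \<Rightarrow> real \<Rightarrow> real \<Rightarrow> ((nat \<Rightarrow> real) \<Rightarrow> real) \<Rightarrow> bool" where
  "eb_estimator n p X \<tau> \<alpha> \<beta> lhat \<longleftrightarrow>
     lhat \<in> borel_measurable (\<Pi>\<^sub>M i\<in>{1..n}. borel) \<and>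
     (\<forall>y \<in> {1..n} \<rightarrow>\<^sub>E UNIV.
        is_arg_max (\<lambda>l. eln (ennreal (weight \<alpha> \<beta> l * marginal n p X \<tau> l y)))
          (\<lambda>l. l \<in> {0..1}) (lhat y))"

text \<open>
  Divergence of order \<open>\<rho> > 1\<close> with the density exponent \<open>\<rho> - 1\<close> under \<open>P\<close>; note that
  \<open>RN_deriv Q P\<close> is \<open>dP/dQ\<close>.
\<close>

definition renyi_div :: "real \<Rightarrow> 'a measure \<Rightarrow> 'a measure \<Rightarrow> ereal" where
  "renyi_div \<rho> P Q =
     (if absolutely_continuous Q P
      then ereal (1 / (\<rho> - 1)) *
             eln (\<integral>\<^sup>+ y. ennreal (enn2real (RN_deriv Q P y) powr (\<rho> - 1)) \<partial>P)
      else \<infinity>)"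

definition test_function :: "nat \<Rightarrow> ((nat \<Rightarrow> real) \<Rightarrow> real) \<Rightarrow> bool" where
  "test_function n \<phi> \<longleftrightarrow>
     \<phi> \<in> borel_measurable (\<Pi>\<^sub>M i\<in>{1..n}. borel) \<and>
     (\<forall>y \<in> {1..n} \<rightarrow>\<^sub>E UNIV. 0 \<le> \<phi> y \<and> \<phi> y \<le> 1)"

end

theory Submission
  imports Defs
begin

text \<open>
  The test is a truncated sum over \<open>S\<close> of exponentiated chi-square statistics of the residual projected
  on the columns in \<open>S \<union> S\<^sup>*\<close>. For the prior mass, compatibility gives
  \<open>\<tau> \<parallel>\<theta>\<parallel>\<^sub>1 \<ge> \<tau> \<parallel>\<theta>\<^sup>*\<parallel>\<^sub>1 + \<tau> \<parallel>\<theta> - \<theta>\<^sup>*\<parallel>\<^sub>1 / 2 - (3/2) \<parallel>X (\<theta> - \<theta>\<^sup>*)\<parallel> |S\<^sup>*|\<^sup>1\<^sup>/\<^sup>2\<close>, so the Laplace slab at \<open>\<theta>\<close> is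
  comparable with the slab centred at \<open>\<theta>\<^sup>*\<close>, up to a factor that the test absorbs. The effective weights
  are binomial-type maxima, compared through the tangent inequality for \<open>x ln x\<close>. Finally, maximality of
  \<open>\<lambda>\<close>-hat allows replacing it by \<open>\<lambda>\<^sup>*\<close> in the evidence and, at the price of the effective weights, in
  the numerator of the posterior.
\<close>

subsection \<open>Mixtures and the spike-and-slab prior\<close>

text \<open>The posterior is built on a prior that depends on \<open>Y\<close> through
  \<lambda>-hat, so neither a test nor Fubini applies to it as it stands. After the passage to
  effective weights, every remaining integral is over a fixed \<open>Gam p \<tau> S\<close>, with
  deterministic coefficients. The bound must be uniform over the unbounded set
  \<open>Theta p Sstar\<close>, on which the slab mass near \<theta>star can be as small as exp (-
  \<tau> |\<theta>star|_1). This factor is never estimated: it is carried explicitly through the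
  upper bounds for the numerator and the lower bound for the evidence, and cancels in the quotient.
  The contraction is not derived by cutting the parameter space into shells and using (1) and (3) on
  each. The test error decays like exp (- d^2 / 4) at every \<theta> at prediction distance d, and
  this decay is integrated against the slab in one go. Comparing the slabs costs exp (3/2 d
  |Sstar|^(1/2)); a share d^2 / 8 of the decay pays for it, and the other d^2 / 8 is the origin of
  the factor 8 in \<open>M\<close>.\<close>

definition mixture :: "'k set \<Rightarrow> ('k \<Rightarrow> ennreal) \<Rightarrow> ('k \<Rightarrow> 'a measure) \<Rightarrow> 'a measure \<Rightarrow> 'a measure" where
  "mixture K c M N = measure_of (space N) (sets N) (\<lambda>A. \<Sum>k\<in>K. c k * emeasure (M k) A)"

lemma space_mixture [simp]: "space (mixture K c M N) = space N"
  by (simp add: mixture_def)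

lemma sets_mixture [simp, measurable_cong]: "sets (mixture K c M N) = sets N"
  by (simp add: mixture_def)

lemma emeasure_mixture:
  assumes "\<And>k. k \<in> K \<Longrightarrow> sets (M k) = sets N" and "A \<in> sets N"
  shows "emeasure (mixture K c M N) A = (\<Sum>k\<in>K. c k * emeasure (M k) A)"
  unfolding mixture_def
proof (rule emeasure_measure_of_sigma)
  show "sigma_algebra (space N) (sets N)" by (rule sets.sigma_algebra_axioms)
  show "positive (sets N) (\<lambda>A. \<Sum>k\<in>K. c k * emeasure (M k) A)"
    by (simp add: positive_def)
  show "countably_additive (sets N) (\<lambda>A. \<Sum>k\<in>K. c k * emeasure (M k) A)"
  proof (rule countably_additiveI)
    fix A :: "nat \<Rightarrow> _ set"
    assume A: "range A \<subseteq> sets N" "disjoint_family A"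
    have "(\<Sum>i. \<Sum>k\<in>K. c k * emeasure (M k) (A i)) = (\<Sum>k\<in>K. \<Sum>i. c k * emeasure (M k) (A i))"
      by (rule suminf_sum) auto
    also have "\<dots> = (\<Sum>k\<in>K. c k * emeasure (M k) (\<Union>i. A i))"
      using A assms(1) by (intro sum.cong refl) (simp add: suminf_emeasure)
    finally show "(\<Sum>i. \<Sum>k\<in>K. c k * emeasure (M k) (A i)) = (\<Sum>k\<in>K. c k * emeasure (M k) (\<Union>i. A i))" .
  qed
qed fact

lemma nn_integral_mixture:
  assumes M: "\<And>k. k \<in> K \<Longrightarrow> sets (M k) = sets N" and f: "f \<in> borel_measurable N"
  shows "(\<integral>\<^sup>+x. f x \<partial>mixture K c M N) = (\<Sum>k\<in>K. c k * (\<integral>\<^sup>+x. f x \<partial>M k))"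
proof -
  note M [measurable_cong]
  have sp: "space (M k) = space N" if "k \<in> K" for k
    using M[OF that] by (rule sets_eq_imp_space_eq)
  have m: "borel_measurable (M k) = borel_measurable N" if "k \<in> K" for k
    using M[OF that] by (intro measurable_cong_sets) auto
  show ?thesis
    using f
  proof induction
    case (cong f g)
    have "(\<integral>\<^sup>+x. f x \<partial>mixture K c M N) = (\<integral>\<^sup>+x. g x \<partial>mixture K c M N)"
      using cong by (intro nn_integral_cong) simp
    moreover have "(\<Sum>k\<in>K. c k * (\<integral>\<^sup>+x. f x \<partial>M k)) = (\<Sum>k\<in>K. c k * (\<integral>\<^sup>+x. g x \<partial>M k))"
      using cong by (intro sum.cong refl arg_cong2[where f="(*)"] nn_integral_cong) (simp add: sp)
    ultimately show ?case using cong by simp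
  next
    case (set A)
    then show ?case using M by (simp add: emeasure_mixture)
  next
    case (mult u v)
    then show ?case by (simp add: nn_integral_cmult m sum_distrib_left mult_ac)
  next
    case (add u v)
    then show ?case by (simp add: nn_integral_add m sum.distrib distrib_left)
  next
    case (seq U)
    have "(\<integral>\<^sup>+x. (SUP i. U i x) \<partial>mixture K c M N) = (SUP i. \<integral>\<^sup>+x. U i x \<partial>mixture K c M N)"
      using seq by (intro nn_integral_monotone_convergence_SUP) auto
    also have "\<dots> = (SUP i. \<Sum>k\<in>K. c k * (\<integral>\<^sup>+x. U i x \<partial>M k))"
      using seq by simp
    also have "\<dots> = (\<Sum>k\<in>K. (SUP i. c k * (\<integral>\<^sup>+x. U i x \<partial>M k)))"
    proof (rule ennreal_SUP_sum)
      fix k assume "k \<in> K"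
      show "incseq (\<lambda>i. c k * (\<integral>\<^sup>+x. U i x \<partial>M k))"
        using seq by (intro monoI mult_left_mono nn_integral_mono) (auto simp: incseq_def le_fun_def)
    qed
    also have "\<dots> = (\<Sum>k\<in>K. c k * (\<integral>\<^sup>+x. (SUP i. U i x) \<partial>M k))"
      using seq by (intro sum.cong refl)
        (simp add: SUP_mult_left_ennreal[symmetric] nn_integral_monotone_convergence_SUP m)
    finally show ?case by (simp add: SUP_apply image_comp)
  qed
qed

section \<open>Exponential integrals under the Laplace slab\<close>

lemma sets_laplace [simp, measurable_cong]: "sets (laplace \<tau>) = sets borel"
  by (simp add: laplace_def)

lemma space_laplace [simp]: "space (laplace \<tau>) = UNIV"
  by (simp add: laplace_def)

lemma nn_integral_laplace_kernel:
  fixes c m :: real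
  assumes "c > 0"
  shows "(\<integral>\<^sup>+x. ennreal (exp (- c * \<bar>x - m\<bar>)) \<partial>lborel) = ennreal (2 / c)"
proof -
  have half: "(\<integral>\<^sup>+x. ennreal (exp (- c * x)) * indicator {0..} x \<partial>lborel) = ennreal (1 / c)"
  proof -
    have "((\<lambda>x. - exp (- c * x) / c) \<longlongrightarrow> 0) at_top"
    proof -
      have "filterlim (\<lambda>x. - c * x) at_bot at_top"
        using assms by (intro filterlim_tendsto_neg_mult_at_bot[OF tendsto_const] filterlim_ident) auto
      then have "((\<lambda>x. exp (- c * x)) \<longlongrightarrow> 0) at_top"
        by (rule filterlim_compose[OF exp_at_bot])
      from tendsto_divide[OF tendsto_minus[OF this] tendsto_const[of c]] show ?thesis
        using assms by simp
    qed
    then have "(\<integral>\<^sup>+x. ennreal (exp (- c * x)) * indicator {0..} x \<partial>lborel)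
        = ennreal (0 - (- exp (- c * 0) / c))"
      using assms by (intro nn_integral_FTC_atLeast) (auto intro!: derivative_eq_intros)
    then show ?thesis by simp
  qed
  have "(\<integral>\<^sup>+x. ennreal (exp (- c * \<bar>x - m\<bar>)) \<partial>lborel)
      = (\<integral>\<^sup>+x. ennreal (exp (- c * \<bar>x\<bar>)) \<partial>lborel)"
    by (subst nn_integral_real_affine[where c=1 and t=m]) auto
  also have "\<dots> = (\<integral>\<^sup>+x. ennreal (exp (- c * \<bar>x\<bar>)) * indicator {0..} x
        + ennreal (exp (- c * \<bar>x\<bar>)) * indicator {..<0} x \<partial>lborel)"
    by (intro nn_integral_cong) (auto split: split_indicator)
  also have "\<dots> = (\<integral>\<^sup>+x. ennreal (exp (- c * \<bar>x\<bar>)) * indicator {0..} x \<partial>lborel)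
        + (\<integral>\<^sup>+x. ennreal (exp (- c * \<bar>x\<bar>)) * indicator {..<0} x \<partial>lborel)"
    by (intro nn_integral_add) auto
  also have "(\<integral>\<^sup>+x. ennreal (exp (- c * \<bar>x\<bar>)) * indicator {0..} x \<partial>lborel) = ennreal (1 / c)"
    by (subst half[symmetric]) (intro nn_integral_cong, auto split: split_indicator)
  also have "(\<integral>\<^sup>+x. ennreal (exp (- c * \<bar>x\<bar>)) * indicator {..<0} x \<partial>lborel) = ennreal (1 / c)"
  proof -
    have "(\<integral>\<^sup>+x. ennreal (exp (- c * \<bar>x\<bar>)) * indicator {..<0} x \<partial>lborel)
        = (\<integral>\<^sup>+x. ennreal (exp (- c * \<bar>x\<bar>)) * indicator {0<..} x \<partial>lborel)"
      by (subst nn_integral_real_affine[where c="-1" and t=0]) (auto split: split_indicator intro!: nn_integral_cong)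
    \<comment> \<open>Reflection produces the open half-line; the missing endpoint 0 is a null
      set.\<close>
    also have "\<dots> = (\<integral>\<^sup>+x. ennreal (exp (- c * x)) * indicator {0..} x \<partial>lborel)"
      using AE_lborel_singleton[of 0]
      by (intro nn_integral_cong_AE) (auto split: split_indicator)
    finally show ?thesis using half by simp
  qed
  also have "ennreal (1 / c) + ennreal (1 / c) = ennreal (2 / c)"
    using assms by (simp flip: ennreal_plus)
  finally show ?thesis .
qed

lemma nn_integral_laplace:
  assumes [measurable]: "f \<in> borel_measurable borel"
  shows "(\<integral>\<^sup>+x. f x \<partial>laplace \<tau>) = (\<integral>\<^sup>+x. ennreal (\<tau> / 2 * exp (- \<tau> * \<bar>x\<bar>)) * f x \<partial>lborel)"
  by (simp add: laplace_def nn_integral_density)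

lemma prob_space_laplace:
  assumes "\<tau> > 0"
  shows "prob_space (laplace \<tau>)"
proof
  have "emeasure (laplace \<tau>) (space (laplace \<tau>)) = (\<integral>\<^sup>+x. ennreal (\<tau> / 2 * exp (- \<tau> * \<bar>x\<bar>)) \<partial>lborel)"
    by (simp add: laplace_def emeasure_density)
  also have "\<dots> = ennreal (\<tau> / 2) * (\<integral>\<^sup>+x. ennreal (exp (- \<tau> * \<bar>x - 0\<bar>)) \<partial>lborel)"
    using assms by (subst nn_integral_cmult[symmetric]) (auto simp flip: ennreal_mult)
  also have "\<dots> = 1"
    using assms by (subst nn_integral_laplace_kernel) (auto simp flip: ennreal_mult)
  finally show "emeasure (laplace \<tau>) (space (laplace \<tau>)) = 1" .
qed

text \<open>The tilt cancels the decay of the slab at 0 and puts in its place a Laplace kernel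
  centred at \<open>m\<close>. The rate drops to \<tau>/2 because \<open>l1_norm_comparison\<close>
  keeps only half of the l1 distance; the price is the mass 2 instead of 1, the same for every
  \<open>m\<close>. It becomes the factor \<open>2 ^ card S\<close> later on.\<close>

lemma laplace_tilt:
  assumes "\<tau> > 0"
  shows "(\<integral>\<^sup>+x. ennreal (exp (\<tau> * (\<bar>x\<bar> - \<bar>x - m\<bar> / 2))) \<partial>laplace \<tau>) = 2"
proof -
  have "(\<integral>\<^sup>+x. ennreal (exp (\<tau> * (\<bar>x\<bar> - \<bar>x - m\<bar> / 2))) \<partial>laplace \<tau>)
      = (\<integral>\<^sup>+x. ennreal (\<tau> / 2) * ennreal (exp (- (\<tau> / 2) * \<bar>x - m\<bar>)) \<partial>lborel)"
    using assms by (subst nn_integral_laplace)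
      (auto intro!: nn_integral_cong simp: field_simps simp flip: ennreal_mult exp_add)
  also have "\<dots> = ennreal (\<tau> / 2) * ennreal (2 / (\<tau> / 2))"
    using assms by (subst nn_integral_cmult, simp, subst nn_integral_laplace_kernel) auto
  also have "\<dots> = 2"
    using assms by (simp flip: ennreal_mult)
  finally show ?thesis .
qed

lemma emeasure_laplace_interval:
  assumes "\<tau> > 0" "r \<ge> 0"
  shows "emeasure (laplace \<tau>) {m - r..m + r} \<ge> ennreal (\<tau> * r * exp (- \<tau> * (\<bar>m\<bar> + r)))"
proof -
  have "ennreal (\<tau> * r * exp (- \<tau> * (\<bar>m\<bar> + r)))
      = (\<integral>\<^sup>+x. ennreal (\<tau> / 2 * exp (- \<tau> * (\<bar>m\<bar> + r))) * indicator {m - r..m + r} x \<partial>lborel)"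
    using assms by (simp add: nn_integral_cmult_indicator flip: ennreal_mult)
  also have "\<dots> \<le> (\<integral>\<^sup>+x. ennreal (\<tau> / 2 * exp (- \<tau> * \<bar>x\<bar>)) * indicator {m - r..m + r} x \<partial>lborel)"
    using assms by (intro nn_integral_mono) (auto split: split_indicator intro!: ennreal_leI)
  also have "\<dots> = emeasure (laplace \<tau>) {m - r..m + r}"
    by (simp add: laplace_def emeasure_density)
  finally show ?thesis .
qed

section \<open>The spike-and-slab prior as a mixture over supports\<close>

lemma spike_slab_eq_mixture:
  "spike_slab \<tau> l = mixture UNIV (\<lambda>b. if b then ennreal l else ennreal (1 - l))
     (\<lambda>b. if b then laplace \<tau> else return borel 0) borel"
  by (simp add: spike_slab_def mixture_def UNIV_bool add.commute)

lemma sets_spike_slab [simp, measurable_cong]: "sets (spike_slab \<tau> l) = sets borel"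
  by (simp add: spike_slab_eq_mixture)

lemma space_spike_slab [simp]: "space (spike_slab \<tau> l) = UNIV"
  by (simp add: spike_slab_eq_mixture)

lemma emeasure_spike_slab:
  assumes "B \<in> sets borel"
  shows "emeasure (spike_slab \<tau> l) B
    = ennreal l * emeasure (laplace \<tau>) B + ennreal (1 - l) * emeasure (return borel 0) B"
  unfolding spike_slab_eq_mixture using assms by (subst emeasure_mixture) (auto simp: UNIV_bool)

lemma prob_space_spike_slab:
  assumes "\<tau> > 0" "l \<in> {0..1}"
  shows "prob_space (spike_slab \<tau> l)"
proof
  show "emeasure (spike_slab \<tau> l) (space (spike_slab \<tau> l)) = 1"
    using assms prob_space.emeasure_space_1[OF prob_space_laplace[OF assms(1)]]
    by (simp add: emeasure_spike_slab flip: ennreal_plus)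
qed

lemma sets_Gam [simp, measurable_cong]: "sets (Gam p \<tau> S) = sets (\<Pi>\<^sub>M j\<in>{1..p}. borel)"
  unfolding Gam_def by (intro sets_PiM_cong) auto

lemma space_Gam [simp]: "space (Gam p \<tau> S) = {1..p} \<rightarrow>\<^sub>E UNIV"
  by (subst sets_eq_imp_space_eq[OF sets_Gam]) (simp add: space_PiM)

lemma sets_prior [simp, measurable_cong]: "sets (prior p \<tau> l) = sets (\<Pi>\<^sub>M j\<in>{1..p}. borel)"
  unfolding prior_def by (intro sets_PiM_cong) auto

lemma space_prior [simp]: "space (prior p \<tau> l) = {1..p} \<rightarrow>\<^sub>E UNIV"
  by (subst sets_eq_imp_space_eq[OF sets_prior]) (simp add: space_PiM)

lemma product_sigma_finite_slab:
  assumes "\<tau> > 0"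
  shows "product_sigma_finite (\<lambda>j. if j \<in> S then laplace \<tau> else return borel 0)"
  by (intro product_prob_space.axioms(1) product_prob_spaceI)
    (auto intro: prob_space_laplace[OF assms] prob_space_return)

lemma prob_space_Gam:
  assumes "\<tau> > 0"
  shows "prob_space (Gam p \<tau> S)"
  unfolding Gam_def by (intro prob_space_PiM) (auto intro: prob_space_laplace[OF assms] prob_space_return)

lemma prob_space_prior:
  assumes "\<tau> > 0" "l \<in> {0..1}"
  shows "prob_space (prior p \<tau> l)"
  unfolding prior_def by (intro prob_space_PiM prob_space_spike_slab assms)

lemma nu_nonneg: "l \<in> {0..1} \<Longrightarrow> nu p l S \<ge> 0"
  by (simp add: nu_def)

text \<open>A product measure is determined by its values on boxes. There the prior is a product of
  two-term sums, one term for the slab and one for the spike, and expanding the product amounts to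
  choosing the set of coordinates that take the slab term.\<close>

lemma prior_eq_mixture:
  assumes \<tau>: "\<tau> > 0" and l: "l \<in> {0..1}"
  shows "prior p \<tau> l = mixture (Pow {1..p}) (\<lambda>S. ennreal (nu p l S)) (Gam p \<tau>) (\<Pi>\<^sub>M j\<in>{1..p}. borel)"
    (is "_ = ?N")
proof -
  interpret P: product_prob_space "\<lambda>_. spike_slab \<tau> l" "{1..p}"
    by (intro product_prob_spaceI prob_space_spike_slab assms)
  have "?N = (\<Pi>\<^sub>M j\<in>{1..p}. spike_slab \<tau> l)"
  proof (rule P.PiM_eqI)
    fix A :: "nat \<Rightarrow> real set"
    assume A: "\<And>i. i \<in> {1..p} \<Longrightarrow> A i \<in> sets (spike_slab \<tau> l)"
    define L where "L j = emeasure (laplace \<tau>) (A j)" for j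
    define R where "R j = emeasure (return borel (0::real)) (A j)" for j
    have G: "emeasure (Gam p \<tau> S) (Pi\<^sub>E {1..p} A) = prod L S * prod R ({1..p} - S)"
      if "S \<subseteq> {1..p}" for S
    proof -
      interpret S: product_sigma_finite "\<lambda>j. if j \<in> S then laplace \<tau> else return borel 0"
        by (rule product_sigma_finite_slab[OF \<tau>])
      have "emeasure (Gam p \<tau> S) (Pi\<^sub>E {1..p} A)
          = (\<Prod>j\<in>{1..p}. emeasure (if j \<in> S then laplace \<tau> else return borel 0) (A j))"
        unfolding Gam_def using A by (intro S.emeasure_PiM) auto
      also have "\<dots> = (\<Prod>j\<in>S. emeasure (if j \<in> S then laplace \<tau> else return borel 0) (A j)) *
          (\<Prod>j\<in>{1..p} - S. emeasure (if j \<in> S then laplace \<tau> else return borel 0) (A j))"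
        using that by (subst mult.commute, intro prod.subset_diff) auto
      also have "\<dots> = prod L S * prod R ({1..p} - S)"
        by (intro arg_cong2[where f="(*)"] prod.cong) (auto simp: L_def R_def)
      finally show ?thesis .
    qed
    have "emeasure ?N (Pi\<^sub>E {1..p} A) = (\<Sum>S\<in>Pow {1..p}. ennreal (nu p l S) * emeasure (Gam p \<tau> S) (Pi\<^sub>E {1..p} A))"
      using A by (intro emeasure_mixture sets_PiM_I_finite) auto
    also have "\<dots> = (\<Sum>S\<in>Pow {1..p}. (\<Prod>j\<in>S. ennreal l * L j) * (\<Prod>j\<in>{1..p}-S. ennreal (1 - l) * R j))"
    proof (rule sum.cong)
      fix S assume "S \<in> Pow {1..p}"
      then have "card ({1..p} - S) = p - card S" "S \<subseteq> {1..p}"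
        by (auto simp: card_Diff_subset finite_subset)
      then show "ennreal (nu p l S) * emeasure (Gam p \<tau> S) (Pi\<^sub>E {1..p} A)
          = (\<Prod>j\<in>S. ennreal l * L j) * (\<Prod>j\<in>{1..p}-S. ennreal (1 - l) * R j)"
        using l unfolding G[OF \<open>S \<subseteq> {1..p}\<close>]
        by (simp only: nu_def prod.distrib prod_constant \<open>card ({1..p} - S) = p - card S\<close>)
          (simp add: ennreal_mult ennreal_power mult_ac)
    qed simp
    also have "\<dots> = (\<Prod>j\<in>{1..p}. ennreal l * L j + ennreal (1 - l) * R j)"
      by (subst prod_add) auto
    also have "\<dots> = (\<Prod>j\<in>{1..p}. emeasure (spike_slab \<tau> l) (A j))"
      using A by (intro prod.cong) (auto simp: emeasure_spike_slab L_def R_def)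
    finally show "emeasure ?N (Pi\<^sub>E {1..p} A) = (\<Prod>j\<in>{1..p}. emeasure (spike_slab \<tau> l) (A j))" .
  next
    show "sets ?N = sets (\<Pi>\<^sub>M j\<in>{1..p}. spike_slab \<tau> l)"
      by (simp only: sets_mixture, intro sets_PiM_cong) auto
  qed simp
  then show ?thesis by (simp add: prior_def)
qed

lemma nn_integral_prior:
  assumes "\<tau> > 0" "l \<in> {0..1}" and "f \<in> borel_measurable (\<Pi>\<^sub>M j\<in>{1..p}. borel)"
  shows "(\<integral>\<^sup>+\<theta>. f \<theta> \<partial>prior p \<tau> l)
    = (\<Sum>S\<in>Pow {1..p}. ennreal (nu p l S) * (\<integral>\<^sup>+\<theta>. f \<theta> \<partial>Gam p \<tau> S))"
  unfolding prior_eq_mixture[OF assms(1,2)] using assms(3) by (intro nn_integral_mixture) auto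

text \<open>Needed because the error bound of the test is available for \<theta> in
  \<open>Theta p S\<close> only, whereas integrals against \<open>Gam p \<tau> S\<close> run over
  all vectors.\<close>

lemma AE_Gam_Theta:
  assumes "\<tau> > 0"
  shows "AE \<theta> in Gam p \<tau> S. \<theta> \<in> Theta p S"
proof -
  have "AE \<theta> in Gam p \<tau> S. \<theta> j = 0" if "j \<in> {1..p} - S" for j
    unfolding Gam_def using that
    by (intro AE_PiM_component) (auto intro: prob_space_laplace[OF assms] prob_space_return simp: AE_return)
  then have "AE \<theta> in Gam p \<tau> S. \<forall>j\<in>{1..p} - S. \<theta> j = 0"
    by (intro AE_finite_allI) auto
  moreover have "AE \<theta> in Gam p \<tau> S. \<theta> \<in> {1..p} \<rightarrow>\<^sub>E UNIV"
    using AE_space[of "Gam p \<tau> S"] by simp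
  ultimately show ?thesis
    by eventually_elim (simp add: Theta_def)
qed

lemma Theta_measurable [measurable]: "Theta p S \<in> sets (\<Pi>\<^sub>M j\<in>{1..p}. borel)"
proof -
  have "Theta p S = {\<theta> \<in> space (\<Pi>\<^sub>M j\<in>{1..p}. borel :: real measure). \<forall>j\<in>{1..p} - S. \<theta> j = 0}"
    by (auto simp: Theta_def space_PiM)
  also have "\<dots> \<in> sets (\<Pi>\<^sub>M j\<in>{1..p}. borel)"
    by measurable
  finally show ?thesis .
qed

subsection \<open>Gaussian sampling measures\<close>

definition dot :: "'i set \<Rightarrow> ('i \<Rightarrow> real) \<Rightarrow> ('i \<Rightarrow> real) \<Rightarrow> real" where
  "dot I u v = (\<Sum>i\<in>I. u i * v i)"

lemma dot_self_nonneg [simp]: "dot I v v \<ge> 0"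
  by (simp add: dot_def sum_nonneg)

lemma dot_commute: "dot I u v = dot I v u"
  by (simp add: dot_def mult.commute)

lemma dot_cmult_left: "dot I (\<lambda>i. c * u i) v = c * dot I u v"
  by (simp add: dot_def sum_distrib_left mult_ac)

lemma dot_cmult_right: "dot I u (\<lambda>i. c * v i) = c * dot I u v"
  by (simp add: dot_def sum_distrib_left mult_ac)

lemma dot_diff_left: "dot I (\<lambda>i. u i - w i) v = dot I u v - dot I w v"
  by (simp add: dot_def sum_subtractf left_diff_distrib)

lemma dot_sum_left: "dot I (\<lambda>i. \<Sum>k\<in>K. u k i) v = (\<Sum>k\<in>K. dot I (u k) v)"
  unfolding dot_def by (subst sum.swap) (simp add: sum_distrib_right)

lemma dot_sum_right: "dot I u (\<lambda>i. \<Sum>k\<in>K. v k i) = (\<Sum>k\<in>K. dot I u (v k))"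
  unfolding dot_def by (subst sum.swap) (simp add: sum_distrib_left)

lemma dot_cong: "(\<And>i. i \<in> I \<Longrightarrow> u i = u' i) \<Longrightarrow> (\<And>i. i \<in> I \<Longrightarrow> v i = v' i) \<Longrightarrow> dot I u v = dot I u' v'"
  unfolding dot_def by (intro sum.cong) auto

lemma L2_set_power2_eq_dot: "(L2_set u I)\<^sup>2 = dot I u u"
  by (simp add: L2_set_def dot_def sum_nonneg power2_eq_square)

lemma dot_self_eq_0: "finite I \<Longrightarrow> dot I v v = 0 \<Longrightarrow> i \<in> I \<Longrightarrow> v i = 0"
  unfolding dot_def by (subst (asm) sum_nonneg_eq_0_iff) auto

lemma dot_measurable [measurable]:
  "(\<lambda>y. dot I v (\<lambda>i. y i - m i)) \<in> borel_measurable (\<Pi>\<^sub>M i\<in>I. borel)"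
  unfolding dot_def by measurable

definition orthonormal_on :: "'i set \<Rightarrow> 'k set \<Rightarrow> ('k \<Rightarrow> 'i \<Rightarrow> real) \<Rightarrow> bool" where
  "orthonormal_on I K e \<longleftrightarrow> (\<forall>k\<in>K. \<forall>l\<in>K. dot I (e k) (e l) = (if k = l then 1 else 0))"

lemma dot_orthonormal_sum:
  assumes "orthonormal_on I K e" "finite K"
  shows "dot I (\<lambda>i. \<Sum>k\<in>K. c k * e k i) (\<lambda>i. \<Sum>k\<in>K. c k * e k i) = (\<Sum>k\<in>K. (c k)\<^sup>2)"
proof -
  have "dot I (\<lambda>i. \<Sum>k\<in>K. c k * e k i) (\<lambda>i. \<Sum>k\<in>K. c k * e k i)
      = (\<Sum>k\<in>K. \<Sum>l\<in>K. c k * c l * dot I (e k) (e l))"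
    by (simp add: dot_sum_left dot_sum_right dot_cmult_left dot_cmult_right sum_distrib_left mult_ac)
  also have "\<dots> = (\<Sum>k\<in>K. \<Sum>l\<in>K. if k = l then c k * c l else 0)"
    using assms(1) by (intro sum.cong refl) (simp add: orthonormal_on_def)
  also have "\<dots> = (\<Sum>k\<in>K. (c k)\<^sup>2)"
    using assms(2) by (simp add: power2_eq_square)
  finally show ?thesis .
qed

text \<open>Columns may be linearly dependent, so the new vectors are indexed by a subset
  \<open>K\<close> of \<open>J\<close>: a column whose residual vanishes contributes none. The
  inclusion bounds the dimension of the span by \<open>card J\<close>, which is all that the
  chi-square bound asks for.\<close>

lemma gram_schmidt:
  fixes x :: "'k \<Rightarrow> 'i \<Rightarrow> real"
  assumes "finite I" "finite J"
  obtains K e where "K \<subseteq> J" "orthonormal_on I K e"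
    "\<And>j. j \<in> J \<Longrightarrow> \<exists>c. \<forall>i\<in>I. x j i = (\<Sum>k\<in>K. c k * e k i)"
proof -
  have "\<exists>K e. K \<subseteq> J \<and> orthonormal_on I K e \<and> (\<forall>j\<in>J. \<exists>c. \<forall>i\<in>I. x j i = (\<Sum>k\<in>K. c k * e k i))"
    using \<open>finite J\<close>
  proof induction
    case empty
    then show ?case by (auto simp: orthonormal_on_def)
  next
    case (insert j J)
    then obtain K e where K: "K \<subseteq> J" "orthonormal_on I K e"
      and sp: "\<And>j. j \<in> J \<Longrightarrow> \<exists>c. \<forall>i\<in>I. x j i = (\<Sum>k\<in>K. c k * e k i)" by blast
    have fK: "finite K" using K insert finite_subset by blast
    have jK: "j \<notin> K" using K insert by blast
    define a where "a k = dot I (x j) (e k)" for k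
    define r where "r i = x j i - (\<Sum>k\<in>K. a k * e k i)" for i
    have ro: "dot I r (e l) = 0" if "l \<in> K" for l
    proof -
      have "dot I r (e l) = a l - (\<Sum>k\<in>K. a k * dot I (e k) (e l))"
        unfolding r_def by (simp add: dot_diff_left dot_sum_left dot_cmult_left a_def)
      also have "(\<Sum>k\<in>K. a k * dot I (e k) (e l)) = (\<Sum>k\<in>K. if k = l then a k else 0)"
        using K(2) that by (intro sum.cong refl) (simp add: orthonormal_on_def)
      finally show ?thesis using fK that by simp
    qed
    show ?case
    proof (cases "dot I r r = 0")
      case True
      then have "\<forall>i\<in>I. x j i = (\<Sum>k\<in>K. a k * e k i)"
        using dot_self_eq_0[OF \<open>finite I\<close> True] by (auto simp: r_def)
      then show ?thesis using K sp by (intro exI[of _ K] exI[of _ e]) auto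
    next
      case False
      define s where "s = sqrt (dot I r r)"
      have s: "s > 0" "s * s = dot I r r"
        using False by (auto simp: s_def order.not_eq_order_implies_strict)
      define e' where "e' = e(j := \<lambda>i. 1 / s * r i)"
      have e': "e' k = e k" if "k \<in> K" for k
        using that jK by (auto simp: e'_def)
      have e'j: "e' j = (\<lambda>i. 1 / s * r i)" by (simp add: e'_def)
      have 1: "dot I (e' j) (e' j) = 1"
        using s(1) by (simp only: e'j dot_cmult_left dot_cmult_right s(2)[symmetric]) simp
      have 2: "dot I (e' j) (e' l) = 0" "dot I (e' l) (e' j) = 0" if "l \<in> K" for l
        unfolding e'[OF that] e'j
        by (simp_all only: dot_cmult_left dot_cmult_right ro[OF that] dot_commute[of I "e l" r] mult_zero_right)
      have on: "orthonormal_on I (insert j K) e'"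
        unfolding orthonormal_on_def using K(2) 1 2 jK by (auto simp: orthonormal_on_def e')
      have sp1: "\<exists>c. \<forall>i\<in>I. x j' i = (\<Sum>k\<in>insert j K. c k * e' k i)" if "j' \<in> insert j J" for j'
      proof (cases "j' = j")
        case True
        \<comment> \<open>The new vector is the residual divided by its length \<open>s\<close>, so
          its coefficient is \<open>s\<close>; columns treated before get coefficient 0 at
          \<open>j\<close>.\<close>
        have "x j i = (\<Sum>k\<in>insert j K. (a(j := s)) k * e' k i)" for i
        proof -
          have "(\<Sum>k\<in>insert j K. (a(j := s)) k * e' k i) = r i + (\<Sum>k\<in>K. (a(j := s)) k * e' k i)"
            using fK jK s by (simp add: e'j)
          also have "(\<Sum>k\<in>K. (a(j := s)) k * e' k i) = (\<Sum>k\<in>K. a k * e k i)"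
            using jK by (intro sum.cong) (auto simp: e')
          finally show ?thesis by (simp add: r_def)
        qed
        then show ?thesis using True by blast
      next
        case False
        then obtain c where c: "\<forall>i\<in>I. x j' i = (\<Sum>k\<in>K. c k * e k i)" using sp \<open>j' \<in> insert j J\<close> by blast
        have "(\<Sum>k\<in>insert j K. (c(j := 0)) k * e' k i) = (\<Sum>k\<in>K. c k * e k i)" for i
          using fK jK by (simp add: e') (intro sum.cong, auto)
        then show ?thesis using c by metis
      qed
      show ?thesis
        using K(1) on sp1 by (intro exI[of _ "insert j K"] exI[of _ e']) auto
    qed
  qed
  then show ?thesis using that by blast
qed

section \<open>Product Gaussian measures: shifts and exponential moments\<close>

definition gauss :: "'i set \<Rightarrow> ('i \<Rightarrow> real) \<Rightarrow> ('i \<Rightarrow> real) measure" where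
  "gauss I m = (\<Pi>\<^sub>M i\<in>I. density lborel (\<lambda>y. ennreal (normal_density (m i) 1 y)))"

lemma sets_gauss [simp, measurable_cong]: "sets (gauss I m) = sets (\<Pi>\<^sub>M i\<in>I. borel)"
  unfolding gauss_def by (intro sets_PiM_cong) auto

lemma space_gauss [simp]: "space (gauss I m) = I \<rightarrow>\<^sub>E UNIV"
  by (subst sets_eq_imp_space_eq[OF sets_gauss]) (simp add: space_PiM)

lemma product_prob_space_gauss:
  "product_prob_space (\<lambda>i. density lborel (\<lambda>y. ennreal (normal_density (m i) 1 y)))"
  by (intro product_prob_spaceI prob_space_normal_density) auto

lemma prob_space_gauss: "prob_space (gauss I m)"
  unfolding gauss_def by (intro prob_space_PiM prob_space_normal_density) auto

lemma normal_density_shift: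
  "normal_density (m + v) 1 y = normal_density m 1 y * exp (v * (y - m) - v\<^sup>2 / 2)"
  by (simp add: normal_density_def mult_exp_exp power2_eq_square field_simps)

text \<open>The Cameron-Martin formula in finite dimension. On a box both sides factor over the
  coordinates, and each factor is the one-dimensional \<open>normal_density_shift\<close>.\<close>

lemma gauss_shift:
  assumes "finite I"
  shows "gauss I (\<lambda>i. m i + v i)
    = density (gauss I m) (\<lambda>y. ennreal (exp (dot I v (\<lambda>i. y i - m i) - dot I v v / 2)))"
proof -
  interpret P: product_prob_space "\<lambda>i. density lborel (\<lambda>y. ennreal (normal_density (m i + v i) 1 y))" I
    by (rule product_prob_space_gauss)
  interpret Q: product_prob_space "\<lambda>i. density lborel (\<lambda>y. ennreal (normal_density (m i) 1 y))" I
    by (rule product_prob_space_gauss)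
  let ?D = "density (gauss I m) (\<lambda>y. ennreal (exp (dot I v (\<lambda>i. y i - m i) - dot I v v / 2)))"
  have "?D = (\<Pi>\<^sub>M i\<in>I. density lborel (\<lambda>y. ennreal (normal_density (m i + v i) 1 y)))"
  proof (rule P.PiM_eqI)
    show "sets ?D = sets (\<Pi>\<^sub>M i\<in>I. density lborel (\<lambda>y. ennreal (normal_density (m i + v i) 1 y)))"
      by (simp, intro sets_PiM_cong) auto
    fix A assume A0: "\<And>i. i \<in> I \<Longrightarrow> A i \<in> sets (density lborel (\<lambda>y. ennreal (normal_density (m i + v i) 1 y)))"
    then have A [measurable]: "A i \<in> sets borel" if "i \<in> I" for i using that by simp
    have box: "Pi\<^sub>E I A \<in> sets (gauss I m)"
      using A assms by (simp add: sets_PiM_I_finite)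
    have "emeasure ?D (Pi\<^sub>E I A)
        = (\<integral>\<^sup>+y. ennreal (exp (dot I v (\<lambda>i. y i - m i) - dot I v v / 2)) * indicator (Pi\<^sub>E I A) y \<partial>gauss I m)"
      using box by (simp add: emeasure_density)
    also have "\<dots> = (\<integral>\<^sup>+y. (\<Prod>i\<in>I. ennreal (exp (v i * (y i - m i) - (v i)\<^sup>2 / 2)) * indicator (A i) (y i)) \<partial>gauss I m)"
    proof (rule nn_integral_cong)
      fix y assume y: "y \<in> space (gauss I m)"
      have e: "exp (dot I v (\<lambda>i. y i - m i) - dot I v v / 2) = (\<Prod>i\<in>I. exp (v i * (y i - m i) - (v i)\<^sup>2 / 2))"
        using assms by (simp add: dot_def exp_sum[symmetric] sum_subtractf sum_divide_distrib power2_eq_square)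
      have i: "indicator (Pi\<^sub>E I A) y = (\<Prod>i\<in>I. indicator (A i) (y i) :: ennreal)"
        using y assms by (auto simp: indicator_def PiE_iff prod_zero_iff split: if_splits)
      show "ennreal (exp (dot I v (\<lambda>i. y i - m i) - dot I v v / 2)) * indicator (Pi\<^sub>E I A) y
        = (\<Prod>i\<in>I. ennreal (exp (v i * (y i - m i) - (v i)\<^sup>2 / 2)) * indicator (A i) (y i))"
        unfolding e i by (simp add: prod.distrib prod_ennreal)
    qed
    also have "\<dots> = (\<Prod>i\<in>I. \<integral>\<^sup>+y. ennreal (exp (v i * (y - m i) - (v i)\<^sup>2 / 2)) * indicator (A i) y
        \<partial>density lborel (\<lambda>y. ennreal (normal_density (m i) 1 y)))"
      unfolding gauss_def using assms by (intro Q.product_nn_integral_prod) auto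
    also have "\<dots> = (\<Prod>i\<in>I. emeasure (density lborel (\<lambda>y. ennreal (normal_density (m i + v i) 1 y))) (A i))"
    proof (rule prod.cong)
      fix i assume [simp]: "i \<in> I"
      show "(\<integral>\<^sup>+y. ennreal (exp (v i * (y - m i) - (v i)\<^sup>2 / 2)) * indicator (A i) y
        \<partial>density lborel (\<lambda>y. ennreal (normal_density (m i) 1 y)))
        = emeasure (density lborel (\<lambda>y. ennreal (normal_density (m i + v i) 1 y))) (A i)"
        by (simp add: nn_integral_density emeasure_density normal_density_shift ennreal_mult mult.assoc)
    qed simp
    finally show "emeasure ?D (Pi\<^sub>E I A)
      = (\<Prod>i\<in>I. emeasure (density lborel (\<lambda>y. ennreal (normal_density (m i + v i) 1 y))) (A i))" .
  qed (fact assms)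
  then show ?thesis by (simp add: gauss_def)
qed

text \<open>No integral is computed: the shifted Gaussian has total mass one, and by
  \<open>gauss_shift\<close> this mass is the moment generating function up to the factor exp (-
  |v|^2 / 2).\<close>

lemma gauss_mgf:
  assumes "finite I"
  shows "(\<integral>\<^sup>+y. ennreal (exp (dot I v (\<lambda>i. y i - m i))) \<partial>gauss I m) = ennreal (exp (dot I v v / 2))"
proof -
  have "1 = (\<integral>\<^sup>+y. 1 \<partial>gauss I (\<lambda>i. m i + v i))"
    using prob_space.emeasure_space_1[OF prob_space_gauss] by simp
  also have "\<dots> = (\<integral>\<^sup>+y. ennreal (exp (dot I v (\<lambda>i. y i - m i) - dot I v v / 2)) \<partial>gauss I m)"
    unfolding gauss_shift[OF assms] by (subst nn_integral_density) auto
  finally have one: "(\<integral>\<^sup>+y. ennreal (exp (dot I v (\<lambda>i. y i - m i) - dot I v v / 2)) \<partial>gauss I m) = 1" ..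
  have "(\<integral>\<^sup>+y. ennreal (exp (dot I v (\<lambda>i. y i - m i))) \<partial>gauss I m)
      = (\<integral>\<^sup>+y. ennreal (exp (dot I v v / 2)) * ennreal (exp (dot I v (\<lambda>i. y i - m i) - dot I v v / 2)) \<partial>gauss I m)"
    by (intro nn_integral_cong) (simp add: mult_exp_exp flip: ennreal_mult)
  also have "\<dots> = ennreal (exp (dot I v v / 2))"
    by (simp add: nn_integral_cmult one)
  finally show ?thesis .
qed

text \<open>The exponents - x^2 / 2 and x^2 / 4 add up to that of a normal density of variance 2,
  whose normalization differs by the factor \<open>sqrt 2\<close>.\<close>

lemma std_normal_chi_square_mgf:
  "(\<integral>\<^sup>+x. ennreal (exp (x\<^sup>2 / 4)) \<partial>density lborel (\<lambda>y. ennreal (std_normal_density y))) = ennreal (sqrt 2)"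
proof -
  have "(\<integral>\<^sup>+x. ennreal (exp (x\<^sup>2 / 4)) \<partial>density lborel (\<lambda>y. ennreal (std_normal_density y)))
      = (\<integral>\<^sup>+x. ennreal (sqrt 2) * ennreal (normal_density 0 (sqrt 2) x) \<partial>lborel)"
    by (subst nn_integral_density)
      (auto intro!: nn_integral_cong simp: normal_density_def mult_exp_exp real_sqrt_mult field_simps simp flip: ennreal_mult)
  also have "\<dots> = ennreal (sqrt 2) * (\<integral>\<^sup>+x. ennreal (normal_density 0 (sqrt 2) x) \<partial>lborel)"
    by (intro nn_integral_cmult) simp
  also have "(\<integral>\<^sup>+x. ennreal (normal_density 0 (sqrt 2) x) \<partial>lborel) = 1"
    by (subst nn_integral_eq_integral) auto
  finally show ?thesis by simp
qed

text \<open>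
  Writing \<open>exp (t\<^sup>2 / 4)\<close> as the moment generating function of an auxiliary standard normal variable at
  \<open>t / sqrt 2\<close> makes the exponent linear in \<open>y\<close>, so that no rotation invariance is needed.
\<close>

lemma gauss_chi_square_mgf:
  fixes e :: "'k \<Rightarrow> 'i \<Rightarrow> real"
  assumes "finite I" "finite K" and on: "orthonormal_on I K e"
  shows "(\<integral>\<^sup>+y. ennreal (exp ((\<Sum>k\<in>K. (dot I (e k) (\<lambda>i. y i - m i))\<^sup>2) / 4)) \<partial>gauss I m)
    = ennreal (sqrt 2 ^ card K)"
proof -
  let ?t = "\<lambda>y k. dot I (e k) (\<lambda>i. y i - m i)"
  let ?G = "gauss K (\<lambda>_. 0)"
  interpret G: prob_space ?G by (rule prob_space_gauss)
  interpret Y: prob_space "gauss I m" by (rule prob_space_gauss)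
  interpret YG: pair_sigma_finite "gauss I m" ?G ..
  interpret Q: product_prob_space "\<lambda>k::'k. density lborel (\<lambda>y. ennreal (std_normal_density y))" K
    by (rule product_prob_space_gauss)
  have "(\<integral>\<^sup>+y. ennreal (exp ((\<Sum>k\<in>K. (?t y k)\<^sup>2) / 4)) \<partial>gauss I m)
      = (\<integral>\<^sup>+y. \<integral>\<^sup>+g. ennreal (exp (\<Sum>k\<in>K. ?t y k * g k / sqrt 2)) \<partial>?G \<partial>gauss I m)"
  proof (intro nn_integral_cong)
    fix y
    have "(\<integral>\<^sup>+g. ennreal (exp (\<Sum>k\<in>K. ?t y k * g k / sqrt 2)) \<partial>?G)
        = (\<integral>\<^sup>+g. ennreal (exp (dot K (\<lambda>k. ?t y k / sqrt 2) (\<lambda>k. g k - 0))) \<partial>?G)"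
      by (simp add: dot_def)
    also have "\<dots> = ennreal (exp ((\<Sum>k\<in>K. (?t y k)\<^sup>2) / 4))"
      by (subst gauss_mgf[OF \<open>finite K\<close>]) (simp add: dot_def[of K] sum_divide_distrib power2_eq_square)
    finally show "ennreal (exp ((\<Sum>k\<in>K. (?t y k)\<^sup>2) / 4)) = (\<integral>\<^sup>+g. ennreal (exp (\<Sum>k\<in>K. ?t y k * g k / sqrt 2)) \<partial>?G)" ..
  qed
  also have "\<dots> = (\<integral>\<^sup>+g. \<integral>\<^sup>+y. ennreal (exp (\<Sum>k\<in>K. ?t y k * g k / sqrt 2)) \<partial>gauss I m \<partial>?G)"
    by (rule YG.Fubini'[symmetric]) measurable
  also have "\<dots> = (\<integral>\<^sup>+g. (\<Prod>k\<in>K. ennreal (exp ((g k)\<^sup>2 / 4))) \<partial>?G)"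
  proof (intro nn_integral_cong)
    fix g :: "'k \<Rightarrow> real"
    let ?v = "\<lambda>i. \<Sum>k\<in>K. (g k / sqrt 2) * e k i"
    have "(\<integral>\<^sup>+y. ennreal (exp (\<Sum>k\<in>K. ?t y k * g k / sqrt 2)) \<partial>gauss I m)
        = (\<integral>\<^sup>+y. ennreal (exp (dot I ?v (\<lambda>i. y i - m i))) \<partial>gauss I m)"
      by (simp only: dot_sum_left dot_cmult_left) (simp add: mult_ac)
    also have "\<dots> = ennreal (exp (dot I ?v ?v / 2))"
      by (rule gauss_mgf[OF \<open>finite I\<close>])
    \<comment> \<open>Orthonormality enters here: half the squared norm of \<open>?v\<close> is the
      sum of the \<open>(g k)\<^sup>2 / 4\<close>, so the same exponential of squares reappears, now
      in independent standard normal variables.\<close>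
    also have "\<dots> = (\<Prod>k\<in>K. ennreal (exp ((g k)\<^sup>2 / 4)))"
      by (simp only: dot_orthonormal_sum[OF on \<open>finite K\<close>])
        (simp add: prod_ennreal exp_sum[OF \<open>finite K\<close>, symmetric] sum_divide_distrib power_divide)
    finally show "(\<integral>\<^sup>+y. ennreal (exp (\<Sum>k\<in>K. ?t y k * g k / sqrt 2)) \<partial>gauss I m)
        = (\<Prod>k\<in>K. ennreal (exp ((g k)\<^sup>2 / 4)))" .
  qed
  also have "\<dots> = (\<Prod>k\<in>K. ennreal (sqrt 2))"
    unfolding gauss_def using \<open>finite K\<close>
    by (subst Q.product_nn_integral_prod) (auto simp: std_normal_chi_square_mgf)
  also have "\<dots> = ennreal (sqrt 2 ^ card K)"
    by (simp add: ennreal_power)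
  finally show ?thesis .
qed

text \<open>\<open>T z\<close> is the squared length of the projection of \<open>z\<close> onto the
  span of the \<open>x j\<close>. Two of its properties do the work: the Cauchy-Schwarz bound
  against vectors of the span governs the second error of the test, the exponential moment governs
  the first.\<close>

lemma projection_statistic:
  fixes x :: "'k \<Rightarrow> 'i \<Rightarrow> real"
  assumes "finite I" "finite J"
  obtains T :: "('i \<Rightarrow> real) \<Rightarrow> real" where
    "\<And>m. (\<lambda>y. T (\<lambda>i. y i - m i)) \<in> borel_measurable (\<Pi>\<^sub>M i\<in>I. borel)"
    "\<And>z. T z \<ge> 0"
    "\<And>u z. (dot I (\<lambda>i. \<Sum>j\<in>J. u j * x j i) z)\<^sup>2
        \<le> dot I (\<lambda>i. \<Sum>j\<in>J. u j * x j i) (\<lambda>i. \<Sum>j\<in>J. u j * x j i) * T z"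
    "\<And>m. (\<integral>\<^sup>+y. ennreal (exp (T (\<lambda>i. y i - m i) / 4)) \<partial>gauss I m) \<le> ennreal (sqrt 2 ^ card J)"
proof -
  obtain K e where K: "K \<subseteq> J" and on: "orthonormal_on I K e"
    and sp: "\<And>j. j \<in> J \<Longrightarrow> \<exists>c. \<forall>i\<in>I. x j i = (\<Sum>k\<in>K. c k * e k i)"
    using gram_schmidt[OF assms, of x] by metis
  have fK: "finite K" using K assms finite_subset by blast
  obtain c where c: "\<And>j i. j \<in> J \<Longrightarrow> i \<in> I \<Longrightarrow> x j i = (\<Sum>k\<in>K. c j k * e k i)"
    using sp by metis
  define T where "T z = (\<Sum>k\<in>K. (dot I (e k) z)\<^sup>2)" for z
  show ?thesis
  proof (rule that)
    show "(\<lambda>y. T (\<lambda>i. y i - m i)) \<in> borel_measurable (\<Pi>\<^sub>M i\<in>I. borel)" for m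
      unfolding T_def by measurable
    show "T z \<ge> 0" for z by (simp add: T_def sum_nonneg)
    show "(\<integral>\<^sup>+y. ennreal (exp (T (\<lambda>i. y i - m i) / 4)) \<partial>gauss I m) \<le> ennreal (sqrt 2 ^ card J)" for m
      unfolding T_def gauss_chi_square_mgf[OF assms(1) fK on]
      using K assms(2) by (intro ennreal_leI power_increasing card_mono) auto
    fix u z
    let ?v = "\<lambda>i. \<Sum>j\<in>J. u j * x j i"
    define d where "d k = (\<Sum>j\<in>J. u j * c j k)" for k
    let ?w = "\<lambda>i. \<Sum>k\<in>K. d k * e k i"
    have vw: "?v i = ?w i" if "i \<in> I" for i
    proof -
      have "?v i = (\<Sum>j\<in>J. \<Sum>k\<in>K. u j * c j k * e k i)"
        using c that by (simp add: sum_distrib_left mult_ac)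
      also have "\<dots> = ?w i"
        by (subst sum.swap) (simp add: d_def sum_distrib_right)
      finally show ?thesis .
    qed
    have "dot I ?v z = (\<Sum>k\<in>K. d k * dot I (e k) z)"
      by (subst dot_cong[OF vw refl]) (simp_all add: dot_sum_left dot_cmult_left)
    moreover have "dot I ?v ?v = (\<Sum>k\<in>K. (d k)\<^sup>2)"
      by (subst dot_cong[OF vw vw]) (simp_all add: dot_orthonormal_sum[OF on fK])
    ultimately show "(dot I ?v z)\<^sup>2 \<le> dot I ?v ?v * T z"
      unfolding T_def using Cauchy_Schwarz_ineq_sum[of d "\<lambda>k. dot I (e k) z" K] by simp
  qed
qed

subsection \<open>Sparse regression and the test\<close>

lemma sampling_eq_gauss: "sampling n p X \<theta> = gauss {1..n} (design_mult p X \<theta>)"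
  by (simp add: sampling_def gauss_def)

lemma sets_sampling [simp, measurable_cong]: "sets (sampling n p X \<theta>) = sets (\<Pi>\<^sub>M i\<in>{1..n}. borel)"
  by (simp add: sampling_eq_gauss)

lemma space_sampling [simp]: "space (sampling n p X \<theta>) = {1..n} \<rightarrow>\<^sub>E UNIV"
  by (simp add: sampling_eq_gauss)

lemma prob_space_sampling: "prob_space (sampling n p X \<theta>)"
  by (simp add: sampling_eq_gauss prob_space_gauss)

lemma design_mult_diff:
  "design_mult p X (\<lambda>j. \<theta> j - \<theta>' j) i = design_mult p X \<theta> i - design_mult p X \<theta>' i"
  by (simp add: design_mult_def right_diff_distrib sum_subtractf)

lemma pred_dist_nonneg [simp]: "pred_dist n p X \<theta> \<theta>' \<ge> 0"
  by (simp add: pred_dist_def L2_set_nonneg)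

lemma pred_dist_power2:
  "(pred_dist n p X \<theta> \<theta>')\<^sup>2
    = dot {1..n} (design_mult p X (\<lambda>j. \<theta> j - \<theta>' j)) (design_mult p X (\<lambda>j. \<theta> j - \<theta>' j))"
  by (simp add: pred_dist_def L2_set_power2_eq_dot)

lemma pred_dist_measurable [measurable]:
  "(\<lambda>\<theta>. pred_dist n p X \<theta> \<theta>') \<in> borel_measurable (\<Pi>\<^sub>M j\<in>{1..p}. borel)"
  unfolding pred_dist_def L2_set_def design_mult_def by measurable

lemma sum_Pow_power_card:
  fixes c :: "'b::comm_semiring_1"
  assumes "finite A"
  shows "(\<Sum>S\<in>Pow A. c ^ card S) = (c + 1) ^ card A"
  using prod_add[OF assms, of "\<lambda>_. c" "\<lambda>_. 1"] by simp

text \<open>Bounds the entropy of model choice: with a penalty of order \<open>1 / p\<close> per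
  coordinate, the sum over all 2^p supports stays bounded.\<close>

lemma sum_Pow_power_card_le_exp:
  fixes c :: real
  assumes "finite A" "c \<ge> 0"
  shows "(\<Sum>S\<in>Pow A. c ^ card S) \<le> exp (real (card A) * c)"
proof -
  have "(c + 1) ^ card A \<le> exp c ^ card A"
    using assms exp_ge_add_one_self[of c] by (intro power_mono) (auto simp: add.commute)
  then show ?thesis
    using assms by (simp add: sum_Pow_power_card exp_of_nat_mult)
qed

text \<open>Lets constants be absorbed by multiples of \<open>ln p\<close>; the factors 3/2 below
  arise from 1 \<le> 3/2 * ln p.\<close>

lemma two_thirds_le_ln:
  assumes "p \<ge> (2::nat)"
  shows "2 / 3 \<le> ln (real p)"
proof -
  have "ln 2 \<le> ln (real p)" using assms by simp
  then show ?thesis using ln2_ge_two_thirds by linarith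
qed

text \<open>One test must serve all supports, so each projection statistic is compared with a
  threshold \<open>B S\<close> that grows with \<open>card S\<close>. Using exponentials
  \<open>W S\<close> in place of indicators has two advantages: the first error is a sum of
  exponential moments, and for the second error a pointwise bound by an exponential that is linear
  in \<open>y\<close> suffices, so that no tail of a noncentral chi-square distribution is
  needed.\<close>

lemma sparse_test_exists:
  assumes p: "p \<ge> 2" and Ss: "Sstar \<subseteq> {1..p}" and ts: "\<theta>star \<in> Theta p Sstar"
  obtains \<phi> where
    "test_function n \<phi>"
    "(\<integral>\<^sup>+y. ennreal (\<phi> y) \<partial>sampling n p X \<theta>star) \<le> ennreal (exp (- real (card Sstar) * ln (real p)))"
    "\<And>S \<theta>. S \<subseteq> {1..p} \<Longrightarrow> \<theta> \<in> Theta p S \<Longrightarrow>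
      (\<integral>\<^sup>+y. ennreal (1 - \<phi> y) \<partial>sampling n p X \<theta>)
        \<le> ennreal (exp (- (pred_dist n p X \<theta> \<theta>star)\<^sup>2 / 4
            + 5 * (real (card S) * ln (real p) + real (card Sstar) * ln (real p))))"
proof -
  let ?I = "{1..n}"
  let ?m = "design_mult p X \<theta>star"
  define s where "s = card Sstar"
  have ln: "ln (real p) \<ge> 2 / 3" by (rule two_thirds_le_ln[OF p])
  define Q where "Q S T \<longleftrightarrow> (\<lambda>y. T (\<lambda>i. y i - ?m i)) \<in> borel_measurable (\<Pi>\<^sub>M i\<in>?I. borel) \<and> (\<forall>z. T z \<ge> 0) \<and>
      (\<forall>u z. (dot ?I (\<lambda>i. \<Sum>j\<in>S\<union>Sstar. u j * X i j) z)\<^sup>2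
        \<le> dot ?I (\<lambda>i. \<Sum>j\<in>S\<union>Sstar. u j * X i j) (\<lambda>i. \<Sum>j\<in>S\<union>Sstar. u j * X i j) * T z) \<and>
      (\<integral>\<^sup>+y. ennreal (exp (T (\<lambda>i. y i - ?m i) / 4)) \<partial>gauss ?I ?m) \<le> ennreal (sqrt 2 ^ card (S \<union> Sstar))"
    for S T
  have "\<exists>T. Q S T" if "S \<in> Pow {1..p}" for S
  proof -
    have "finite (S \<union> Sstar)" using that Ss finite_subset by auto
    then show ?thesis
      by (rule projection_statistic[of ?I "S \<union> Sstar" "\<lambda>j i. X i j", OF finite_atLeastAtMost])
        (unfold Q_def, blast)
  qed
  then obtain T where T: "\<And>S. S \<in> Pow {1..p} \<Longrightarrow> Q S (T S)"
    by metis
  have T_meas: "(\<lambda>y. T S (\<lambda>i. y i - ?m i)) \<in> borel_measurable (\<Pi>\<^sub>M i\<in>?I. borel)"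
    and T_CS: "\<And>u z. (dot ?I (\<lambda>i. \<Sum>j\<in>S\<union>Sstar. u j * X i j) z)\<^sup>2
        \<le> dot ?I (\<lambda>i. \<Sum>j\<in>S\<union>Sstar. u j * X i j) (\<lambda>i. \<Sum>j\<in>S\<union>Sstar. u j * X i j) * T S z"
    and T_mgf: "(\<integral>\<^sup>+y. ennreal (exp (T S (\<lambda>i. y i - ?m i) / 4)) \<partial>gauss ?I ?m) \<le> ennreal (sqrt 2 ^ card (S \<union> Sstar))"
    if "S \<in> Pow {1..p}" for S
    using T[OF that] unfolding Q_def by blast+
  \<comment> \<open>With 10, the factor exp (- B S / 4) is \<open>p\<close> to the power - 5/2 (card
    S + s). The chi-square moment takes back at most 1/2 of the 5/2, and the remaining exponent - 2
    makes the sum over \<open>S\<close> converge and leaves \<open>?c ^ s\<close>.\<close>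
  define B where "B S = 10 * (real (card S) * ln (real p) + real s * ln (real p))" for S :: "nat set"
  have B_nn: "B S \<ge> 0" for S using ln by (simp add: B_def)
  define W where "W S y = exp (T S (\<lambda>i. y i - ?m i) / 4 - B S / 4)" for S y
  define \<phi> where "\<phi> y = min 1 (\<Sum>S\<in>Pow {1..p}. W S y)" for y
  have W_nn: "W S y \<ge> 0" for S y by (simp add: W_def)
  have W_meas [measurable]: "W S \<in> borel_measurable (\<Pi>\<^sub>M i\<in>?I. borel)" if "S \<in> Pow {1..p}" for S
    unfolding W_def using T_meas[OF that] by measurable
  have \<phi>_meas [measurable]: "\<phi> \<in> borel_measurable (\<Pi>\<^sub>M i\<in>?I. borel)"
    unfolding \<phi>_def by (intro borel_measurable_min borel_measurable_const borel_measurable_sum W_meas)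
  have \<phi>01: "0 \<le> \<phi> y" "\<phi> y \<le> 1" for y
    using W_nn by (auto simp: \<phi>_def sum_nonneg)
  show ?thesis
  proof (rule that)
    show "test_function n \<phi>"
      unfolding test_function_def using \<phi>_meas \<phi>01 by blast
  next
    show "(\<integral>\<^sup>+y. ennreal (\<phi> y) \<partial>sampling n p X \<theta>star) \<le> ennreal (exp (- real (card Sstar) * ln (real p)))"
    proof (cases "s = 0")
      case True
      have "(\<integral>\<^sup>+y. ennreal (\<phi> y) \<partial>sampling n p X \<theta>star) \<le> (\<integral>\<^sup>+y. 1 \<partial>sampling n p X \<theta>star)"
        using \<phi>01 by (intro nn_integral_mono) simp
      then show ?thesis
        using True prob_space.emeasure_space_1[OF prob_space_sampling[of n p X \<theta>star]] by (simp add: s_def)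
    next
      case False
      let ?c = "exp (- 2 * ln (real p))"
      have c: "?c = 1 / (real p)\<^sup>2"
        using p by (simp add: exp_minus exp_of_nat_mult[of 2, simplified] inverse_eq_divide)
      have term_le: "(\<integral>\<^sup>+y. ennreal (W S y) \<partial>gauss ?I ?m) \<le> ennreal (?c ^ s * ?c ^ card S)"
        if S: "S \<in> Pow {1..p}" for S
      proof -
        have "(\<integral>\<^sup>+y. ennreal (W S y) \<partial>gauss ?I ?m)
            = (\<integral>\<^sup>+y. ennreal (exp (- B S / 4)) * ennreal (exp (T S (\<lambda>i. y i - ?m i) / 4)) \<partial>gauss ?I ?m)"
          by (intro nn_integral_cong) (simp add: W_def mult_exp_exp flip: ennreal_mult)
        also have "\<dots> = ennreal (exp (- B S / 4)) * (\<integral>\<^sup>+y. ennreal (exp (T S (\<lambda>i. y i - ?m i) / 4)) \<partial>gauss ?I ?m)"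
        proof (rule nn_integral_cmult)
          have [measurable]: "(\<lambda>y. T S (\<lambda>i. y i - ?m i)) \<in> borel_measurable (gauss ?I ?m)"
            using T_meas[OF S] by simp
          show "(\<lambda>y. ennreal (exp (T S (\<lambda>i. y i - ?m i) / 4))) \<in> borel_measurable (gauss ?I ?m)"
            by measurable
        qed
        also have "\<dots> \<le> ennreal (exp (- B S / 4)) * ennreal (sqrt 2 ^ card (S \<union> Sstar))"
          by (intro mult_left_mono T_mgf S) simp
        also have "\<dots> = ennreal (exp (- B S / 4) * sqrt 2 ^ card (S \<union> Sstar))"
          by (simp add: ennreal_mult)
        also have "\<dots> \<le> ennreal (?c ^ s * ?c ^ card S)"
        proof (rule ennreal_leI)
          have sq: "sqrt 2 \<le> exp (ln (real p) / 2)"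
          proof -
            have "sqrt 2 \<le> sqrt (real p)" using p by simp
            also have "\<dots> = exp (ln (real p) / 2)" using p by (simp add: ln_sqrt[symmetric])
            finally show ?thesis .
          qed
          have "sqrt 2 ^ card (S \<union> Sstar) \<le> sqrt 2 ^ (card S + s)"
            by (intro power_increasing) (auto simp: card_Un_le s_def)
          also have "\<dots> \<le> exp (ln (real p) / 2) ^ (card S + s)"
            by (intro power_mono sq) auto
          also have "\<dots> = exp (real (card S + s) * (ln (real p) / 2))"
            by (simp only: exp_of_nat_mult)
          finally have "exp (- B S / 4) * sqrt 2 ^ card (S \<union> Sstar)
              \<le> exp (- B S / 4) * exp (real (card S + s) * (ln (real p) / 2))"
            by (intro mult_left_mono) auto
          also have "\<dots> = exp (real (s + card S) * (- 2 * ln (real p)))"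
            by (simp add: mult_exp_exp B_def field_simps)
          also have "\<dots> = ?c ^ s * ?c ^ card S"
            by (simp only: exp_of_nat_mult power_add)
          finally show "exp (- B S / 4) * sqrt 2 ^ card (S \<union> Sstar) \<le> ?c ^ s * ?c ^ card S" .
        qed
        finally show ?thesis .
      qed
      have "(\<integral>\<^sup>+y. ennreal (\<phi> y) \<partial>sampling n p X \<theta>star) \<le> (\<integral>\<^sup>+y. (\<Sum>S\<in>Pow {1..p}. ennreal (W S y)) \<partial>gauss ?I ?m)"
        unfolding sampling_eq_gauss using W_nn
        by (intro nn_integral_mono) (auto simp: \<phi>_def sum_ennreal intro!: ennreal_leI)
      also have "\<dots> = (\<Sum>S\<in>Pow {1..p}. \<integral>\<^sup>+y. ennreal (W S y) \<partial>gauss ?I ?m)"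
        by (intro nn_integral_sum) (use W_meas in simp)
      also have "\<dots> \<le> (\<Sum>S\<in>Pow {1..p}. ennreal (?c ^ s * ?c ^ card S))"
        by (intro sum_mono term_le)
      also have "\<dots> = ennreal (?c ^ s * (\<Sum>S\<in>Pow {1..p}. ?c ^ card S))"
        by (simp add: sum_ennreal sum_distrib_left)
      also have "\<dots> \<le> ennreal (exp (- real (card Sstar) * ln (real p)))"
      proof (rule ennreal_leI)
        have "(\<Sum>S\<in>Pow {1..p}. ?c ^ card S) \<le> exp (real (card {1..p}) * ?c)"
          by (intro sum_Pow_power_card_le_exp) auto
        \<comment> \<open>The sum over supports is at most exp (1 / p). It is absorbed by giving up
          one of the two powers of \<open>p\<close> per element of \<open>Sstar\<close>, which
          requires \<open>Sstar\<close> to be nonempty.\<close>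
        also have "\<dots> \<le> exp (real s * ln (real p))"
        proof -
          have "real p * ?c = 1 / real p" using p by (simp only: c) (simp add: power2_eq_square)
          also have "\<dots> \<le> 1 / 2" using p by simp
          also have "\<dots> \<le> 1 * ln (real p)" using ln by simp
          also have "\<dots> \<le> real s * ln (real p)"
            using False ln by (intro mult_right_mono) auto
          finally show ?thesis by simp
        qed
        finally have "?c ^ s * (\<Sum>S\<in>Pow {1..p}. ?c ^ card S) \<le> ?c ^ s * exp (real s * ln (real p))"
          by (intro mult_left_mono) auto
        also have "\<dots> = exp (- real (card Sstar) * ln (real p))"
          by (simp add: exp_of_nat_mult[symmetric] mult_exp_exp s_def)
        finally show "?c ^ s * (\<Sum>S\<in>Pow {1..p}. ?c ^ card S) \<le> exp (- real (card Sstar) * ln (real p))" .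
      qed
      finally show ?thesis .
    qed
  next
    fix S \<theta> assume S: "S \<subseteq> {1..p}" and \<theta>: "\<theta> \<in> Theta p S"
    let ?\<Delta> = "design_mult p X (\<lambda>j. \<theta> j - \<theta>star j)"
    let ?d2 = "(pred_dist n p X \<theta> \<theta>star)\<^sup>2"
    have span: "?\<Delta> = (\<lambda>i. \<Sum>j\<in>S \<union> Sstar. (\<theta> j - \<theta>star j) * X i j)"
    proof
      fix i
      have "?\<Delta> i = (\<Sum>j\<in>S \<union> Sstar. X i j * (\<theta> j - \<theta>star j))"
        unfolding design_mult_def using S Ss \<theta> ts
        by (intro sum.mono_neutral_right) (auto simp: Theta_def)
      then show "?\<Delta> i = (\<Sum>j\<in>S \<union> Sstar. (\<theta> j - \<theta>star j) * X i j)"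
        by (simp add: mult.commute)
    qed
    \<comment> \<open>Below the threshold, Cauchy-Schwarz and d^2 B \<le> (d^2 / 4 + B)^2 bound the
      inner product by d^2 / 4 + B, so the exponent is nonnegative and the right side is at least 1.
      Above the threshold \<open>W S y\<close> \<ge> 1 and the test rejects with certainty.\<close>
    have pw: "1 - \<phi> y \<le> exp (?d2 / 8 + B S / 2 + dot ?I (\<lambda>i. - (1 / 2) * ?\<Delta> i) (\<lambda>i. y i - ?m i))" for y
    proof (cases "T S (\<lambda>i. y i - ?m i) < B S")
      case True
      let ?z = "\<lambda>i. y i - ?m i"
      have "(dot ?I ?\<Delta> ?z)\<^sup>2 \<le> ?d2 * T S ?z"
        unfolding pred_dist_power2 span using T_CS[of S] S by simp
      also have "\<dots> \<le> ?d2 * B S" using True by (intro mult_left_mono) auto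
      also have "\<dots> \<le> (?d2 / 4 + B S)\<^sup>2"
        using zero_le_power2[of "?d2 / 4 - B S"] by (simp add: power2_eq_square algebra_simps)
      finally have "dot ?I ?\<Delta> ?z \<le> ?d2 / 4 + B S"
        by (rule power2_le_imp_le) (use B_nn[of S] in simp)
      then have "0 \<le> ?d2 / 8 + B S / 2 + dot ?I (\<lambda>i. - (1 / 2) * ?\<Delta> i) ?z"
        by (simp only: dot_cmult_left)
      then have "1 \<le> exp (?d2 / 8 + B S / 2 + dot ?I (\<lambda>i. - (1 / 2) * ?\<Delta> i) ?z)" by simp
      then show ?thesis using \<phi>01(1)[of y] by linarith
    next
      case False
      then have "1 \<le> W S y" by (simp add: W_def)
      also have "\<dots> \<le> (\<Sum>S\<in>Pow {1..p}. W S y)"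
        using S W_nn by (intro member_le_sum) auto
      finally have "\<phi> y = 1" by (simp add: \<phi>_def)
      then show ?thesis by simp
    qed
    have "(\<integral>\<^sup>+y. ennreal (1 - \<phi> y) \<partial>sampling n p X \<theta>)
        \<le> (\<integral>\<^sup>+y. ennreal (exp (- 3 * ?d2 / 8 + B S / 2))
            * ennreal (exp (dot ?I (\<lambda>i. - (1 / 2) * ?\<Delta> i) (\<lambda>i. y i - design_mult p X \<theta> i))) \<partial>sampling n p X \<theta>)"
    proof (rule nn_integral_mono)
      fix y
      \<comment> \<open>Recentring from \<theta>star to \<theta> adds d^2 to the inner product and
        turns d^2 / 8 into - 3 d^2 / 8; the Gaussian moment below gives back d^2 / 8, whence the
        rate 1/4.\<close>
      have "dot ?I ?\<Delta> (\<lambda>i. y i - ?m i) = dot ?I ?\<Delta> (\<lambda>i. y i - design_mult p X \<theta> i) + ?d2"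
        by (simp add: pred_dist_power2 dot_def sum.distrib[symmetric] design_mult_diff algebra_simps)
      then have eq: "?d2 / 8 + B S / 2 + dot ?I (\<lambda>i. - (1 / 2) * ?\<Delta> i) (\<lambda>i. y i - ?m i)
          = - 3 * ?d2 / 8 + B S / 2 + dot ?I (\<lambda>i. - (1 / 2) * ?\<Delta> i) (\<lambda>i. y i - design_mult p X \<theta> i)"
        by (simp only: dot_cmult_left) (simp add: field_simps)
      have "ennreal (1 - \<phi> y) \<le> ennreal (exp (- 3 * ?d2 / 8 + B S / 2)
            * exp (dot ?I (\<lambda>i. - (1 / 2) * ?\<Delta> i) (\<lambda>i. y i - design_mult p X \<theta> i)))"
        unfolding mult_exp_exp eq[symmetric] by (rule ennreal_leI[OF pw])
      then show "ennreal (1 - \<phi> y) \<le> ennreal (exp (- 3 * ?d2 / 8 + B S / 2))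
            * ennreal (exp (dot ?I (\<lambda>i. - (1 / 2) * ?\<Delta> i) (\<lambda>i. y i - design_mult p X \<theta> i)))"
        by (simp only: ennreal_mult exp_ge_zero)
    qed
    also have "\<dots> = ennreal (exp (- 3 * ?d2 / 8 + B S / 2)) * ennreal (exp (?d2 / 8))"
    proof -
      have "dot ?I (\<lambda>i. - (1 / 2) * ?\<Delta> i) (\<lambda>i. - (1 / 2) * ?\<Delta> i) = ?d2 / 4"
        by (simp only: dot_cmult_left dot_cmult_right pred_dist_power2)
      then have "(\<integral>\<^sup>+y. ennreal (exp (dot ?I (\<lambda>i. - (1 / 2) * ?\<Delta> i) (\<lambda>i. y i - design_mult p X \<theta> i)))
          \<partial>sampling n p X \<theta>) = ennreal (exp (?d2 / 8))"
        unfolding sampling_eq_gauss by (subst gauss_mgf) auto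
      moreover have [measurable]: "(\<lambda>y. dot ?I (\<lambda>i. - (1 / 2) * ?\<Delta> i) (\<lambda>i. y i - design_mult p X \<theta> i))
          \<in> borel_measurable (sampling n p X \<theta>)"
        unfolding measurable_cong_sets[OF sets_sampling refl] by (rule dot_measurable)
      have "(\<integral>\<^sup>+y. ennreal (exp (- 3 * ?d2 / 8 + B S / 2))
            * ennreal (exp (dot ?I (\<lambda>i. - (1 / 2) * ?\<Delta> i) (\<lambda>i. y i - design_mult p X \<theta> i))) \<partial>sampling n p X \<theta>)
          = ennreal (exp (- 3 * ?d2 / 8 + B S / 2)) * (\<integral>\<^sup>+y.
            ennreal (exp (dot ?I (\<lambda>i. - (1 / 2) * ?\<Delta> i) (\<lambda>i. y i - design_mult p X \<theta> i))) \<partial>sampling n p X \<theta>)"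
        by (rule nn_integral_cmult) measurable
      ultimately show ?thesis by (simp only:)
    qed
    also have "\<dots> = ennreal (exp (- ?d2 / 4 + 5 * (real (card S) * ln (real p) + real (card Sstar) * ln (real p))))"
      by (simp add: mult_exp_exp B_def s_def algebra_simps flip: ennreal_mult)
    finally show "(\<integral>\<^sup>+y. ennreal (1 - \<phi> y) \<partial>sampling n p X \<theta>)
        \<le> ennreal (exp (- ?d2 / 4 + 5 * (real (card S) * ln (real p) + real (card Sstar) * ln (real p))))" .
  qed
qed

subsection \<open>Prior masses and divergences\<close>

lemma prod_mono_ennreal:
  fixes f g :: "'a \<Rightarrow> ennreal"
  shows "(\<And>i. i \<in> A \<Longrightarrow> f i \<le> g i) \<Longrightarrow> prod f A \<le> prod g A"
  by (induction A rule: infinite_finite_induct) (auto intro: mult_mono)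

lemma L2_set_sum_le:
  "L2_set (\<lambda>i. \<Sum>j\<in>J. f j i) I \<le> (\<Sum>j\<in>J. L2_set (f j) I)"
proof (induction J rule: infinite_finite_induct)
  case (insert j J)
  have "L2_set (\<lambda>i. \<Sum>j\<in>insert j J. f j i) I = L2_set (\<lambda>i. f j i + (\<Sum>j\<in>J. f j i)) I"
    using insert by simp
  also have "\<dots> \<le> L2_set (f j) I + L2_set (\<lambda>i. \<Sum>j\<in>J. f j i) I"
    by (rule L2_set_triangle_ineq)
  finally show ?case using insert by simp
qed (auto simp: L2_set_def)

lemma L2_set_design_mult_le:
  "L2_set (design_mult p X u) {1..n} \<le> design_norm n p X * (\<Sum>j\<in>{1..p}. \<bar>u j\<bar>)"
proof -
  have "L2_set (design_mult p X u) {1..n} \<le> (\<Sum>j\<in>{1..p}. L2_set (\<lambda>i. X i j * u j) {1..n})"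
    unfolding design_mult_def[abs_def] by (rule L2_set_sum_le)
  also have "\<dots> \<le> (\<Sum>j\<in>{1..p}. design_norm n p X * \<bar>u j\<bar>)"
  proof (rule sum_mono)
    fix j assume j: "j \<in> {1..p}"
    have "L2_set (\<lambda>i. X i j * u j) {1..n} = L2_set (\<lambda>i. X i j) {1..n} * \<bar>u j\<bar>"
      by (simp add: L2_set_def power_mult_distrib sum_distrib_right[symmetric] real_sqrt_mult)
    also have "\<dots> \<le> design_norm n p X * \<bar>u j\<bar>"
      unfolding design_norm_def using j by (intro mult_right_mono Max_ge) auto
    finally show "L2_set (\<lambda>i. X i j * u j) {1..n} \<le> design_norm n p X * \<bar>u j\<bar>" .
  qed
  finally show ?thesis by (simp add: sum_distrib_left)
qed

text \<open>The multiplied form of compatibility. It also holds for \<open>u\<close> vanishing on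
  \<open>S\<close>, over which the infimum does not range, so later uses only have to check the cone
  condition.\<close>

lemma compat_number_bound:
  assumes compat: "compat_number n p X S \<ge> ereal k" and norm: "design_norm n p X > 0"
    and S: "S \<subseteq> {1..p}" and cone: "(\<Sum>j\<in>{1..p} - S. \<bar>u j\<bar>) \<le> 3 * (\<Sum>j\<in>S. \<bar>u j\<bar>)"
  shows "k * design_norm n p X * (\<Sum>j\<in>S. \<bar>u j\<bar>)
    \<le> L2_set (design_mult p X u) {1..n} * sqrt (real (card S))"
proof (cases "\<exists>j\<in>S. u j \<noteq> 0")
  case False
  then show ?thesis by (simp add: L2_set_nonneg)
next
  case True
  have fS: "finite S" using S finite_subset by auto
  \<comment> \<open>The infimum ranges over extensional functions; restriction changes none of the
    sums.\<close>
  define v where "v = restrict u {1..p}"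
  have vS: "v j = u j" if "j \<in> S" for j using that S by (auto simp: v_def)
  have pos: "(\<Sum>j\<in>S. \<bar>u j\<bar>) > 0"
  proof -
    obtain j where "j \<in> S" "u j \<noteq> 0" using True by blast
    then show ?thesis using fS by (intro sum_pos2[of S j]) auto
  qed
  have sums: "(\<Sum>j\<in>S. \<bar>v j\<bar>) = (\<Sum>j\<in>S. \<bar>u j\<bar>)" "(\<Sum>j\<in>{1..p} - S. \<bar>v j\<bar>) = (\<Sum>j\<in>{1..p} - S. \<bar>u j\<bar>)"
    using vS by (auto simp: v_def intro!: sum.cong)
  have Xv: "design_mult p X v = design_mult p X u"
    by (auto simp: design_mult_def v_def intro!: sum.cong)
  have "ereal k \<le> compat_number n p X S" by (rule compat)
  also have "\<dots> \<le> ereal (L2_set (design_mult p X v) {1..n} * sqrt (real (card S)) /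
               (design_norm n p X * (\<Sum>j\<in>S. \<bar>v j\<bar>)))"
    unfolding compat_number_def
  proof (rule INF_lower)
    have "v \<in> {1..p} \<rightarrow>\<^sub>E UNIV" by (simp add: v_def)
    then show "v \<in> {u \<in> {1..p} \<rightarrow>\<^sub>E UNIV.
               (\<Sum>j\<in>{1..p} - S. \<bar>u j\<bar>) \<le> 3 * (\<Sum>j\<in>S. \<bar>u j\<bar>) \<and> (\<exists>j\<in>S. u j \<noteq> 0)}"
      using cone True vS unfolding mem_Collect_eq sums by simp
  qed
  finally have "k \<le> L2_set (design_mult p X u) {1..n} * sqrt (real (card S)) /
               (design_norm n p X * (\<Sum>j\<in>S. \<bar>u j\<bar>))"
    by (simp add: Xv sums)
  then show ?thesis using pos norm by (simp add: field_simps)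
qed

text \<open>
  On the cone, compatibility bounds the \<open>\<ell>\<^sub>1\<close> norm of the error on \<open>S\<close> by its prediction norm; off the
  cone, the error outside \<open>S\<close> already dominates.
\<close>

lemma l1_norm_comparison:
  fixes \<theta> \<theta>star :: "nat \<Rightarrow> real"
  assumes \<tau>: "\<tau> = k * design_norm n p X" "\<tau> > 0"
    and compat: "compat_number n p X S \<ge> ereal k" and norm: "design_norm n p X > 0"
    and S: "S \<subseteq> {1..p}" and ts: "\<theta>star \<in> Theta p S"
  shows "- (3 / 2 * pred_dist n p X \<theta> \<theta>star * sqrt (real (card S)))
    \<le> - \<tau> * (\<Sum>j\<in>{1..p}. \<bar>\<theta>star j\<bar>) + (\<Sum>j\<in>{1..p}. \<tau> * (\<bar>\<theta> j\<bar> - \<bar>\<theta> j - \<theta>star j\<bar> / 2))"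
proof -
  define u where "u j = \<theta> j - \<theta>star j" for j
  define A where "A = (\<Sum>j\<in>S. \<bar>u j\<bar>)"
  define B where "B = (\<Sum>j\<in>{1..p} - S. \<bar>u j\<bar>)"
  have "A \<ge> 0" "B \<ge> 0" by (simp_all add: A_def B_def sum_nonneg)
  let ?d = "pred_dist n p X \<theta> \<theta>star * sqrt (real (card S))"
  have e: "\<tau> * (A - B) = \<tau> * A - \<tau> * B" "- \<tau> / 2 * (A + B) = - (\<tau> * A + \<tau> * B) / 2"
    by (simp_all add: algebra_simps)
  \<comment> \<open>After moving terms, the claim reads \<tau> (3 A - B) / 2 \<le> 3/2 *
    \<open>?d\<close>. So the cone constant 3 is what allows half of the l1 error to be kept: off
    the cone the left side is negative, and on it \<tau> A \<le> \<open>?d\<close> by compatibility,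
    as \<tau> is exactly \<open>k\<close> times the design norm.\<close>
  have key: "\<tau> * (A - B) \<le> - \<tau> / 2 * (A + B) + 3 / 2 * ?d"
  proof (cases "B \<le> 3 * A")
    case True
    have gen: "a \<le> d \<Longrightarrow> 0 \<le> b \<Longrightarrow> a - b \<le> - (a + b) / 2 + 3 / 2 * d" for a b d :: real
      by (simp add: field_simps)
    have "\<tau> * A \<le> ?d"
      using compat_number_bound[OF compat norm S, of u] True
      by (simp add: A_def B_def \<tau>(1) pred_dist_def u_def[abs_def])
    moreover have "\<tau> * B \<ge> 0" using \<tau> \<open>B \<ge> 0\<close> by simp
    ultimately show ?thesis unfolding e by (rule gen)
  next
    case False
    have gen: "3 * a \<le> b \<Longrightarrow> 0 \<le> d \<Longrightarrow> a - b \<le> - (a + b) / 2 + 3 / 2 * d" for a b d :: real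
      by (simp add: field_simps)
    have "3 * (\<tau> * A) = \<tau> * (3 * A)" by simp
    also have "\<dots> \<le> \<tau> * B" using False \<tau>(2) by (intro mult_left_mono) auto
    finally have "3 * (\<tau> * A) \<le> \<tau> * B" .
    moreover have "?d \<ge> 0" by simp
    ultimately show ?thesis unfolding e by (rule gen)
  qed
  have split: "(\<Sum>j\<in>{1..p}. f j) = (\<Sum>j\<in>{1..p} - S. f j) + (\<Sum>j\<in>S. f j)" for f :: "nat \<Rightarrow> real"
    using S by (intro sum.subset_diff) auto
  have "(\<Sum>j\<in>{1..p} - S. \<bar>\<theta>star j\<bar> - \<bar>\<theta> j\<bar>) = - B"
    unfolding B_def sum_negf[symmetric] using ts by (intro sum.cong) (auto simp: Theta_def u_def)
  moreover have "(\<Sum>j\<in>S. \<bar>\<theta>star j\<bar> - \<bar>\<theta> j\<bar>) \<le> A"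
    unfolding A_def u_def by (intro sum_mono) auto
  ultimately have "(\<Sum>j\<in>{1..p}. \<bar>\<theta>star j\<bar> - \<bar>\<theta> j\<bar>) \<le> A - B"
    by (subst split) simp
  then have "\<tau> * (\<Sum>j\<in>{1..p}. \<bar>\<theta>star j\<bar> - \<bar>\<theta> j\<bar>) \<le> \<tau> * (A - B)"
    using \<tau>(2) by (intro mult_left_mono) auto
  moreover have "A + B = (\<Sum>j\<in>{1..p}. \<bar>u j\<bar>)"
    unfolding A_def B_def by (subst split) simp
  ultimately have "\<tau> * (\<Sum>j\<in>{1..p}. \<bar>\<theta>star j\<bar> - \<bar>\<theta> j\<bar>) \<le> - \<tau> / 2 * (\<Sum>j\<in>{1..p}. \<bar>u j\<bar>) + 3 / 2 * ?d"
    using key by simp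
  then show ?thesis
    by (simp add: sum_subtractf sum_distrib_left[symmetric] sum_divide_distrib[symmetric] u_def algebra_simps)
qed

text \<open>The prediction distance couples all coordinates, but \<open>l1_norm_comparison\<close>
  replaces it by an exponent that is a sum over coordinates, so the integral factors. A slab
  coordinate contributes 2 by \<open>laplace_tilt\<close>, a spike coordinate exp (- \<tau>
  |\<theta>star j| / 2), which is at most 1. Both the upper bound for prior masses and that for the
  tested numerator rest on this estimate.\<close>

lemma Gam_exp_pred_dist:
  assumes \<tau>: "\<tau> = k * design_norm n p X" "\<tau> > 0"
    and compat: "compat_number n p X Sstar \<ge> ereal k" and norm: "design_norm n p X > 0"
    and Ss: "Sstar \<subseteq> {1..p}" and ts: "\<theta>star \<in> Theta p Sstar" and S: "S \<subseteq> {1..p}"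
  shows "(\<integral>\<^sup>+\<theta>. ennreal (exp (- (3 / 2 * pred_dist n p X \<theta> \<theta>star * sqrt (real (card Sstar))))) \<partial>Gam p \<tau> S)
    \<le> ennreal (2 ^ card S * exp (- \<tau> * (\<Sum>j\<in>{1..p}. \<bar>\<theta>star j\<bar>)))"
proof -
  interpret P: product_sigma_finite "\<lambda>j. if j \<in> S then laplace \<tau> else return borel 0"
    by (rule product_sigma_finite_slab[OF \<tau>(2)])
  let ?E = "ennreal (exp (- \<tau> * (\<Sum>j\<in>{1..p}. \<bar>\<theta>star j\<bar>)))"
  let ?f = "\<lambda>j x. ennreal (exp (\<tau> * (\<bar>x\<bar> - \<bar>x - \<theta>star j\<bar> / 2)))"
  have "(\<integral>\<^sup>+\<theta>. ennreal (exp (- (3 / 2 * pred_dist n p X \<theta> \<theta>star * sqrt (real (card Sstar))))) \<partial>Gam p \<tau> S)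
      \<le> (\<integral>\<^sup>+\<theta>. ?E * (\<Prod>j\<in>{1..p}. ?f j (\<theta> j)) \<partial>Gam p \<tau> S)"
  proof (rule nn_integral_mono)
    fix \<theta>
    have "exp (- (3 / 2 * pred_dist n p X \<theta> \<theta>star * sqrt (real (card Sstar))))
      \<le> exp (- \<tau> * (\<Sum>j\<in>{1..p}. \<bar>\<theta>star j\<bar>)) * (\<Prod>j\<in>{1..p}. exp (\<tau> * (\<bar>\<theta> j\<bar> - \<bar>\<theta> j - \<theta>star j\<bar> / 2)))"
      using l1_norm_comparison[OF \<tau> compat norm Ss ts, of \<theta>]
      by (simp only: exp_sum[symmetric, OF finite_atLeastAtMost] mult_exp_exp exp_le_cancel_iff)
    then show "ennreal (exp (- (3 / 2 * pred_dist n p X \<theta> \<theta>star * sqrt (real (card Sstar)))))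
        \<le> ?E * (\<Prod>j\<in>{1..p}. ?f j (\<theta> j))"
      by (simp add: prod_ennreal prod_nonneg ennreal_leI flip: ennreal_mult)
  qed
  also have "\<dots> = ?E * (\<integral>\<^sup>+\<theta>. (\<Prod>j\<in>{1..p}. ?f j (\<theta> j)) \<partial>Gam p \<tau> S)"
    by (rule nn_integral_cmult) measurable
  also have "(\<integral>\<^sup>+\<theta>. (\<Prod>j\<in>{1..p}. ?f j (\<theta> j)) \<partial>Gam p \<tau> S)
      = (\<Prod>j\<in>{1..p}. \<integral>\<^sup>+x. ?f j x \<partial>(if j \<in> S then laplace \<tau> else return borel 0))"
    unfolding Gam_def by (rule P.product_nn_integral_prod) auto
  also have "\<dots> \<le> (\<Prod>j\<in>{1..p}. if j \<in> S then 2 else 1)"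
  proof (rule prod_mono_ennreal)
    fix j
    show "(\<integral>\<^sup>+x. ?f j x \<partial>(if j \<in> S then laplace \<tau> else return borel 0)) \<le> (if j \<in> S then 2 else 1)"
      using laplace_tilt[OF \<tau>(2), of "\<theta>star j"] \<tau>(2) by (simp add: nn_integral_return)
  qed
  also have "\<dots> = 2 ^ card S"
    using S by (simp add: prod.If_cases Int_absorb1)
  finally have "(\<integral>\<^sup>+\<theta>. ennreal (exp (- (3 / 2 * pred_dist n p X \<theta> \<theta>star * sqrt (real (card Sstar))))) \<partial>Gam p \<tau> S)
      \<le> ?E * 2 ^ card S" by (simp add: mult_left_mono)
  also have "?E * 2 ^ card S = ennreal (2 ^ card S * exp (- \<tau> * (\<Sum>j\<in>{1..p}. \<bar>\<theta>star j\<bar>)))"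
    by (simp add: ennreal_mult ennreal_power[symmetric] mult.commute flip: ennreal_numeral)
  finally show ?thesis .
qed

section \<open>Boxes around the truth, whose slab mass factors over coordinates\<close>

definition center_box :: "nat \<Rightarrow> real \<Rightarrow> nat set \<Rightarrow> (nat \<Rightarrow> real) \<Rightarrow> (nat \<Rightarrow> real) set" where
  "center_box p r S \<theta>star = (\<Pi>\<^sub>E j\<in>{1..p}. if j \<in> S then {\<theta>star j - r..\<theta>star j + r} else {0})"

lemma center_box_measurable [measurable]: "center_box p r S \<theta>star \<in> sets (\<Pi>\<^sub>M j\<in>{1..p}. borel)"
  unfolding center_box_def by (intro sets_PiM_I_finite) auto

lemma center_box_subset_Theta: "center_box p r S \<theta>star \<subseteq> Theta p S"
  by (fastforce simp: center_box_def Theta_def PiE_iff split: if_splits)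

text \<open>The radius makes the prediction distance at most \<open>card S / p\<close>. As this is
  at most 1, its square is no larger, and the resulting bound \<open>card S\<close> is still correct
  for empty \<open>S\<close>.\<close>

lemma pred_dist_center_box:
  assumes p: "p \<ge> 1" and norm: "design_norm n p X > 0" and S: "S \<subseteq> {1..p}" and ts: "\<theta>star \<in> Theta p S"
    and \<theta>: "\<theta> \<in> center_box p (1 / (real p * design_norm n p X)) S \<theta>star"
  shows "(pred_dist n p X \<theta> \<theta>star)\<^sup>2 \<le> real (card S)"
proof -
  let ?r = "1 / (real p * design_norm n p X)"
  have card: "card S \<le> p" using S card_mono[of "{1..p}" S] by simp
  have "(\<Sum>j\<in>{1..p}. \<bar>\<theta> j - \<theta>star j\<bar>) = (\<Sum>j\<in>S. \<bar>\<theta> j - \<theta>star j\<bar>)"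
    using S ts subsetD[OF center_box_subset_Theta \<theta>] by (intro sum.mono_neutral_right) (auto simp: Theta_def)
  also have "\<dots> \<le> (\<Sum>j\<in>S. ?r)"
  proof (rule sum_mono)
    fix j assume j: "j \<in> S"
    then have "\<theta> j \<in> {\<theta>star j - ?r..\<theta>star j + ?r}"
      using \<theta> S by (auto simp: center_box_def PiE_iff split: if_splits)
    then show "\<bar>\<theta> j - \<theta>star j\<bar> \<le> ?r" by (simp add: abs_le_iff)
  qed
  also have "\<dots> = real (card S) * ?r" by simp
  finally have "design_norm n p X * (\<Sum>j\<in>{1..p}. \<bar>\<theta> j - \<theta>star j\<bar>) \<le> design_norm n p X * (real (card S) * ?r)"
    using norm by (intro mult_left_mono) auto
  with L2_set_design_mult_le[of p X "\<lambda>j. \<theta> j - \<theta>star j" n]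
  have d: "pred_dist n p X \<theta> \<theta>star \<le> real (card S) / real p"
    using norm by (simp add: pred_dist_def)
  have q: "real (card S) / real p \<le> 1" using card p by simp
  have "(pred_dist n p X \<theta> \<theta>star)\<^sup>2 \<le> (real (card S) / real p)\<^sup>2"
    using d by (intro power_mono) auto
  also have "\<dots> \<le> (real (card S) / real p) * 1"
    unfolding power2_eq_square using q by (intro mult_left_mono) auto
  also have "\<dots> \<le> real (card S)" using p by (simp add: divide_le_eq mult_le_cancel_left1)
  finally show ?thesis .
qed

text \<open>In \<tau> times the radius the design norm cancels and
  \<open>p powr (- \<zeta> - 1)\<close> remains, the cost per coordinate of a small interval. The
  slab density varies over the interval by at most exp (- \<tau> r) \<ge> exp (- 1), which costs at
  most two more powers of \<open>p\<close>; hence \<zeta> + 3.\<close>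

lemma Gam_center_box:
  assumes p: "p \<ge> 2" and \<tau>: "\<tau> = real p powr (- \<zeta>) * design_norm n p X" and "\<zeta> > 0"
    and norm: "design_norm n p X > 0" and S: "S \<subseteq> {1..p}" and ts: "\<theta>star \<in> Theta p S"
  shows "emeasure (Gam p \<tau> S) (center_box p (1 / (real p * design_norm n p X)) S \<theta>star)
    \<ge> ennreal (exp (- \<tau> * (\<Sum>j\<in>{1..p}. \<bar>\<theta>star j\<bar>) - (\<zeta> + 3) * (real (card S) * ln (real p))))"
proof -
  let ?r = "1 / (real p * design_norm n p X)"
  let ?l = "ln (real p)"
  let ?A = "\<lambda>j. if j \<in> S then {\<theta>star j - ?r..\<theta>star j + ?r} else {0}"
  let ?M = "\<lambda>j. if j \<in> S then laplace \<tau> else return borel 0"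
  have ln: "?l \<ge> 2 / 3" by (rule two_thirds_le_ln[OF p])
  have fS: "finite S" using S finite_subset by auto
  have \<tau>0: "\<tau> > 0" using p norm by (simp add: \<tau>)
  have \<tau>r: "\<tau> * ?r = exp (- (\<zeta> + 1) * ?l)"
  proof -
    have "\<tau> * ?r = real p powr (- \<zeta>) / real p" using norm p by (simp add: \<tau>)
    also have "\<dots> = real p powr (- \<zeta> - 1)" using p by (simp add: powr_diff)
    also have "\<dots> = exp (- (\<zeta> + 1) * ?l)" using p by (simp add: powr_def algebra_simps)
    finally show ?thesis .
  qed
  have "\<tau> * ?r \<le> 1" unfolding \<tau>r using ln \<open>\<zeta> > 0\<close> by (simp add: mult_nonpos_nonneg)
  interpret P: product_sigma_finite ?M
    by (rule product_sigma_finite_slab[OF \<tau>0])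
  have "(\<Sum>j\<in>{1..p}. \<bar>\<theta>star j\<bar>) = (\<Sum>j\<in>S. \<bar>\<theta>star j\<bar>)"
    using S ts by (intro sum.mono_neutral_right) (auto simp: Theta_def)
  then have "- \<tau> * (\<Sum>j\<in>{1..p}. \<bar>\<theta>star j\<bar>) - (\<zeta> + 3) * (real (card S) * ?l)
      = (\<Sum>j\<in>S. - \<tau> * \<bar>\<theta>star j\<bar> - (\<zeta> + 3) * ?l)"
    by (simp add: sum_subtractf sum_distrib_left sum_negf algebra_simps)
  then have "ennreal (exp (- \<tau> * (\<Sum>j\<in>{1..p}. \<bar>\<theta>star j\<bar>) - (\<zeta> + 3) * (real (card S) * ?l)))
      = (\<Prod>j\<in>S. ennreal (exp (- \<tau> * \<bar>\<theta>star j\<bar> - (\<zeta> + 3) * ?l)))"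
    using fS by (simp add: exp_sum prod_ennreal)
  also have "\<dots> = (\<Prod>j\<in>{1..p}. if j \<in> S then ennreal (exp (- \<tau> * \<bar>\<theta>star j\<bar> - (\<zeta> + 3) * ?l)) else 1)"
    using S by (simp add: prod.If_cases Int_absorb1)
  also have "\<dots> \<le> (\<Prod>j\<in>{1..p}. emeasure (?M j) (?A j))"
  proof (rule prod_mono_ennreal)
    fix j assume j: "j \<in> {1..p}"
    show "(if j \<in> S then ennreal (exp (- \<tau> * \<bar>\<theta>star j\<bar> - (\<zeta> + 3) * ?l)) else 1) \<le> emeasure (?M j) (?A j)"
    proof (cases "j \<in> S")
      case True
      have "exp (- \<tau> * \<bar>\<theta>star j\<bar> - (\<zeta> + 3) * ?l) \<le> exp (- \<tau> * \<bar>\<theta>star j\<bar> - (\<zeta> + 1) * ?l - \<tau> * ?r)"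
        using \<open>\<tau> * ?r \<le> 1\<close> ln by (simp add: algebra_simps)
      also have "\<dots> = exp (- (\<zeta> + 1) * ?l) * exp (- \<tau> * (\<bar>\<theta>star j\<bar> + ?r))"
        unfolding mult_exp_exp by (simp add: algebra_simps)
      also have "\<dots> = (\<tau> * ?r) * exp (- \<tau> * (\<bar>\<theta>star j\<bar> + ?r))"
        by (simp only: \<tau>r)
      finally have "ennreal (exp (- \<tau> * \<bar>\<theta>star j\<bar> - (\<zeta> + 3) * ?l)) \<le> ennreal (\<tau> * ?r * exp (- \<tau> * (\<bar>\<theta>star j\<bar> + ?r)))"
        by (rule ennreal_leI)
      also have "\<dots> \<le> emeasure (laplace \<tau>) {\<theta>star j - ?r..\<theta>star j + ?r}"
        using norm by (intro emeasure_laplace_interval \<tau>0) simp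
      finally show ?thesis using True by simp
    qed simp
  qed
  also have "\<dots> = emeasure (Gam p \<tau> S) (center_box p ?r S \<theta>star)"
    unfolding Gam_def center_box_def by (intro P.emeasure_PiM[symmetric]) auto
  finally show ?thesis .
qed

text \<open>The order 2 makes both the exponent and the prefactor 1, so the divergence is the
  logarithm of the mean likelihood ratio. Half of the result is the deterministic part of the ratio
  after recentring, half comes from the Gaussian moment. Divergence balls thereby become prediction
  balls.\<close>

lemma renyi_div_sampling:
  "renyi_div 2 (sampling n p X \<theta>star) (sampling n p X \<theta>) = ereal ((pred_dist n p X \<theta> \<theta>star)\<^sup>2)"
proof -
  let ?I = "{1..n}"
  let ?P = "sampling n p X \<theta>star" and ?Q = "sampling n p X \<theta>"
  let ?m = "design_mult p X \<theta>" and ?ms = "design_mult p X \<theta>star"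
  let ?v = "design_mult p X (\<lambda>j. \<theta>star j - \<theta> j)"
  let ?f = "\<lambda>y. exp (dot ?I ?v (\<lambda>i. y i - ?m i) - dot ?I ?v ?v / 2)"
  interpret P: prob_space ?P by (rule prob_space_sampling)
  interpret Q: prob_space ?Q by (rule prob_space_sampling)
  have f_meas: "(\<lambda>y. ennreal (?f y)) \<in> borel_measurable ?Q"
    by measurable
  have P: "density ?Q (\<lambda>y. ennreal (?f y)) = ?P"
    using gauss_shift[of ?I ?m ?v] by (simp add: sampling_eq_gauss design_mult_diff)
  have ac: "absolutely_continuous ?Q ?P"
    unfolding P[symmetric] by (rule absolutely_continuousI_density[OF f_meas])
  have "AE y in ?Q. ennreal (?f y) = RN_deriv ?Q ?P y"
    by (rule RN_deriv_unique_sigma_finite[OF f_meas P]) (rule P.sigma_finite_measure_axioms)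
  then have RN: "AE y in ?P. ennreal (?f y) = RN_deriv ?Q ?P y"
    by (rule absolutely_continuous_AE[OF _ ac, rotated]) simp
  have vv: "dot ?I ?v ?v = (pred_dist n p X \<theta> \<theta>star)\<^sup>2"
    unfolding pred_dist_power2 dot_def by (intro sum.cong) (auto simp: design_mult_diff algebra_simps)
  have f: "?f y = exp (dot ?I ?v ?v / 2) * exp (dot ?I ?v (\<lambda>i. y i - ?ms i))" for y
  proof -
    have "dot ?I ?v (\<lambda>i. y i - ?m i) = dot ?I ?v (\<lambda>i. y i - ?ms i) + dot ?I ?v ?v"
      unfolding dot_def sum.distrib[symmetric] by (intro sum.cong) (auto simp: design_mult_diff algebra_simps)
    then show ?thesis by (simp add: mult_exp_exp)
  qed
  have "(\<integral>\<^sup>+y. ennreal (enn2real (RN_deriv ?Q ?P y) powr (2 - 1)) \<partial>?P) = (\<integral>\<^sup>+y. ennreal (?f y) \<partial>?P)"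
  proof (rule nn_integral_cong_AE)
    show "AE y in ?P. ennreal (enn2real (RN_deriv ?Q ?P y) powr (2 - 1)) = ennreal (?f y)"
      using RN
    proof eventually_elim
      case (elim y)
      then have "enn2real (RN_deriv ?Q ?P y) = ?f y"
        by (metis enn2real_ennreal exp_ge_zero)
      then show ?case by simp
    qed
  qed
  also have "\<dots> = (\<integral>\<^sup>+y. ennreal (exp (dot ?I ?v ?v / 2)) * ennreal (exp (dot ?I ?v (\<lambda>i. y i - ?ms i))) \<partial>?P)"
    by (simp only: f ennreal_mult exp_ge_zero)
  also have "\<dots> = ennreal (exp (dot ?I ?v ?v / 2)) * ennreal (exp (dot ?I ?v ?v / 2))"
    unfolding sampling_eq_gauss by (subst nn_integral_cmult) (auto simp: gauss_mgf)
  also have "\<dots> = ennreal (exp ((pred_dist n p X \<theta> \<theta>star)\<^sup>2))"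
    unfolding vv by (simp add: mult_exp_exp flip: ennreal_mult)
  finally show ?thesis
    using ac by (simp add: renyi_div_def eln_def)
qed

subsection \<open>Effective weights\<close>

text \<open>Convexity of x ln x, extended to the endpoint \<open>y = 0\<close> by the value 0
  there.\<close>

lemma xlnx_tangent:
  fixes x y :: real
  assumes "x > 0" "y \<ge> 0"
  shows "x * ln x + (y - x) * (ln x + 1) \<le> y * ln y"
proof (cases "y = 0")
  case True
  then show ?thesis using assms by (simp add: algebra_simps)
next
  case False
  then have y: "y > 0" using assms by simp
  have "y * ln (x / y) \<le> y * (x / y - 1)"
    using assms y by (intro mult_left_mono ln_le_minus_one) auto
  then show ?thesis using assms y by (simp add: ln_div algebra_simps)
qed

text \<open>Gibbs' inequality for two-point distributions: ln x \<le> x - 1 is applied to the ratios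
  of \<open>l\<close> to \<open>A / (A + B)\<close> and of \<open>1 - l\<close> to
  \<open>B / (A + B)\<close>, and the linear terms cancel.\<close>

lemma binomial_entropy_bound:
  fixes A B l :: real
  assumes "A \<ge> 0" "B > 0" "0 < l" "l < 1"
  shows "A * ln l + B * ln (1 - l) \<le> A * ln A + B * ln B - (A + B) * ln (A + B)"
proof (cases "A = 0")
  case True
  then show ?thesis using assms by (simp add: mult_le_0_iff)
next
  case False
  then have A: "A > 0" using assms by simp
  have AB: "A + B > 0" using A assms by simp
  have "A * ln (l * (A + B) / A) \<le> A * (l * (A + B) / A - 1)"
    using assms A by (intro mult_left_mono ln_le_minus_one) auto
  also have "\<dots> = l * (A + B) - A" using A by (simp add: field_simps)
  finally have 1: "A * (ln l + ln (A + B) - ln A) \<le> l * (A + B) - A"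
    using assms A AB by (simp only: ln_divide_pos ln_mult_pos mult_pos_pos)
  have "B * ln ((1 - l) * (A + B) / B) \<le> B * ((1 - l) * (A + B) / B - 1)"
    using assms A by (intro mult_left_mono ln_le_minus_one) auto
  also have "\<dots> = (1 - l) * (A + B) - B" using assms by (simp add: field_simps)
  finally have 2: "B * (ln (1 - l) + ln (A + B) - ln B) \<le> (1 - l) * (A + B) - B"
    using assms A AB by (simp only: ln_divide_pos ln_mult_pos mult_pos_pos diff_gt_0_iff_gt)
  show ?thesis
    using 1 2 by (simp add: algebra_simps)
qed

text \<open>The logarithm of A^A B^B / (A + B)^(A + B), the maximum over \<open>l\<close> of l^A (1
  - l)^B for A = \<alpha> - 1 + s and B = \<beta> - 1 + p - s. The sum A + B does not depend on
  \<open>s\<close>, so it drops out of differences.\<close>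

definition log_eff_weight :: "nat \<Rightarrow> real \<Rightarrow> real \<Rightarrow> nat \<Rightarrow> real" where
  "log_eff_weight p \<alpha> \<beta> s =
     (\<alpha> - 1 + real s) * ln (\<alpha> - 1 + real s) + (\<beta> - 1 + real p - real s) * ln (\<beta> - 1 + real p - real s)
     - (\<alpha> - 1 + (\<beta> - 1) + real p) * ln (\<alpha> - 1 + (\<beta> - 1) + real p)"

lemma weight_nu_eq_exp:
  assumes "card S \<le> p" "0 < l" "l < 1"
  shows "weight \<alpha> \<beta> l * nu p l S
    = exp ((\<alpha> - 1 + real (card S)) * ln l + (\<beta> - 1 + real p - real (card S)) * ln (1 - l))"
proof -
  have r: "rpow x c = exp (c * ln x)" if "x > 0" for x c
    using that by (simp add: rpow_def powr_def)
  have q: "x ^ k = exp (real k * ln x)" if "x > 0" for x :: real and k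
    using that by (simp add: exp_of_nat_mult)
  show ?thesis
    using assms by (simp add: weight_def nu_def r q mult_exp_exp of_nat_diff algebra_simps)
qed

lemma weight_nu_le:
  assumes "\<alpha> \<ge> 1" "\<beta> > 1" "card S \<le> p" "l \<in> {0..1}"
  shows "weight \<alpha> \<beta> l * nu p l S \<le> exp (log_eff_weight p \<alpha> \<beta> (card S))"
proof -
  consider "l = 0" | "l = 1" | "0 < l" "l < 1" using assms(4) by fastforce
  then show ?thesis
  proof cases
    case 1
    \<comment> \<open>At \<open>l = 0\<close> the product is nonzero only if every power of
      \<open>l\<close> has exponent 0; it is then 1, and \<open>log_eff_weight\<close> is 0.\<close>
    show ?thesis
    proof (cases "\<alpha> = 1 \<and> card S = 0")
      case True
      then show ?thesis using 1 by (simp add: weight_def nu_def rpow_def log_eff_weight_def)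
    next
      case False
      then have "weight \<alpha> \<beta> l * nu p l S = 0"
        using 1 by (auto simp: weight_def nu_def rpow_def)
      then show ?thesis using exp_ge_zero by (simp only:)
    qed
  next
    case 2
    then have "weight \<alpha> \<beta> l * nu p l S = 0" using assms by (simp add: weight_def rpow_def)
    then show ?thesis using exp_ge_zero by (simp only:)
  next
    case 3
    have N: "\<alpha> - 1 + (\<beta> - 1) + real p = (\<alpha> - 1 + real (card S)) + (\<beta> - 1 + real p - real (card S))"
      by simp
    show ?thesis
      unfolding weight_nu_eq_exp[OF assms(3) 3] log_eff_weight_def N exp_le_cancel_iff
      using 3 assms by (intro binomial_entropy_bound) auto
  qed
qed

lemma weight_nu_le_eff_weight:
  assumes "\<alpha> \<ge> 1" "\<beta> > 1" "card S \<le> p" "l \<in> {0..1}"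
  shows "weight \<alpha> \<beta> l * nu p l S \<le> eff_weight p \<alpha> \<beta> S"
  unfolding eff_weight_def using weight_nu_le[OF assms(1-3)] assms(4)
  by (intro cSUP_upper bdd_aboveI2) auto

lemma eff_weight_le:
  assumes "\<alpha> \<ge> 1" "\<beta> > 1" "card S \<le> p"
  shows "eff_weight p \<alpha> \<beta> S \<le> exp (log_eff_weight p \<alpha> \<beta> (card S))"
  unfolding eff_weight_def using weight_nu_le[OF assms] by (intro cSUP_least) auto

text \<open>The mode of the Beta(\<alpha> + s, \<beta> + p - s) density, at which the weighted
  probability of a support of size \<open>s\<close> is maximal.\<close>

definition mode_weight :: "nat \<Rightarrow> real \<Rightarrow> real \<Rightarrow> nat \<Rightarrow> real" where
  "mode_weight p \<alpha> \<beta> s = (\<alpha> - 1 + real s) / (\<alpha> - 1 + (\<beta> - 1) + real p)"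

lemma mode_weight_in:
  assumes "\<alpha> \<ge> 1" "\<beta> > 1" "s \<le> p"
  shows "mode_weight p \<alpha> \<beta> s \<in> {0..1}"
  using assms by (auto simp: mode_weight_def divide_le_eq)

lemma weight_nu_mode:
  assumes "\<alpha> \<ge> 1" "\<beta> > 1" "card S \<le> p" "card S > 0"
  shows "weight \<alpha> \<beta> (mode_weight p \<alpha> \<beta> (card S)) * nu p (mode_weight p \<alpha> \<beta> (card S)) S
    = exp (log_eff_weight p \<alpha> \<beta> (card S))"
proof -
  define A where "A = \<alpha> - 1 + real (card S)"
  define B where "B = \<beta> - 1 + real p - real (card S)"
  have AB: "A > 0" "B > 0" "\<alpha> - 1 + (\<beta> - 1) + real p = A + B"
    using assms by (auto simp: A_def B_def)
  have l: "mode_weight p \<alpha> \<beta> (card S) = A / (A + B)" "1 - A / (A + B) = B / (A + B)"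
    using AB by (auto simp: mode_weight_def A_def field_simps)
  have "0 < A / (A + B)" "A / (A + B) < 1" using AB by auto
  note w = weight_nu_eq_exp[OF assms(3) this, of \<alpha> \<beta>, folded A_def B_def, unfolded l(2)]
  show ?thesis
    unfolding l(1) w log_eff_weight_def A_def[symmetric] B_def[symmetric] AB(3)
    using AB by (simp add: ln_div algebra_simps)
qed

text \<open>The two quantities \<alpha> - 1 + s and \<beta> - 1 + p - s move in opposite directions,
  so the tangents of x ln x at \<open>s\<close> bound the difference by (t - s) times the log odds
  \<Lambda>. Bounding \<Lambda> below by \<open>D2\<close> and above by \<open>D1\<close> separates
  the price of each coordinate in \<open>S\<close> from the gain for each one in
  \<open>Sstar\<close>.\<close>

lemma log_eff_weight_diff:
  assumes a: "\<alpha> \<ge> 1" "\<beta> > 1" and s: "s \<le> p" "1 \<le> t" "t \<le> p"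
    and D2: "D2 \<le> ln ((\<beta> - 1) / (\<alpha> - 1 + real p))" and D1: "ln ((\<beta> - 1 + real p) / \<alpha>) \<le> D1"
  shows "log_eff_weight p \<alpha> \<beta> s - log_eff_weight p \<alpha> \<beta> t \<le> - D2 * real s + (D1 + 1) * real t"
proof (cases "s = 0")
  \<comment> \<open>For \<alpha> = 1 the tangent point \<alpha> - 1 + s would be 0, so only the
    other term is linearized. The constant 1 in the slope of its tangent then has no counterpart,
    which explains \<open>D1 + 1\<close>.\<close>
  case True
  let ?b = "\<beta> - 1 + real p"
  have b: "?b > 0" "?b - real t \<ge> 0" using a s by auto
  have "(\<alpha> - 1) * ln (\<alpha> - 1) \<le> (\<alpha> - 1) * ln (\<alpha> - 1 + real t)"
    using a s by (cases "\<alpha> = 1") (auto intro!: mult_left_mono)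
  moreover have "real t * ln \<alpha> \<le> real t * ln (\<alpha> - 1 + real t)"
    using a s by (intro mult_left_mono) auto
  moreover have "?b * ln ?b + (- real t) * (ln ?b + 1) \<le> (?b - real t) * ln (?b - real t)"
    using xlnx_tangent[OF b] by simp
  moreover have "real t * (ln ?b - ln \<alpha>) \<le> real t * D1"
    using D1 a b by (intro mult_left_mono) (auto simp: ln_div)
  ultimately show ?thesis
    using True by (simp add: log_eff_weight_def algebra_simps)
next
  case False
  define A where "A = \<alpha> - 1 + real s"
  define B where "B = \<beta> - 1 + real p - real s"
  have AB: "A > 0" "B > 0" using a s False by (auto simp: A_def B_def)
  have AB': "A + (real t - real s) \<ge> 0" "B + (real s - real t) \<ge> 0" using a s by (auto simp: A_def B_def)
  have tA: "A * ln A + (real t - real s) * (ln A + 1) \<le> (A + (real t - real s)) * ln (A + (real t - real s))"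
    using xlnx_tangent[OF AB(1) AB'(1)] by simp
  have tB: "B * ln B + (real s - real t) * (ln B + 1) \<le> (B + (real s - real t)) * ln (B + (real s - real t))"
    using xlnx_tangent[OF AB(2) AB'(2)] by simp
  define \<Lambda> where "\<Lambda> = ln B - ln A"
  have diff: "log_eff_weight p \<alpha> \<beta> s - log_eff_weight p \<alpha> \<beta> t \<le> (real t - real s) * \<Lambda>"
    using tA tB by (simp add: log_eff_weight_def A_def B_def \<Lambda>_def algebra_simps)
  have "(\<beta> - 1) / (\<alpha> - 1 + real p) \<le> B / A"
    using a s AB by (intro frac_le) (auto simp: A_def B_def)
  then have "ln ((\<beta> - 1) / (\<alpha> - 1 + real p)) \<le> ln (B / A)"
    using a s by (intro ln_mono) (auto intro!: divide_pos_pos)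
  then have lo: "D2 \<le> \<Lambda>" using D2 AB by (simp add: \<Lambda>_def ln_div)
  have "B / A \<le> (\<beta> - 1 + real p) / \<alpha>"
    using a s AB False by (intro frac_le) (auto simp: A_def B_def)
  then have "ln (B / A) \<le> ln ((\<beta> - 1 + real p) / \<alpha>)"
    using AB by (intro ln_mono) auto
  then have hi: "\<Lambda> \<le> D1" using D1 AB by (simp add: \<Lambda>_def ln_div)
  have "real s * D2 \<le> real s * \<Lambda>" "real t * \<Lambda> \<le> real t * D1"
    using lo hi by (auto intro!: mult_left_mono)
  with diff show ?thesis by (simp add: algebra_simps)
qed

text \<open>Each coordinate of \<open>S\<close> costs \<open>C2 - 2\<close> powers of
  \<open>p\<close>, and the condition on \<open>C2\<close> leaves at least one after the exponential
  factor; the sum over \<open>S\<close> is then at most e. Each coordinate of \<open>Sstar\<close>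
  gives back at most \<open>C1 + 1\<close> powers, plus 3/2 for the additive 1 in
  \<open>log_eff_weight_diff\<close> and 3/2 for e, hence \<open>C1 + 4\<close>.\<close>

lemma eff_weight_sum:
  assumes p: "p \<ge> 2" and \<alpha>: "\<alpha> \<ge> 1"
    and up: "real p powr C1 \<ge> \<beta> / \<alpha>" and lo: "\<beta> / \<alpha> \<ge> real p powr C2"
    and C: "C2 \<ge> 2 * c + 3" "c \<ge> 0" "C1 > C2"
    and S: "Sstar \<subseteq> {1..p}" "Sstar \<noteq> {}"
  defines "D \<equiv> weight \<alpha> \<beta> (mode_weight p \<alpha> \<beta> (card Sstar)) * nu p (mode_weight p \<alpha> \<beta> (card Sstar)) Sstar"
  shows "\<beta> > 1" and "D > 0"
    and "(\<Sum>S\<in>Pow {1..p}. eff_weight p \<alpha> \<beta> S / D * exp (2 * c * real (card S) * ln (real p)))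
      \<le> exp ((C1 + 4) * real (card Sstar) * ln (real p))"
proof -
  let ?l = "ln (real p)"
  let ?t = "card Sstar"
  have l: "?l \<ge> 2 / 3" by (rule two_thirds_le_ln[OF p])
  have fS: "finite Sstar" using S finite_subset by auto
  have t: "1 \<le> ?t" "?t \<le> p"
    using S fS card_mono[of "{1..p}" Sstar] by (auto simp: Suc_le_eq card_gt_0_iff)
  have pp: "real p powr x > 0" for x using p by simp
  have pow2: "2 * real p powr x \<le> real p powr (x + 1)" for x
    using p by (simp add: powr_add)
  have \<beta>lo: "\<alpha> * real p powr C2 \<le> \<beta>" and \<beta>up: "\<beta> \<le> \<alpha> * real p powr C1"
    using lo up \<alpha> by (auto simp: field_simps)
  have p1: "real p powr x \<ge> 1" if "x \<ge> 0" for x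
    using p that by (simp add: ge_one_powr_ge_zero)
  have q: "\<alpha> * real p powr (C2 - 1) \<ge> 1"
    using mult_mono[of 1 \<alpha> 1 "real p powr (C2 - 1)"] \<alpha> p1[of "C2 - 1"] C by simp
  \<comment> \<open>Since \<open>p\<close> \<ge> 2, lowering the exponent by one gains a factor 2,
    and one of the two copies pays for the subtracted 1. Dividing by \<alpha> - 1 + p \<le> \<alpha>
    p costs the second power of \<open>p\<close>.\<close>
  have bl: "\<alpha> * real p powr (C2 - 1) \<le> \<beta> - 1"
  proof -
    have "\<alpha> * (2 * real p powr (C2 - 1)) \<le> \<alpha> * real p powr C2"
      using pow2[of "C2 - 1"] \<alpha> by (intro mult_left_mono) auto
    then show ?thesis using q \<beta>lo by simp
  qed
  show \<beta>: "\<beta> > 1" using bl q by simp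
  have ap: "\<alpha> - 1 + real p \<le> \<alpha> * real p" and ap0: "\<alpha> - 1 + real p > 0"
  proof -
    have "(\<alpha> - 1) * (real p - 1) \<ge> 0" using \<alpha> p by simp
    then show "\<alpha> - 1 + real p \<le> \<alpha> * real p" by (simp add: algebra_simps)
  qed (use \<alpha> p in simp)
  have "(C2 - 2) * ?l = ln (real p powr (C2 - 2))" using p by (simp add: ln_powr)
  also have "\<dots> \<le> ln ((\<beta> - 1) / (\<alpha> - 1 + real p))"
  proof (rule ln_mono)
    have "real p powr (C2 - 2) * (\<alpha> - 1 + real p) \<le> real p powr (C2 - 2) * (\<alpha> * real p)"
      using ap by (intro mult_left_mono) auto
    also have "\<dots> = \<alpha> * real p powr (C2 - 2 + 1)" using p by (subst powr_add) simp
    also have "\<dots> \<le> \<beta> - 1" using bl by simp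
    finally show "real p powr (C2 - 2) \<le> (\<beta> - 1) / (\<alpha> - 1 + real p)"
      using ap0 by (simp add: le_divide_eq)
  qed (use pp \<beta> ap0 in auto)
  finally have D2: "(C2 - 2) * ?l \<le> ln ((\<beta> - 1) / (\<alpha> - 1 + real p))" .
  have "ln ((\<beta> - 1 + real p) / \<alpha>) \<le> ln (real p powr (C1 + 1))"
  proof (rule ln_mono)
    have "real p \<le> \<alpha> * real p powr C1"
    proof -
      have "real p powr 1 \<le> real p powr C1" using p C by (intro powr_mono) auto
      also have "\<dots> \<le> \<alpha> * real p powr C1" using \<alpha> by (simp add: mult_le_cancel_right1)
      finally show ?thesis using p by simp
    qed
    then have "\<beta> - 1 + real p \<le> \<alpha> * (2 * real p powr C1)" using \<beta>up by simp
    also have "\<dots> \<le> \<alpha> * real p powr (C1 + 1)"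
      using pow2[of C1] \<alpha> by (intro mult_left_mono) auto
    finally show "(\<beta> - 1 + real p) / \<alpha> \<le> real p powr (C1 + 1)"
      using \<alpha> by (simp add: divide_le_eq mult.commute)
  qed (use \<beta> \<alpha> p in auto)
  also have "\<dots> = (C1 + 1) * ?l" using p by (simp add: ln_powr)
  finally have D1: "ln ((\<beta> - 1 + real p) / \<alpha>) \<le> (C1 + 1) * ?l" .
  have D: "D = exp (log_eff_weight p \<alpha> \<beta> ?t)"
    unfolding D_def using weight_nu_mode[OF \<alpha> \<beta>, of Sstar p] t by simp
  then show "D > 0" by simp
  have "(\<Sum>S\<in>Pow {1..p}. eff_weight p \<alpha> \<beta> S / D * exp (2 * c * real (card S) * ?l))
      \<le> (\<Sum>S\<in>Pow {1..p}. exp ((C1 + 5 / 2) * (real ?t * ?l)) * (1 / real p) ^ card S)"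
  proof (rule sum_mono)
    fix S assume "S \<in> Pow {1..p}"
    then have s: "card S \<le> p" using card_mono[of "{1..p}" S] by simp
    have "eff_weight p \<alpha> \<beta> S / D \<le> exp (log_eff_weight p \<alpha> \<beta> (card S)) / D"
      using eff_weight_le[OF \<alpha> \<beta> s] D by (intro divide_right_mono) auto
    also have "\<dots> = exp (log_eff_weight p \<alpha> \<beta> (card S) - log_eff_weight p \<alpha> \<beta> ?t)"
      by (simp add: D exp_diff)
    finally have "eff_weight p \<alpha> \<beta> S / D * exp (2 * c * real (card S) * ?l)
        \<le> exp (log_eff_weight p \<alpha> \<beta> (card S) - log_eff_weight p \<alpha> \<beta> ?t) * exp (2 * c * real (card S) * ?l)"
      by (intro mult_right_mono) auto
    also have "\<dots> \<le> exp ((C1 + 5 / 2) * (real ?t * ?l) + real (card S) * (- ?l))"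
    proof -
      have "real ?t * 1 \<le> real ?t * (3 / 2 * ?l)" using l by (intro mult_left_mono) auto
      moreover have "real (card S) * ?l * (2 * c + 3) \<le> real (card S) * ?l * C2"
        using C l by (intro mult_left_mono) auto
      ultimately show ?thesis
        using log_eff_weight_diff[OF \<alpha> \<beta> s t D2 D1] unfolding mult_exp_exp exp_le_cancel_iff
        by (simp add: algebra_simps)
    qed
    also have "\<dots> = exp ((C1 + 5 / 2) * (real ?t * ?l)) * (1 / real p) ^ card S"
    proof -
      have "exp (real (card S) * (- ?l)) = exp (- ?l) ^ card S" by (rule exp_of_nat_mult)
      also have "exp (- ?l) = 1 / real p" using p by (simp add: exp_minus inverse_eq_divide)
      finally show ?thesis by (simp only: exp_add)
    qed
    finally show "eff_weight p \<alpha> \<beta> S / D * exp (2 * c * real (card S) * ?l)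
        \<le> exp ((C1 + 5 / 2) * (real ?t * ?l)) * (1 / real p) ^ card S" .
  qed
  also have "\<dots> = exp ((C1 + 5 / 2) * (real ?t * ?l)) * (\<Sum>S\<in>Pow {1..p}. (1 / real p) ^ card S)"
    by (simp only: sum_distrib_left)
  also have "\<dots> \<le> exp ((C1 + 5 / 2) * (real ?t * ?l)) * exp (3 / 2 * (real ?t * ?l))"
  proof (rule mult_left_mono)
    have "(\<Sum>S\<in>Pow {1..p}. (1 / real p) ^ card S) \<le> exp (real (card {1..p}) * (1 / real p))"
      by (intro sum_Pow_power_card_le_exp) auto
    also have "\<dots> \<le> exp (3 / 2 * (real ?t * ?l))"
    proof -
      have "1 * (2 / 3) \<le> real ?t * ?l" using t l by (intro mult_mono) auto
      then show ?thesis using p by simp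
    qed
    finally show "(\<Sum>S\<in>Pow {1..p}. (1 / real p) ^ card S) \<le> exp (3 / 2 * (real ?t * ?l))" .
  qed simp
  also have "\<dots> = exp ((C1 + 4) * real ?t * ?l)"
    by (simp add: mult_exp_exp algebra_simps)
  finally show "(\<Sum>S\<in>Pow {1..p}. eff_weight p \<alpha> \<beta> S / D * exp (2 * c * real (card S) * ?l))
      \<le> exp ((C1 + 4) * real ?t * ?l)" .
qed

subsection \<open>Likelihood ratios\<close>

text \<open>The density of the model at \<theta> with respect to the true one in Cameron-Martin
  form. Working with it instead of the likelihood removes a factor that depends on \<open>y\<close>
  alone.\<close>

definition lik_ratio ::
  "nat \<Rightarrow> nat \<Rightarrow> (nat \<Rightarrow> nat \<Rightarrow> real) \<Rightarrow> (nat \<Rightarrow> real) \<Rightarrow> (nat \<Rightarrow> real) \<Rightarrow> (nat \<Rightarrow> real) \<Rightarrow> real" where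
  "lik_ratio n p X \<theta>star \<theta> y =
     exp (dot {1..n} (design_mult p X (\<lambda>j. \<theta> j - \<theta>star j)) (\<lambda>i. y i - design_mult p X \<theta>star i)
       - (pred_dist n p X \<theta> \<theta>star)\<^sup>2 / 2)"

lemma lik_ratio_pos: "lik_ratio n p X \<theta>star \<theta> y > 0"
  by (simp add: lik_ratio_def)

lemma lik_ratio_measurable_pair:
  "(\<lambda>(y, \<theta>). lik_ratio n p X \<theta>star \<theta> y)
    \<in> borel_measurable ((\<Pi>\<^sub>M i\<in>{1..n}. borel) \<Otimes>\<^sub>M (\<Pi>\<^sub>M j\<in>{1..p}. borel))"
  unfolding lik_ratio_def pred_dist_def L2_set_def dot_def design_mult_def by measurable

lemma lik_ratio_measurable [measurable (raw)]:
  assumes [measurable]: "f \<in> N \<rightarrow>\<^sub>M (\<Pi>\<^sub>M j\<in>{1..p}. borel)" "g \<in> N \<rightarrow>\<^sub>M (\<Pi>\<^sub>M i\<in>{1..n}. borel)"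
  shows "(\<lambda>x. lik_ratio n p X \<theta>star (f x) (g x)) \<in> borel_measurable N"
  using measurable_compose[OF measurable_Pair[OF assms(2,1)] lik_ratio_measurable_pair[of n p X \<theta>star]]
  by simp

lemma sampling_eq_density:
  "sampling n p X \<theta> = density (sampling n p X \<theta>star) (\<lambda>y. ennreal (lik_ratio n p X \<theta>star \<theta> y))"
  using gauss_shift[of "{1..n}" "design_mult p X \<theta>star" "design_mult p X (\<lambda>j. \<theta> j - \<theta>star j)"]
  by (simp add: sampling_eq_gauss lik_ratio_def pred_dist_power2 design_mult_diff)

text \<open>Controls how often the evidence is small: the ratio itself contributes d^2 / 2, the
  Gaussian moment another d^2 / 2.\<close>

lemma nn_integral_inverse_lik_ratio:
  "(\<integral>\<^sup>+y. ennreal (1 / lik_ratio n p X \<theta>star \<theta> y) \<partial>sampling n p X \<theta>star)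
    = ennreal (exp ((pred_dist n p X \<theta> \<theta>star)\<^sup>2))"
proof -
  let ?I = "{1..n}"
  let ?v = "\<lambda>i. - 1 * design_mult p X (\<lambda>j. \<theta> j - \<theta>star j) i"
  let ?d2 = "(pred_dist n p X \<theta> \<theta>star)\<^sup>2"
  have vv: "dot ?I ?v ?v = ?d2"
    by (simp only: dot_cmult_left dot_cmult_right pred_dist_power2)
  have [measurable]: "(\<lambda>y. dot ?I ?v (\<lambda>i. y i - design_mult p X \<theta>star i)) \<in> borel_measurable (sampling n p X \<theta>star)"
    unfolding measurable_cong_sets[OF sets_sampling refl] by (rule dot_measurable)
  have eq: "1 / lik_ratio n p X \<theta>star \<theta> y
      = exp (?d2 / 2) * exp (dot ?I ?v (\<lambda>i. y i - design_mult p X \<theta>star i))" for y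
    unfolding lik_ratio_def dot_cmult_left mult_exp_exp
    by (simp add: exp_minus[symmetric] inverse_eq_divide[symmetric])
  have "(\<integral>\<^sup>+y. ennreal (1 / lik_ratio n p X \<theta>star \<theta> y) \<partial>sampling n p X \<theta>star)
      = (\<integral>\<^sup>+y. ennreal (exp (?d2 / 2)) * ennreal (exp (dot ?I ?v (\<lambda>i. y i - design_mult p X \<theta>star i))) \<partial>sampling n p X \<theta>star)"
    by (simp only: eq ennreal_mult exp_ge_zero)
  also have "\<dots> = ennreal (exp (?d2 / 2)) * (\<integral>\<^sup>+y. ennreal (exp (dot ?I ?v (\<lambda>i. y i - design_mult p X \<theta>star i))) \<partial>sampling n p X \<theta>star)"
    by (rule nn_integral_cmult) measurable
  also have "\<dots> = ennreal (exp (?d2 / 2)) * ennreal (exp (?d2 / 2))"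
    unfolding sampling_eq_gauss gauss_mgf[OF finite_atLeastAtMost] vv ..
  finally show ?thesis by (simp add: mult_exp_exp flip: ennreal_mult)
qed

subsection \<open>The empirical Bayes posterior\<close>

lemma likelihood_pos: "likelihood n p X \<theta> y > 0"
  by (simp add: likelihood_def prod_pos normal_density_pos)

lemma likelihood_le_1: "likelihood n p X \<theta> y \<le> 1"
  unfolding likelihood_def
proof (rule prod_le_1, intro conjI)
  fix i
  have "1 / sqrt (2 * pi) \<le> 1" using pi_ge_two by simp
  then show "normal_density (design_mult p X \<theta> i) 1 (y i) \<le> 1"
    unfolding normal_density_def by (intro mult_le_one) auto
qed simp

lemma likelihood_eq_lik_ratio:
  "likelihood n p X \<theta> y = likelihood n p X \<theta>star y * lik_ratio n p X \<theta>star \<theta> y"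
proof -
  let ?v = "design_mult p X (\<lambda>j. \<theta> j - \<theta>star j)"
  have "likelihood n p X \<theta> y
      = (\<Prod>i\<in>{1..n}. normal_density (design_mult p X \<theta>star i + ?v i) 1 (y i))"
    by (simp add: likelihood_def design_mult_diff)
  also have "\<dots> = likelihood n p X \<theta>star y * exp (\<Sum>i\<in>{1..n}. ?v i * (y i - design_mult p X \<theta>star i) - (?v i)\<^sup>2 / 2)"
    unfolding normal_density_shift prod.distrib likelihood_def by (simp add: exp_sum)
  also have "(\<Sum>i\<in>{1..n}. ?v i * (y i - design_mult p X \<theta>star i) - (?v i)\<^sup>2 / 2)
      = dot {1..n} ?v (\<lambda>i. y i - design_mult p X \<theta>star i) - (pred_dist n p X \<theta> \<theta>star)\<^sup>2 / 2"
    unfolding pred_dist_power2 dot_def by (simp add: sum_subtractf sum_divide_distrib power2_eq_square)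
  finally show ?thesis by (simp add: lik_ratio_def)
qed

lemma likelihood_measurable [measurable]:
  "(\<lambda>\<theta>. likelihood n p X \<theta> y) \<in> borel_measurable (\<Pi>\<^sub>M j\<in>{1..p}. borel)"
  unfolding likelihood_def normal_density_def design_mult_def by measurable

lemma marginal_nn_integral:
  assumes "\<tau> > 0" "l \<in> {0..1}"
  shows "(\<integral>\<^sup>+\<theta>. ennreal (likelihood n p X \<theta> y) \<partial>prior p \<tau> l) = ennreal (marginal n p X \<tau> l y)"
    and "marginal n p X \<tau> l y > 0"
proof -
  interpret prob_space "prior p \<tau> l" by (rule prob_space_prior[OF assms])
  have int: "integrable (prior p \<tau> l) (\<lambda>\<theta>. likelihood n p X \<theta> y)"
    using likelihood_le_1 less_imp_le[OF likelihood_pos]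
    by (intro integrable_const_bound[where B = 1]) auto
  then show eq: "(\<integral>\<^sup>+\<theta>. ennreal (likelihood n p X \<theta> y) \<partial>prior p \<tau> l) = ennreal (marginal n p X \<tau> l y)"
    unfolding marginal_def using less_imp_le[OF likelihood_pos] by (intro nn_integral_eq_integral) auto
  have "(\<integral>\<^sup>+\<theta>. ennreal (likelihood n p X \<theta> y) \<partial>prior p \<tau> l) \<noteq> 0"
  proof
    assume "(\<integral>\<^sup>+\<theta>. ennreal (likelihood n p X \<theta> y) \<partial>prior p \<tau> l) = 0"
    then have "AE \<theta> in prior p \<tau> l. ennreal (likelihood n p X \<theta> y) = 0"
      by (subst (asm) nn_integral_0_iff_AE) auto
    then have "AE \<theta> in prior p \<tau> l. False"
      by eventually_elim (metis ennreal_eq_0_iff likelihood_pos not_le)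
    then show False by simp
  qed
  then show "marginal n p X \<tau> l y > 0" unfolding eq by (simp add: ennreal_eq_0_iff)
qed

text \<open>Multiplying by the marginal clears the random denominator and leaves an expression that
  is linear in the prior, hence a sum over supports.\<close>

lemma emeasure_posterior:
  assumes "\<tau> > 0" "l \<in> {0..1}" and [measurable]: "A \<in> sets (\<Pi>\<^sub>M j\<in>{1..p}. borel)"
  shows "ennreal (marginal n p X \<tau> l y) * emeasure (posterior n p X \<tau> l y) A
    = (\<Sum>S\<in>Pow {1..p}. ennreal (nu p l S) * (\<integral>\<^sup>+\<theta>. ennreal (likelihood n p X \<theta> y) * indicator A \<theta> \<partial>Gam p \<tau> S))"
proof -
  let ?m = "marginal n p X \<tau> l y"
  have m: "?m > 0" by (rule marginal_nn_integral[OF assms(1,2)])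
  have "ennreal ?m * emeasure (posterior n p X \<tau> l y) A
      = ennreal ?m * (\<integral>\<^sup>+\<theta>. ennreal (likelihood n p X \<theta> y / ?m) * indicator A \<theta> \<partial>prior p \<tau> l)"
    unfolding posterior_def using assms(3) by (subst emeasure_density) auto
  also have "\<dots> = (\<integral>\<^sup>+\<theta>. ennreal ?m * (ennreal (likelihood n p X \<theta> y / ?m) * indicator A \<theta>) \<partial>prior p \<tau> l)"
    by (rule nn_integral_cmult[symmetric]) measurable
  also have "\<dots> = (\<integral>\<^sup>+\<theta>. ennreal (likelihood n p X \<theta> y) * indicator A \<theta> \<partial>prior p \<tau> l)"
    using m less_imp_le[OF likelihood_pos]
    by (intro nn_integral_cong) (simp add: mult.assoc[symmetric] flip: ennreal_mult)
  also have "\<dots> = (\<Sum>S\<in>Pow {1..p}. ennreal (nu p l S) * (\<integral>\<^sup>+\<theta>. ennreal (likelihood n p X \<theta> y) * indicator A \<theta> \<partial>Gam p \<tau> S))"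
    by (rule nn_integral_prior[OF assms(1,2)]) measurable
  finally show ?thesis .
qed

lemma emeasure_posterior_le_1:
  assumes "\<tau> > 0" "l \<in> {0..1}" and [measurable]: "A \<in> sets (\<Pi>\<^sub>M j\<in>{1..p}. borel)"
  shows "emeasure (posterior n p X \<tau> l y) A \<le> 1"
proof -
  let ?m = "marginal n p X \<tau> l y"
  have m: "?m > 0" by (rule marginal_nn_integral[OF assms(1,2)])
  have "emeasure (posterior n p X \<tau> l y) A \<le> (\<integral>\<^sup>+\<theta>. ennreal (likelihood n p X \<theta> y / ?m) \<partial>prior p \<tau> l)"
    unfolding posterior_def using assms(3)
    by (subst emeasure_density) (auto intro!: nn_integral_mono split: split_indicator)
  also have "\<dots> = (\<integral>\<^sup>+\<theta>. ennreal (1 / ?m) * ennreal (likelihood n p X \<theta> y) \<partial>prior p \<tau> l)"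
    using m less_imp_le[OF likelihood_pos] by (simp flip: ennreal_mult)
  also have "\<dots> = ennreal (1 / ?m) * ennreal ?m"
    by (subst nn_integral_cmult) (auto simp: marginal_nn_integral[OF assms(1,2)])
  also have "\<dots> = 1" using m by (simp flip: ennreal_mult)
  finally show ?thesis .
qed

lemma weight_nonneg: "weight \<alpha> \<beta> l \<ge> 0"
  by (simp add: weight_def rpow_def)

lemma eb_estimator_maximizes:
  assumes "eb_estimator n p X \<tau> \<alpha> \<beta> lhat" and y: "y \<in> {1..n} \<rightarrow>\<^sub>E UNIV"
    and l: "l \<in> {0..1}" and pos: "weight \<alpha> \<beta> l * marginal n p X \<tau> l y > 0"
  shows "lhat y \<in> {0..1}"
    and "weight \<alpha> \<beta> l * marginal n p X \<tau> l y \<le> weight \<alpha> \<beta> (lhat y) * marginal n p X \<tau> (lhat y) y"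
proof -
  let ?f = "\<lambda>l. weight \<alpha> \<beta> l * marginal n p X \<tau> l y"
  have am: "is_arg_max (\<lambda>l. eln (ennreal (?f l))) (\<lambda>l. l \<in> {0..1}) (lhat y)"
    using assms(1) y unfolding eb_estimator_def by blast
  then show "lhat y \<in> {0..1}" by (simp add: is_arg_max_def)
  have "eln (ennreal (?f l)) \<le> eln (ennreal (?f (lhat y)))"
    using am l unfolding is_arg_max_def by force
  moreover have "eln (ennreal (?f l)) = ereal (ln (?f l))"
    using pos by (simp add: eln_def ennreal_eq_0_iff)
  ultimately have le: "ereal (ln (?f l)) \<le> eln (ennreal (?f (lhat y)))" by simp
  \<comment> \<open>A zero value would have logarithm minus infinity, below the finite value at
    \<open>l\<close>; from here on the real logarithm can be used.\<close>
  then have pos': "?f (lhat y) > 0"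
    by (rule contrapos_pp) (simp add: eln_def ennreal_eq_0_iff)
  then have "ln (?f l) \<le> ln (?f (lhat y))"
    using le by (simp add: eln_def ennreal_eq_0_iff)
  then show "?f l \<le> ?f (lhat y)" using pos pos' by simp
qed

text \<open>The right side is free of \<open>lhat\<close>, so its expectation can be taken term by
  term. The inequality is stated with the evidence multiplied out, since a lower bound for the
  evidence holds only with high probability and is brought in by
  \<open>evidence_dichotomy\<close>.\<close>

lemma eb_posterior_le:
  assumes eb: "eb_estimator n p X \<tau> \<alpha> \<beta> lhat" and y: "y \<in> {1..n} \<rightarrow>\<^sub>E UNIV"
    and \<tau>: "\<tau> > 0" and \<alpha>\<beta>: "\<alpha> \<ge> 1" "\<beta> > 1" and l: "l \<in> {0..1}" and S: "Sstar \<subseteq> {1..p}"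
    and c: "c = weight \<alpha> \<beta> l * nu p l Sstar" "c > 0"
    and A [measurable]: "A \<in> sets (\<Pi>\<^sub>M j\<in>{1..p}. borel)"
  shows "emeasure (posterior n p X \<tau> (lhat y) y) A * (\<integral>\<^sup>+\<theta>. ennreal (lik_ratio n p X \<theta>star \<theta> y) \<partial>Gam p \<tau> Sstar)
    \<le> (\<Sum>S\<in>Pow {1..p}. ennreal (eff_weight p \<alpha> \<beta> S / c) *
        (\<integral>\<^sup>+\<theta>. ennreal (lik_ratio n p X \<theta>star \<theta> y) * indicator A \<theta> \<partial>Gam p \<tau> S))"
proof -
  let ?L = "likelihood n p X \<theta>star y"
  let ?post = "emeasure (posterior n p X \<tau> (lhat y) y) A"
  let ?m = "\<lambda>l. marginal n p X \<tau> l y" and ?w = "weight \<alpha> \<beta>"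
  let ?R = "\<lambda>\<theta>. lik_ratio n p X \<theta>star \<theta> y"
  have y' [measurable]: "y \<in> space (\<Pi>\<^sub>M i\<in>{1..n}. borel)" using y by (simp add: space_PiM)
  have [measurable]: "?R \<in> borel_measurable (\<Pi>\<^sub>M j\<in>{1..p}. borel)"
    by (intro lik_ratio_measurable measurable_ident_sets measurable_const refl y')
  have w0: "?w l > 0" using c weight_nonneg[of \<alpha> \<beta> l] nu_nonneg[OF l, of p Sstar]
    by (auto simp: zero_less_mult_iff)
  have pos: "?w l * ?m l > 0" using w0 marginal_nn_integral(2)[OF \<tau> l] by simp
  note lhat = eb_estimator_maximizes[OF eb y l pos]
  have lik: "(\<integral>\<^sup>+\<theta>. ennreal (likelihood n p X \<theta> y) * indicator A \<theta> \<partial>Gam p \<tau> S)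
      = ennreal ?L * (\<integral>\<^sup>+\<theta>. ennreal (?R \<theta>) * indicator A \<theta> \<partial>Gam p \<tau> S)" 
    if "A \<in> sets (\<Pi>\<^sub>M j\<in>{1..p}. borel)" for S and A :: "(nat \<Rightarrow> real) set"
  proof -
    note that [measurable]
    have "(\<integral>\<^sup>+\<theta>. ennreal (likelihood n p X \<theta> y) * indicator A \<theta> \<partial>Gam p \<tau> S)
        = (\<integral>\<^sup>+\<theta>. ennreal ?L * (ennreal (?R \<theta>) * indicator A \<theta>) \<partial>Gam p \<tau> S)"
      using less_imp_le[OF likelihood_pos] less_imp_le[OF lik_ratio_pos]
      by (subst likelihood_eq_lik_ratio[of _ _ _ _ _ \<theta>star]) (simp add: ennreal_mult mult.assoc)
    also have "\<dots> = ennreal ?L * (\<integral>\<^sup>+\<theta>. ennreal (?R \<theta>) * indicator A \<theta> \<partial>Gam p \<tau> S)"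
      by (rule nn_integral_cmult) measurable
    finally show ?thesis .
  qed
  have eff0: "eff_weight p \<alpha> \<beta> S \<ge> 0" if "S \<in> Pow {1..p}" for S
  proof -
    have "card S \<le> p" using that card_mono[of "{1..p}" S] by simp
    then show ?thesis
      using weight_nu_le_eff_weight[OF \<alpha>\<beta> _ l, of S p] weight_nonneg[of \<alpha> \<beta> l] nu_nonneg[OF l, of p S]
      by (meson mult_nonneg_nonneg order_trans)
  qed
  let ?I = "\<lambda>S. \<integral>\<^sup>+\<theta>. ennreal (?R \<theta>) * indicator A \<theta> \<partial>Gam p \<tau> S"
  let ?D = "\<integral>\<^sup>+\<theta>. ennreal (?R \<theta>) \<partial>Gam p \<tau> Sstar"
  \<comment> \<open>The marginal at \<open>l\<close> is bounded below by its summand for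
    \<open>Sstar\<close>.\<close>
  have "ennreal (c * ?L) * (?post * ?D) \<le> ?post * ennreal (?w l * ?m l)"
  proof -
    have "(\<integral>\<^sup>+\<theta>. ennreal (likelihood n p X \<theta> y) \<partial>Gam p \<tau> Sstar)
        = (\<integral>\<^sup>+\<theta>. ennreal ?L * ennreal (?R \<theta>) \<partial>Gam p \<tau> Sstar)"
      using less_imp_le[OF likelihood_pos] less_imp_le[OF lik_ratio_pos]
      by (subst likelihood_eq_lik_ratio[of _ _ _ _ _ \<theta>star]) (simp add: ennreal_mult)
    also have "\<dots> = ennreal ?L * ?D"
      by (rule nn_integral_cmult) measurable
    finally have "ennreal (nu p l Sstar) * (ennreal ?L * ?D)
        = ennreal (nu p l Sstar) * (\<integral>\<^sup>+\<theta>. ennreal (likelihood n p X \<theta> y) \<partial>Gam p \<tau> Sstar)"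
      by (simp only:)
    also have "\<dots> \<le> (\<Sum>S\<in>Pow {1..p}. ennreal (nu p l S) * (\<integral>\<^sup>+\<theta>. ennreal (likelihood n p X \<theta> y) \<partial>Gam p \<tau> S))"
      using S by (intro member_le_sum) auto
    also have "\<dots> = ennreal (?m l)"
    proof -
      have "(\<lambda>\<theta>. ennreal (likelihood n p X \<theta> y)) \<in> borel_measurable (\<Pi>\<^sub>M j\<in>{1..p}. borel)"
        by measurable
      from nn_integral_prior[OF \<tau> l this] show ?thesis
        by (simp only: marginal_nn_integral(1)[OF \<tau> l])
    qed
    finally have le: "ennreal (nu p l Sstar) * (ennreal ?L * ?D) \<le> ennreal (?m l)" .
    have "ennreal (c * ?L) * (?post * ?D) = ?post * (ennreal (?w l) * (ennreal (nu p l Sstar) * (ennreal ?L * ?D)))"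
      using w0 nu_nonneg[OF l, of p Sstar] less_imp_le[OF likelihood_pos]
      by (simp add: c(1) ennreal_mult mult_ac)
    also have "\<dots> \<le> ?post * (ennreal (?w l) * ennreal (?m l))"
      by (intro mult_left_mono le) auto
    also have "\<dots> = ?post * ennreal (?w l * ?m l)"
      using w0 by (simp add: ennreal_mult')
    finally show ?thesis .
  qed
  \<comment> \<open>Maximality of \<open>lhat y\<close> is used here, in the denominator of the
    posterior.\<close>
  also have "\<dots> \<le> ?post * ennreal (?w (lhat y) * ?m (lhat y))"
    by (intro mult_left_mono ennreal_leI lhat) auto
  also have "\<dots> = ennreal (?w (lhat y)) * (ennreal (?m (lhat y)) * ?post)"
    using weight_nonneg by (simp add: ennreal_mult' mult_ac)
  also have "\<dots> = (\<Sum>S\<in>Pow {1..p}. ennreal (?w (lhat y) * nu p (lhat y) S) * (ennreal ?L * ?I S))"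
    unfolding emeasure_posterior[OF \<tau> lhat(1) A] lik[OF A] sum_distrib_left
    using weight_nonneg by (simp add: ennreal_mult' mult.assoc)
  \<comment> \<open>The data-dependent weight of each support is replaced by its maximum over all
    weights, which is deterministic.\<close>
  also have "\<dots> \<le> (\<Sum>S\<in>Pow {1..p}. ennreal (eff_weight p \<alpha> \<beta> S) * (ennreal ?L * ?I S))"
  proof (intro sum_mono mult_right_mono ennreal_leI)
    fix S assume "S \<in> Pow {1..p}"
    then have "card S \<le> p" using card_mono[of "{1..p}" S] by simp
    then show "?w (lhat y) * nu p (lhat y) S \<le> eff_weight p \<alpha> \<beta> S"
      by (intro weight_nu_le_eff_weight \<alpha>\<beta> lhat)
  qed simp
  also have "\<dots> = (\<Sum>S\<in>Pow {1..p}. ennreal (c * ?L) * (ennreal (eff_weight p \<alpha> \<beta> S / c) * ?I S))"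
  proof (rule sum.cong)
    fix S assume "S \<in> Pow {1..p}"
    then have "ennreal (eff_weight p \<alpha> \<beta> S) = ennreal c * ennreal (eff_weight p \<alpha> \<beta> S / c)"
      using c(2) eff0 by (simp flip: ennreal_mult)
    then show "ennreal (eff_weight p \<alpha> \<beta> S) * (ennreal ?L * ?I S)
        = ennreal (c * ?L) * (ennreal (eff_weight p \<alpha> \<beta> S / c) * ?I S)"
      using c(2) less_imp_le[OF likelihood_pos] by (simp add: ennreal_mult mult_ac)
  qed simp
  also have "\<dots> = ennreal (c * ?L) * (\<Sum>S\<in>Pow {1..p}. ennreal (eff_weight p \<alpha> \<beta> S / c) * ?I S)"
    by (simp only: sum_distrib_left)
  finally show ?thesis
    using c(2) likelihood_pos[of n p X \<theta>star y]
    by (subst (asm) ennreal_mult_le_mult_iff) (auto simp: ennreal_eq_0_iff not_le)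
qed

section \<open>Prior mass of prediction balls and numerator after testing\<close>

lemma prior_mass_upper:
  assumes \<tau>: "\<tau> = k * design_norm n p X" "\<tau> > 0"
    and compat: "compat_number n p X Sstar \<ge> ereal k" and norm: "design_norm n p X > 0"
    and Ss: "Sstar \<subseteq> {1..p}" and ts: "\<theta>star \<in> Theta p Sstar" and S: "S \<subseteq> {1..p}"
  shows "measure (Gam p \<tau> S) {\<theta> \<in> Theta p S. (pred_dist n p X \<theta> \<theta>star)\<^sup>2 \<le> \<epsilon>\<^sup>2}
    \<le> exp (3 / 2 * \<bar>\<epsilon>\<bar> * sqrt (real (card Sstar)) + real (card S) * ln 2 - \<tau> * (\<Sum>j\<in>{1..p}. \<bar>\<theta>star j\<bar>))"
proof -
  interpret prob_space "Gam p \<tau> S" by (rule prob_space_Gam[OF \<tau>(2)])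
  let ?B = "{\<theta> \<in> Theta p S. (pred_dist n p X \<theta> \<theta>star)\<^sup>2 \<le> \<epsilon>\<^sup>2}"
  let ?q = "sqrt (real (card Sstar))"
  have B: "?B \<in> sets (Gam p \<tau> S)" by (simp only: sets_Gam, measurable)
  let ?E = "exp (3 / 2 * \<bar>\<epsilon>\<bar> * ?q)"
  let ?f = "\<lambda>\<theta>. exp (- (3 / 2 * pred_dist n p X \<theta> \<theta>star * ?q))"
  have "emeasure (Gam p \<tau> S) ?B = (\<integral>\<^sup>+\<theta>. indicator ?B \<theta> \<partial>Gam p \<tau> S)"
    using B by simp
  also have "\<dots> \<le> (\<integral>\<^sup>+\<theta>. ennreal ?E * ennreal (?f \<theta>) \<partial>Gam p \<tau> S)"
  proof (rule nn_integral_mono)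
    fix \<theta>
    \<comment> \<open>Markov's inequality in exponential form reduces the mass of the ball to
      \<open>Gam_exp_pred_dist\<close>.\<close>
    have le: "1 \<le> ennreal ?E * ennreal (?f \<theta>)" if "\<theta> \<in> ?B"
    proof -
      have "(pred_dist n p X \<theta> \<theta>star)\<^sup>2 \<le> \<bar>\<epsilon>\<bar>\<^sup>2" using that by simp
      then have "pred_dist n p X \<theta> \<theta>star \<le> \<bar>\<epsilon>\<bar>" by (rule power2_le_imp_le) simp
      then have "pred_dist n p X \<theta> \<theta>star * ?q \<le> \<bar>\<epsilon>\<bar> * ?q" by (intro mult_right_mono) auto
      then have "1 \<le> ?E * ?f \<theta>" unfolding mult_exp_exp one_le_exp_iff by (simp add: mult_ac)
      then have "ennreal 1 \<le> ennreal (?E * ?f \<theta>)" by (rule ennreal_leI)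
      then show ?thesis by (simp only: ennreal_mult exp_ge_zero ennreal_1)
    qed
    show "indicator ?B \<theta> \<le> ennreal ?E * ennreal (?f \<theta>)"
    proof (cases "\<theta> \<in> ?B")
      case True
      then show ?thesis using le by (simp only: indicator_simps)
    next
      case False
      then have "indicator ?B \<theta> = (0 :: ennreal)" by (rule indicator_simps(2))
      then show ?thesis by (simp only: zero_le)
    qed
  qed
  also have "\<dots> = ennreal ?E * (\<integral>\<^sup>+\<theta>. ennreal (?f \<theta>) \<partial>Gam p \<tau> S)"
    by (rule nn_integral_cmult) measurable
  also have "\<dots> \<le> ennreal ?E * ennreal (2 ^ card S * exp (- \<tau> * (\<Sum>j\<in>{1..p}. \<bar>\<theta>star j\<bar>)))"
    by (intro mult_left_mono Gam_exp_pred_dist[OF \<tau> compat norm Ss ts S]) simp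
  also have "\<dots> = ennreal (exp (3 / 2 * \<bar>\<epsilon>\<bar> * ?q + real (card S) * ln 2 - \<tau> * (\<Sum>j\<in>{1..p}. \<bar>\<theta>star j\<bar>)))"
  proof -
    have two: "2 ^ card S = exp (real (card S) * ln 2)" by (simp add: exp_of_nat_mult)
    show ?thesis
      unfolding two mult_exp_exp by (simp add: mult_exp_exp algebra_simps flip: ennreal_mult)
  qed
  finally show ?thesis
    by (simp add: emeasure_eq_measure)
qed

text \<open>Two weights for two purposes: 1/16 becomes \<open>C5\<close> and must satisfy 2 *
  \<open>C5\<close> < 1/4, while 1/8 spends half of the decay 1/4 of the test error and keeps the
  other half for the contraction.\<close>

lemma am_gm_quarter:
  fixes x q :: real
  assumes "q \<ge> 0"
  shows "3 / 2 * x * sqrt q \<le> x\<^sup>2 / 16 + 9 * q" "3 / 2 * x * sqrt q \<le> x\<^sup>2 / 8 + 9 / 2 * q"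
proof -
  have q: "(sqrt q)\<^sup>2 = q" using assms by simp
  show "3 / 2 * x * sqrt q \<le> x\<^sup>2 / 16 + 9 * q"
    using zero_le_power2[of "x / 4 - 3 * sqrt q"] unfolding power2_diff power_mult_distrib q
    by (simp add: power_divide algebra_simps)
  show "3 / 2 * x * sqrt q \<le> x\<^sup>2 / 8 + 9 / 2 * q"
    using zero_le_power2[of "x - 6 * sqrt q"] unfolding power2_diff power_mult_distrib q
    by (simp add: power_divide algebra_simps)
qed

lemma divergence_ball:
  "{\<theta> \<in> Theta p S. renyi_div 2 (sampling n p X \<theta>star) (sampling n p X \<theta>) \<le> ereal C3}
      = {\<theta> \<in> Theta p S. (pred_dist n p X \<theta> \<theta>star)\<^sup>2 \<le> C3}"
  by (simp add: renyi_div_sampling)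

lemma prior_mass_lower:
  assumes p: "p \<ge> 2" and \<tau>: "\<tau> = real p powr (- \<zeta>) * design_norm n p X" and \<zeta>: "\<zeta> > 0"
    and norm: "design_norm n p X > 0" and S: "S \<subseteq> {1..p}" and ts: "\<theta>star \<in> Theta p S"
  shows "exp (- \<tau> * (\<Sum>j\<in>{1..p}. \<bar>\<theta>star j\<bar>) - (\<zeta> + 3) * (real (card S) * ln (real p)))
    \<le> measure (Gam p \<tau> S) {\<theta> \<in> Theta p S. renyi_div 2 (sampling n p X \<theta>star) (sampling n p X \<theta>)
        \<le> ereal (3 / 2 * real (card S) * ln (real p))}"
proof -
  have \<tau>0: "\<tau> > 0" using p norm by (simp add: \<tau>)
  interpret prob_space "Gam p \<tau> S" by (rule prob_space_Gam[OF \<tau>0])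
  let ?U = "center_box p (1 / (real p * design_norm n p X)) S \<theta>star"
  let ?B = "{\<theta> \<in> Theta p S. (pred_dist n p X \<theta> \<theta>star)\<^sup>2 \<le> 3 / 2 * real (card S) * ln (real p)}"
  have l: "ln (real p) \<ge> 2 / 3" by (rule two_thirds_le_ln[OF p])
  \<comment> \<open>Origin of \<open>C3\<close> = 3/2: on the box the divergence is at most
    \<open>card S\<close>, which is compared with \<open>card S * ln p\<close>.\<close>
  have s: "real (card S) * 1 \<le> real (card S) * (3 / 2 * ln (real p))"
    using l by (intro mult_left_mono) auto
  have "?U \<subseteq> ?B"
  proof
    fix \<theta> assume \<theta>: "\<theta> \<in> ?U"
    have "(pred_dist n p X \<theta> \<theta>star)\<^sup>2 \<le> real (card S)"
      using p by (intro pred_dist_center_box[OF _ norm S ts \<theta>]) simp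
    then show "\<theta> \<in> ?B" using s subsetD[OF center_box_subset_Theta \<theta>] by simp
  qed
  moreover have "?B \<in> sets (Gam p \<tau> S)" by (simp only: sets_Gam, measurable)
  ultimately have "emeasure (Gam p \<tau> S) ?U \<le> emeasure (Gam p \<tau> S) ?B"
    by (rule emeasure_mono)
  from order_trans[OF Gam_center_box[OF p \<tau> \<zeta> norm S ts] this]
  have "exp (- \<tau> * (\<Sum>j\<in>{1..p}. \<bar>\<theta>star j\<bar>) - (\<zeta> + 3) * (real (card S) * ln (real p))) \<le> measure (Gam p \<tau> S) ?B"
    by (simp add: emeasure_eq_measure)
  then show ?thesis
    by (simp only: divergence_ball)
qed

text \<open>By Fubini the likelihood ratio acts as a change of measure from \<theta>star to
  \<theta>, so the test error at each \<theta> can be inserted. Half of its decay turns into exp (-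
  r / 8) on \<open>A\<close>, and the other half dominates the factor that makes the slab integral
  converge to the bound of \<open>Gam_exp_pred_dist\<close>.\<close>

lemma tested_mass:
  fixes \<phi> :: "(nat \<Rightarrow> real) \<Rightarrow> real"
  assumes \<tau>: "\<tau> = k * design_norm n p X" "\<tau> > 0"
    and compat: "compat_number n p X Sstar \<ge> ereal k" and norm: "design_norm n p X > 0"
    and Ss: "Sstar \<subseteq> {1..p}" and ts: "\<theta>star \<in> Theta p Sstar" and S: "S \<subseteq> {1..p}"
    and \<phi> [measurable]: "\<phi> \<in> borel_measurable (\<Pi>\<^sub>M i\<in>{1..n}. borel)"
    and test: "\<And>\<theta>. \<theta> \<in> Theta p S \<Longrightarrow> (\<integral>\<^sup>+y. ennreal (1 - \<phi> y) \<partial>sampling n p X \<theta>)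
        \<le> ennreal (exp (- (pred_dist n p X \<theta> \<theta>star)\<^sup>2 / 4 + b))"
    and A: "A = {\<theta> \<in> {1..p} \<rightarrow>\<^sub>E UNIV. (pred_dist n p X \<theta> \<theta>star)\<^sup>2 > r}"
  shows "(\<integral>\<^sup>+y. ennreal (1 - \<phi> y) * (\<integral>\<^sup>+\<theta>. ennreal (lik_ratio n p X \<theta>star \<theta> y) * indicator A \<theta> \<partial>Gam p \<tau> S)
        \<partial>sampling n p X \<theta>star)
    \<le> ennreal (exp (- r / 8 + 9 / 2 * real (card Sstar) + b + real (card S) * ln 2 - \<tau> * (\<Sum>j\<in>{1..p}. \<bar>\<theta>star j\<bar>)))"
proof -
  let ?P = "sampling n p X \<theta>star" and ?G = "Gam p \<tau> S"
  interpret G: prob_space ?G by (rule prob_space_Gam[OF \<tau>(2)])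
  interpret P: prob_space ?P by (rule prob_space_sampling)
  interpret PG: pair_sigma_finite ?P ?G ..
  let ?R = "\<lambda>\<theta> y. lik_ratio n p X \<theta>star \<theta> y"
  let ?d = "\<lambda>\<theta>. pred_dist n p X \<theta> \<theta>star"
  let ?q = "sqrt (real (card Sstar))"
  have [measurable]: "A \<in> sets (\<Pi>\<^sub>M j\<in>{1..p}. borel)"
  proof -
    have "A = {\<theta> \<in> space (\<Pi>\<^sub>M j\<in>{1..p}. borel). (?d \<theta>)\<^sup>2 > r}" by (simp add: A space_PiM)
    also have "\<dots> \<in> sets (\<Pi>\<^sub>M j\<in>{1..p}. borel)" by measurable
    finally show ?thesis .
  qed
  then have [measurable]: "A \<in> sets ?G" by (simp only: sets_Gam)
  let ?E = "exp (- r / 8 + 9 / 2 * real (card Sstar) + b)"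
  have "(\<integral>\<^sup>+y. ennreal (1 - \<phi> y) * (\<integral>\<^sup>+\<theta>. ennreal (?R \<theta> y) * indicator A \<theta> \<partial>?G) \<partial>?P)
      = (\<integral>\<^sup>+y. (\<integral>\<^sup>+\<theta>. ennreal (1 - \<phi> y) * (ennreal (?R \<theta> y) * indicator A \<theta>) \<partial>?G) \<partial>?P)"
  proof (rule nn_integral_cong)
    fix y assume "y \<in> space ?P"
    then have [measurable]: "y \<in> space (\<Pi>\<^sub>M i\<in>{1..n}. borel)" by (simp add: space_PiM)
    show "ennreal (1 - \<phi> y) * (\<integral>\<^sup>+\<theta>. ennreal (?R \<theta> y) * indicator A \<theta> \<partial>?G)
        = (\<integral>\<^sup>+\<theta>. ennreal (1 - \<phi> y) * (ennreal (?R \<theta> y) * indicator A \<theta>) \<partial>?G)"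
      by (rule nn_integral_cmult[symmetric]) measurable
  qed
  also have "\<dots> = (\<integral>\<^sup>+\<theta>. (\<integral>\<^sup>+y. ennreal (1 - \<phi> y) * (ennreal (?R \<theta> y) * indicator A \<theta>) \<partial>?P) \<partial>?G)"
    by (rule PG.Fubini'[symmetric]) measurable
  also have "\<dots> \<le> (\<integral>\<^sup>+\<theta>. ennreal ?E * ennreal (exp (- (3 / 2 * ?d \<theta> * ?q))) \<partial>?G)"
  proof (rule nn_integral_mono_AE)
    show "AE \<theta> in ?G. (\<integral>\<^sup>+y. ennreal (1 - \<phi> y) * (ennreal (?R \<theta> y) * indicator A \<theta>) \<partial>?P)
        \<le> ennreal ?E * ennreal (exp (- (3 / 2 * ?d \<theta> * ?q)))"
      using AE_Gam_Theta[OF \<tau>(2), of p S] AE_space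
    proof eventually_elim
      case (elim \<theta>)
      have \<theta> [measurable]: "\<theta> \<in> space (\<Pi>\<^sub>M j\<in>{1..p}. borel)"
        using elim by (simp add: space_PiM)
      have [measurable]: "?R \<theta> \<in> borel_measurable ?P" by measurable
      show ?case
      proof (cases "\<theta> \<in> A")
        case True
        have "(\<integral>\<^sup>+y. ennreal (1 - \<phi> y) * (ennreal (?R \<theta> y) * indicator A \<theta>) \<partial>?P)
            = (\<integral>\<^sup>+y. ennreal (?R \<theta> y) * ennreal (1 - \<phi> y) \<partial>?P)"
          using True by (simp add: mult.commute)
        also have "\<dots> = (\<integral>\<^sup>+y. ennreal (1 - \<phi> y) \<partial>sampling n p X \<theta>)"
          unfolding sampling_eq_density[of n p X \<theta> \<theta>star]
          by (rule nn_integral_density[symmetric]) measurable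
        also have "\<dots> \<le> ennreal (exp (- (?d \<theta>)\<^sup>2 / 4 + b))"
          by (rule test) (rule elim)
        also have "\<dots> \<le> ennreal (?E * exp (- (3 / 2 * ?d \<theta> * ?q)))"
        proof (rule ennreal_leI)
          have "r < (?d \<theta>)\<^sup>2" using True by (simp add: A)
          then show "exp (- (?d \<theta>)\<^sup>2 / 4 + b) \<le> ?E * exp (- (3 / 2 * ?d \<theta> * ?q))"
            using am_gm_quarter(2)[of "real (card Sstar)" "?d \<theta>"]
            unfolding mult_exp_exp exp_le_cancel_iff by simp
        qed
        finally show ?thesis by (simp add: ennreal_mult)
      qed simp
    qed
  qed
  also have "\<dots> = ennreal ?E * (\<integral>\<^sup>+\<theta>. ennreal (exp (- (3 / 2 * ?d \<theta> * ?q))) \<partial>?G)"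
    by (rule nn_integral_cmult) measurable
  also have "\<dots> \<le> ennreal ?E * ennreal (2 ^ card S * exp (- \<tau> * (\<Sum>j\<in>{1..p}. \<bar>\<theta>star j\<bar>)))"
    by (intro mult_left_mono Gam_exp_pred_dist[OF \<tau> compat norm Ss ts S]) simp
  also have "\<dots> = ennreal (exp (- r / 8 + 9 / 2 * real (card Sstar) + b + real (card S) * ln 2 - \<tau> * (\<Sum>j\<in>{1..p}. \<bar>\<theta>star j\<bar>)))"
  proof -
    have two: "2 ^ card S = exp (real (card S) * ln 2)" by (simp add: exp_of_nat_mult)
    show ?thesis
      unfolding two mult_exp_exp by (simp add: mult_exp_exp algebra_simps flip: ennreal_mult)
  qed
  finally show ?thesis .
qed

text \<open>
  In place of Jensen's inequality for the evidence: integrating \<open>2 \<le> K R + 1 / (K R)\<close> over the box shows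
  that the evidence is at least \<open>g / K\<close> unless the integral of \<open>1 / R\<close> is at least \<open>K g\<close>.
\<close>

lemma evidence_dichotomy:
  fixes R :: "'a \<Rightarrow> real" and \<phi> K g :: real
  assumes [measurable]: "R \<in> borel_measurable M" "U \<in> sets M" and R: "\<And>x. R x > 0"
    and g: "emeasure M U = ennreal g" "g > 0" and K: "K > 0"
    and post: "P \<le> 1" "P * (\<integral>\<^sup>+x. ennreal (R x) \<partial>M) \<le> N" and \<phi>: "0 \<le> \<phi>" "\<phi> \<le> 1"
  shows "P \<le> ennreal \<phi> + ennreal (K / g) * (ennreal (1 - \<phi>) * N)
    + ennreal (1 / (K * g)) * (\<integral>\<^sup>+x. ennreal (1 / R x) * indicator U x \<partial>M)"
proof -
  let ?D = "\<integral>\<^sup>+x. ennreal (R x) * indicator U x \<partial>M"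
  let ?W = "\<integral>\<^sup>+x. ennreal (1 / R x) * indicator U x \<partial>M"
  have "ennreal (2 * g) = (\<integral>\<^sup>+x. 2 * indicator U x \<partial>M)"
    using g by (simp add: nn_integral_cmult_indicator ennreal_mult)
  also have "\<dots> \<le> (\<integral>\<^sup>+x. ennreal K * (ennreal (R x) * indicator U x) + ennreal (1 / K) * (ennreal (1 / R x) * indicator U x) \<partial>M)"
  proof (rule nn_integral_mono)
    fix x
    have KR: "K * R x > 0" using K R by simp
    have "2 \<le> z + 1 / z" if "z > 0" for z :: real
      using zero_le_power2[of "z - 1"] that by (simp add: field_simps power2_eq_square)
    from this[OF KR] have "2 \<le> K * R x + 1 / (K * R x)" .
    then have "ennreal 2 \<le> ennreal (K * R x + 1 / K * (1 / R x))"
      by (intro ennreal_leI) simp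
    also have "\<dots> = ennreal (K * R x) + ennreal (1 / K * (1 / R x))"
      using K R[of x] by (intro ennreal_plus) auto
    also have "\<dots> = ennreal K * ennreal (R x) + ennreal (1 / K) * ennreal (1 / R x)"
      using K R[of x] by (intro arg_cong2[where f = "(+)"] ennreal_mult) auto
    finally show "2 * indicator U x \<le> ennreal K * (ennreal (R x) * indicator U x) + ennreal (1 / K) * (ennreal (1 / R x) * indicator U x)"
      by (auto split: split_indicator)
  qed
  also have "\<dots> = ennreal K * ?D + ennreal (1 / K) * ?W"
    by (simp add: nn_integral_add nn_integral_cmult)
  finally have two: "ennreal (2 * g) \<le> ennreal K * ?D + ennreal (1 / K) * ?W" .
  \<comment> \<open>If the evidence over the box is small, the last summand is at least 1 and P
    \<le> 1 suffices. Otherwise P is at most \<open>(K / g) * N\<close>; this is applied to the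
    share \<open>1 - \<phi>\<close> of P alone, the share \<open>\<phi>\<close> being bounded by
    \<open>\<phi>\<close> itself.\<close>
  show ?thesis
  proof (cases "ennreal K * ?D \<le> ennreal g")
    case True
    then have "ennreal g + ennreal g \<le> ennreal g + ennreal (1 / K) * ?W"
      using two g(2) by (simp flip: ennreal_plus) (meson add_right_mono order_trans)
    then have "ennreal g \<le> ennreal (1 / K) * ?W"
      by (simp add: ennreal_add_left_cancel_le)
    then have "ennreal (1 / g) * ennreal g \<le> ennreal (1 / g) * (ennreal (1 / K) * ?W)"
      by (intro mult_left_mono) auto
    then have "1 \<le> ennreal (1 / (K * g)) * ?W"
      using g(2) K by (simp add: mult.assoc[symmetric] mult.commute[of K] flip: ennreal_mult)
    also have "\<dots> \<le> ennreal \<phi> + ennreal (K / g) * (ennreal (1 - \<phi>) * N) + ennreal (1 / (K * g)) * ?W"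
      by simp
    finally show ?thesis using post(1) by (rule order_trans[rotated])
  next
    case False
    have "P * ennreal g \<le> P * (ennreal K * ?D)"
      using False by (intro mult_left_mono) auto
    also have "?D \<le> (\<integral>\<^sup>+x. ennreal (R x) \<partial>M)"
      by (intro nn_integral_mono) (auto split: split_indicator)
    then have "P * (ennreal K * ?D) \<le> ennreal K * (P * (\<integral>\<^sup>+x. ennreal (R x) \<partial>M))"
      by (simp add: mult.left_commute mult_left_mono)
    also have "\<dots> \<le> ennreal K * N" using post(2) by (intro mult_left_mono) auto
    finally have "ennreal (1 / g) * (P * ennreal g) \<le> ennreal (1 / g) * (ennreal K * N)"
      by (intro mult_left_mono) auto
    then have le: "P \<le> ennreal (K / g) * N"
      using g(2) K by (simp add: mult.left_commute mult.assoc[symmetric] flip: ennreal_mult)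
    have "P = ennreal \<phi> * P + ennreal (1 - \<phi>) * P"
      using \<phi> by (simp add: distrib_right[symmetric] flip: ennreal_plus)
    also have "\<dots> \<le> ennreal \<phi> * 1 + ennreal (1 - \<phi>) * (ennreal (K / g) * N)"
      using post(1) le by (intro add_mono mult_left_mono) auto
    also have "\<dots> \<le> ennreal \<phi> + ennreal (K / g) * (ennreal (1 - \<phi>) * N) + ennreal (1 / (K * g)) * ?W"
      by (simp add: mult.left_commute)
    finally show ?thesis .
  qed
qed

subsection \<open>Posterior contraction\<close>

text \<open>\<open>evidence_dichotomy\<close> splits the posterior mass into three terms: rejection
  by the test, the tested numerator over the evidence, and failure of the evidence bound. The
  constants make the mean of each at most exp (- L).\<close>

lemma eb_posterior_contraction:
  assumes p: "p \<ge> 2" and norm: "design_norm n p X > 0" and Ss: "Sstar \<subseteq> {1..p}" "Sstar \<noteq> {}"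
    and \<tau>: "\<tau> = real p powr (- \<zeta>) * design_norm n p X" and \<zeta>: "\<zeta> > 0"
    and \<alpha>\<beta>: "\<alpha> \<ge> 1" "\<beta> > 1"
    and compat: "compat_number n p X Sstar \<ge> ereal (real p powr (- \<zeta>))"
    and ts: "\<theta>star \<in> Theta p Sstar"
    and l: "l \<in> {0..1}" and c: "c = weight \<alpha> \<beta> l * nu p l Sstar" "c > 0"
    and sum: "(\<Sum>S\<in>Pow {1..p}. eff_weight p \<alpha> \<beta> S / c * exp (2 * C2 * real (card S) * ln (real p)))
      \<le> exp (C4 * real (card Sstar) * ln (real p))" and C2: "C2 \<ge> 3"
    and test: "test_function n \<phi>"
      "(\<integral>\<^sup>+y. ennreal (\<phi> y) \<partial>sampling n p X \<theta>star) \<le> ennreal (exp (- real (card Sstar) * ln (real p)))"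
      "\<And>S \<theta>. S \<subseteq> {1..p} \<Longrightarrow> \<theta> \<in> Theta p S \<Longrightarrow>
      (\<integral>\<^sup>+y. ennreal (1 - \<phi> y) \<partial>sampling n p X \<theta>)
        \<le> ennreal (exp (- (pred_dist n p X \<theta> \<theta>star)\<^sup>2 / 4
            + 5 * (real (card S) * ln (real p) + real (card Sstar) * ln (real p))))"
    and eb: "eb_estimator n p X \<tau> \<alpha> \<beta> lhat"
    and A: "A = {\<theta> \<in> {1..p} \<rightarrow>\<^sub>E UNIV. (pred_dist n p X \<theta> \<theta>star)\<^sup>2 > 8 * (\<zeta> + C4 + 19) * real (card Sstar) * ln (real p)}"
  shows "(\<integral>\<^sup>+y. emeasure (posterior n p X \<tau> (lhat y) y) A \<partial>sampling n p X \<theta>star)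
    \<le> ennreal (3 * exp (- real (card Sstar) * ln (real p)))"
proof -
  define L where "L = real (card Sstar) * ln (real p)"
  let ?P = "sampling n p X \<theta>star" and ?G = "Gam p \<tau> Sstar"
  let ?R = "\<lambda>\<theta> y. lik_ratio n p X \<theta>star \<theta> y"
  let ?d = "\<lambda>\<theta>. pred_dist n p X \<theta> \<theta>star"
  let ?n1 = "\<Sum>j\<in>{1..p}. \<bar>\<theta>star j\<bar>"
  let ?U = "center_box p (1 / (real p * design_norm n p X)) Sstar \<theta>star"
  have ln: "ln (real p) \<ge> 2 / 3" by (rule two_thirds_le_ln[OF p])
  have sL: "real (card Sstar) \<le> 3 / 2 * L"
  proof -
    have "real (card Sstar) * 1 \<le> real (card Sstar) * (3 / 2 * ln (real p))"
      using ln by (intro mult_left_mono) auto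
    then show ?thesis by (simp add: L_def mult_ac)
  qed
  have \<tau>0: "\<tau> > 0" using p norm by (simp add: \<tau>)
  interpret P: prob_space ?P by (rule prob_space_sampling)
  interpret G: prob_space ?G by (rule prob_space_Gam[OF \<tau>0])
  interpret PG: pair_sigma_finite ?P ?G ..
  have \<phi> [measurable]: "\<phi> \<in> borel_measurable (\<Pi>\<^sub>M i\<in>{1..n}. borel)"
    and \<phi>01: "\<And>y. y \<in> {1..n} \<rightarrow>\<^sub>E UNIV \<Longrightarrow> 0 \<le> \<phi> y \<and> \<phi> y \<le> 1"
    using test(1) unfolding test_function_def by blast+
  have A_sets [measurable]: "A \<in> sets (\<Pi>\<^sub>M j\<in>{1..p}. borel)"
  proof -
    have "A = {\<theta> \<in> space (\<Pi>\<^sub>M j\<in>{1..p}. borel). (?d \<theta>)\<^sup>2 > 8 * (\<zeta> + C4 + 19) * real (card Sstar) * ln (real p)}"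
      by (simp add: A space_PiM)
    also have "\<dots> \<in> sets (\<Pi>\<^sub>M j\<in>{1..p}. borel)" by measurable
    finally show ?thesis .
  qed
  have A_G [measurable]: "A \<in> sets (Gam p \<tau> S)" for S using A_sets by (simp only: sets_Gam)
  have U_G [measurable]: "?U \<in> sets ?G" by (simp only: sets_Gam center_box_measurable)
  define g where "g = measure ?G ?U"
  have g: "emeasure ?G ?U = ennreal g" by (simp add: g_def G.emeasure_eq_measure)
  have g_lower: "exp (- \<tau> * ?n1 - (\<zeta> + 3) * L) \<le> g"
    using Gam_center_box[OF p \<tau> \<zeta> norm Ss(1) ts] unfolding g L_def by (simp add: g_def)
  then have g0: "g > 0" by (rule less_le_trans[OF exp_gt_zero])
  \<comment> \<open>The failure term has mean at most exp (card Sstar) / K with card Sstar \<le> 3/2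
    * L, so 3 leaves more than the required exp (- L).\<close>
  define K where "K = exp (3 * L)"
  have K0: "K > 0" by (simp add: K_def)
  define E where "E S = ennreal (eff_weight p \<alpha> \<beta> S / c)" for S
  define I where "I S y = (\<integral>\<^sup>+\<theta>. ennreal (?R \<theta> y) * indicator A \<theta> \<partial>Gam p \<tau> S)" for S y
  define W where "W y = (\<integral>\<^sup>+\<theta>. ennreal (1 / ?R \<theta> y) * indicator ?U \<theta> \<partial>?G)" for y
  have I_meas [measurable]: "I S \<in> borel_measurable ?P" for S
  proof -
    interpret GS: prob_space "Gam p \<tau> S" by (rule prob_space_Gam[OF \<tau>0])
    show ?thesis unfolding I_def by measurable
  qed
  have W_meas [measurable]: "W \<in> borel_measurable ?P"
    unfolding W_def by measurable
  have pw: "emeasure (posterior n p X \<tau> (lhat y) y) A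
      \<le> ennreal (\<phi> y) + ennreal (K / g) * (\<Sum>S\<in>Pow {1..p}. E S * (ennreal (1 - \<phi> y) * I S y)) + ennreal (1 / (K * g)) * W y"
    if y: "y \<in> space ?P" for y
  proof -
    have y1: "y \<in> {1..n} \<rightarrow>\<^sub>E UNIV" using y by simp
    have [measurable]: "y \<in> space (\<Pi>\<^sub>M i\<in>{1..n}. borel)" using y by (simp add: space_PiM)
    have Rm: "(\<lambda>\<theta>. ?R \<theta> y) \<in> borel_measurable ?G" by measurable
    have lhat: "lhat y \<in> {0..1}"
      using eb y1 unfolding eb_estimator_def is_arg_max_def by blast
    have "emeasure (posterior n p X \<tau> (lhat y) y) A
        \<le> ennreal (\<phi> y) + ennreal (K / g) * (ennreal (1 - \<phi> y) * (\<Sum>S\<in>Pow {1..p}. E S * I S y))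
          + ennreal (1 / (K * g)) * W y"
      unfolding W_def
    proof (rule evidence_dichotomy[OF Rm U_G lik_ratio_pos g g0 K0])
      show "emeasure (posterior n p X \<tau> (lhat y) y) A \<le> 1"
        by (rule emeasure_posterior_le_1[OF \<tau>0 lhat A_sets])
      show "emeasure (posterior n p X \<tau> (lhat y) y) A * (\<integral>\<^sup>+\<theta>. ennreal (?R \<theta> y) \<partial>?G)
          \<le> (\<Sum>S\<in>Pow {1..p}. E S * I S y)"
        unfolding E_def I_def by (rule eb_posterior_le[OF eb y1 \<tau>0 \<alpha>\<beta> l Ss(1) c A_sets])
    qed (use \<phi>01[OF y1] in auto)
    then show ?thesis by (simp only: sum_distrib_left mult.left_commute)
  qed
  \<comment> \<open>On the box the inverse likelihood ratio has mean exp (d^2), at most exp (card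
    Sstar). The bound is proportional to \<open>g\<close>, which cancels against the coefficient of
    \<open>W\<close>.\<close>
  have W_int: "(\<integral>\<^sup>+y. W y \<partial>?P) \<le> ennreal (exp (real (card Sstar)) * g)"
  proof -
    have "(\<integral>\<^sup>+y. W y \<partial>?P) = (\<integral>\<^sup>+\<theta>. (\<integral>\<^sup>+y. ennreal (1 / ?R \<theta> y) * indicator ?U \<theta> \<partial>?P) \<partial>?G)"
      unfolding W_def by (rule PG.Fubini'[symmetric]) measurable
    also have "\<dots> \<le> (\<integral>\<^sup>+\<theta>. ennreal (exp (real (card Sstar))) * indicator ?U \<theta> \<partial>?G)"
    proof (rule nn_integral_mono)
      fix \<theta>
      show "(\<integral>\<^sup>+y. ennreal (1 / ?R \<theta> y) * indicator ?U \<theta> \<partial>?P) \<le> ennreal (exp (real (card Sstar))) * indicator ?U \<theta>"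
      proof (cases "\<theta> \<in> ?U")
        case True
        have "(?d \<theta>)\<^sup>2 \<le> real (card Sstar)"
          using p by (intro pred_dist_center_box[OF _ norm Ss(1) ts True]) simp
        then show ?thesis
          using True by (simp add: nn_integral_inverse_lik_ratio ennreal_leI)
      qed simp
    qed
    also have "\<dots> = ennreal (exp (real (card Sstar)) * g)"
      using g0 by (subst nn_integral_cmult_indicator[OF U_G]) (simp only: g ennreal_mult exp_ge_zero less_imp_le)
    finally show ?thesis .
  qed
  define B where "B S = exp (- (\<zeta> + C4 + 19) * L + 9 / 2 * real (card Sstar)
      + 5 * (real (card S) * ln (real p) + L) + real (card S) * ln 2 - \<tau> * ?n1)" for S :: "nat set"
  have I_int: "(\<integral>\<^sup>+y. ennreal (1 - \<phi> y) * I S y \<partial>?P) \<le> ennreal (B S)" if S: "S \<subseteq> {1..p}" for S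
  proof -
    have "(\<integral>\<^sup>+y. ennreal (1 - \<phi> y) * I S y \<partial>?P)
        \<le> ennreal (exp (- (8 * (\<zeta> + C4 + 19) * real (card Sstar) * ln (real p)) / 8 + 9 / 2 * real (card Sstar)
          + 5 * (real (card S) * ln (real p) + real (card Sstar) * ln (real p)) + real (card S) * ln 2 - \<tau> * ?n1))"
      unfolding I_def by (rule tested_mass[OF \<tau> \<tau>0 compat norm Ss(1) ts S \<phi> test(3)[OF S] A])
    also have "\<dots> = ennreal (B S)"
      unfolding B_def L_def by (intro arg_cong[where f = ennreal] arg_cong[where f = exp]) (simp add: field_simps)
    finally show ?thesis .
  qed
  have eff0: "eff_weight p \<alpha> \<beta> S / c \<ge> 0" if "S \<in> Pow {1..p}" for S
  proof -
    have "card S \<le> p" using that card_mono[of "{1..p}" S] by simp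
    then have "0 \<le> eff_weight p \<alpha> \<beta> S"
      using weight_nu_le_eff_weight[OF \<alpha>\<beta> _ l, of S p] weight_nonneg[of \<alpha> \<beta> l] nu_nonneg[OF l, of p S]
      by (meson mult_nonneg_nonneg order_trans)
    then show ?thesis using c by simp
  qed
  have B0: "B S \<ge> 0" for S by (simp add: B_def)
  have mid: "ennreal (K / g) * (\<Sum>S\<in>Pow {1..p}. E S * ennreal (B S)) \<le> ennreal (exp (- L))"
  proof -
    have "(\<Sum>S\<in>Pow {1..p}. E S * ennreal (B S)) = ennreal (\<Sum>S\<in>Pow {1..p}. eff_weight p \<alpha> \<beta> S / c * B S)"
    proof -
      have "(\<Sum>S\<in>Pow {1..p}. E S * ennreal (B S)) = (\<Sum>S\<in>Pow {1..p}. ennreal (eff_weight p \<alpha> \<beta> S / c * B S))"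
        unfolding E_def using eff0 B0 by (intro sum.cong refl ennreal_mult[symmetric]) auto
      also have "\<dots> = ennreal (\<Sum>S\<in>Pow {1..p}. eff_weight p \<alpha> \<beta> S / c * B S)"
        by (intro sum_ennreal mult_nonneg_nonneg eff0 B0)
      finally show ?thesis .
    qed
    moreover have "K / g * (\<Sum>S\<in>Pow {1..p}. eff_weight p \<alpha> \<beta> S / c * B S) \<le> exp (- L)"
    proof -
      \<comment> \<open>The part of \<open>B S\<close> that does not depend on \<open>S\<close>:
        47/4 is 9/2 * 3/2 from the comparison of slabs plus 5 from the test.\<close>
      let ?F = "exp (- (\<zeta> + C4 + 19) * L + 47 / 4 * L - \<tau> * ?n1)"
      have "(\<Sum>S\<in>Pow {1..p}. eff_weight p \<alpha> \<beta> S / c * B S)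
          \<le> (\<Sum>S\<in>Pow {1..p}. ?F * (eff_weight p \<alpha> \<beta> S / c * exp (2 * C2 * real (card S) * ln (real p))))"
      proof (rule sum_mono)
        fix S assume S: "S \<in> Pow {1..p}"
        have "ln 2 \<le> ln (real p)" using p by simp
        then have "real (card S) * ln 2 \<le> real (card S) * ln (real p)" by (intro mult_left_mono) auto
        \<comment> \<open>Per coordinate of \<open>S\<close>, 5 comes from the test and at most 1
          from the factor 2 of the tilted slab; \<open>C2\<close> \<ge> 3 matches this with the
          exponential in the sum of effective weights.\<close>
        moreover have "6 * (real (card S) * ln (real p)) \<le> 2 * C2 * (real (card S) * ln (real p))"
          using C2 ln by (intro mult_right_mono) auto
        ultimately have "B S \<le> ?F * exp (2 * C2 * real (card S) * ln (real p))"
          using sL unfolding B_def mult_exp_exp exp_le_cancel_iff by (simp add: mult.assoc)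
        then have "eff_weight p \<alpha> \<beta> S / c * B S
            \<le> eff_weight p \<alpha> \<beta> S / c * (?F * exp (2 * C2 * real (card S) * ln (real p)))"
          using eff0[OF S] by (intro mult_left_mono) auto
        then show "eff_weight p \<alpha> \<beta> S / c * B S
            \<le> ?F * (eff_weight p \<alpha> \<beta> S / c * exp (2 * C2 * real (card S) * ln (real p)))"
          by (simp only: mult.left_commute)
      qed
      also have "\<dots> \<le> ?F * exp (C4 * L)"
        unfolding sum_distrib_left[symmetric] using sum by (intro mult_left_mono) (simp_all add: L_def mult.assoc)
      finally have s: "(\<Sum>S\<in>Pow {1..p}. eff_weight p \<alpha> \<beta> S / c * B S) \<le> ?F * exp (C4 * L)" .
      have "K / g \<le> K / exp (- \<tau> * ?n1 - (\<zeta> + 3) * L)"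
        using g_lower g0 K0 by (intro divide_left_mono) auto
      also have "\<dots> = exp (3 * L + \<tau> * ?n1 + (\<zeta> + 3) * L)"
        unfolding K_def exp_diff[symmetric] by simp
      finally have "K / g * (\<Sum>S\<in>Pow {1..p}. eff_weight p \<alpha> \<beta> S / c * B S)
          \<le> exp (3 * L + \<tau> * ?n1 + (\<zeta> + 3) * L) * (?F * exp (C4 * L))"
      proof (rule mult_mono)
        show "0 \<le> (\<Sum>S\<in>Pow {1..p}. eff_weight p \<alpha> \<beta> S / c * B S)"
          by (intro sum_nonneg mult_nonneg_nonneg eff0 B0)
      qed (use s in simp_all)
      \<comment> \<open>The l1 norm of \<theta>star, \<zeta> and \<open>C4\<close> cancel. What
        remains is 3 + 3 + 47/4 - 19 = - 5/4 times \<open>L\<close>, which explains the 19.\<close>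
      also have "\<dots> \<le> exp (- L)"
      proof -
        have "L \<ge> 0" using ln by (simp add: L_def)
        then show ?thesis unfolding mult_exp_exp exp_le_cancel_iff by (simp add: algebra_simps)
      qed
      finally show ?thesis .
    qed
    ultimately show ?thesis
      using g0 K0 by (simp add: ennreal_mult'[symmetric] ennreal_leI)
  qed
  have "(\<integral>\<^sup>+y. emeasure (posterior n p X \<tau> (lhat y) y) A \<partial>?P)
      \<le> (\<integral>\<^sup>+y. ennreal (\<phi> y) + ennreal (K / g) * (\<Sum>S\<in>Pow {1..p}. E S * (ennreal (1 - \<phi> y) * I S y))
          + ennreal (1 / (K * g)) * W y \<partial>?P)"
    by (rule nn_integral_mono) (rule pw)
  also have "\<dots> = (\<integral>\<^sup>+y. ennreal (\<phi> y) \<partial>?P)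
      + ennreal (K / g) * (\<Sum>S\<in>Pow {1..p}. E S * (\<integral>\<^sup>+y. ennreal (1 - \<phi> y) * I S y \<partial>?P))
      + ennreal (1 / (K * g)) * (\<integral>\<^sup>+y. W y \<partial>?P)"
    by (simp add: nn_integral_add nn_integral_cmult nn_integral_sum)
  also have "\<dots> \<le> ennreal (exp (- L)) + ennreal (exp (- L)) + ennreal (exp (- L))"
  proof (intro add_mono)
    show "(\<integral>\<^sup>+y. ennreal (\<phi> y) \<partial>?P) \<le> ennreal (exp (- L))"
      using test(2) by (simp add: L_def)
    have "ennreal (K / g) * (\<Sum>S\<in>Pow {1..p}. E S * (\<integral>\<^sup>+y. ennreal (1 - \<phi> y) * I S y \<partial>?P))
        \<le> ennreal (K / g) * (\<Sum>S\<in>Pow {1..p}. E S * ennreal (B S))"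
      by (intro mult_left_mono sum_mono I_int) auto
    then show "ennreal (K / g) * (\<Sum>S\<in>Pow {1..p}. E S * (\<integral>\<^sup>+y. ennreal (1 - \<phi> y) * I S y \<partial>?P)) \<le> ennreal (exp (- L))"
      using mid by (rule order_trans)
    have "ennreal (1 / (K * g)) * (\<integral>\<^sup>+y. W y \<partial>?P) \<le> ennreal (1 / (K * g)) * ennreal (exp (real (card Sstar)) * g)"
      by (intro mult_left_mono W_int) simp
    also have "\<dots> = ennreal (exp (real (card Sstar)) / K)"
      using g0 K0 by (simp flip: ennreal_mult)
    also have "\<dots> \<le> ennreal (exp (- L))"
    proof (rule ennreal_leI)
      show "exp (real (card Sstar)) / K \<le> exp (- L)"
        unfolding K_def exp_diff[symmetric] exp_le_cancel_iff using sL ln by (simp add: L_def)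
    qed
    finally show "ennreal (1 / (K * g)) * (\<integral>\<^sup>+y. W y \<partial>?P) \<le> ennreal (exp (- L))" .
  qed
  also have "\<dots> = ennreal (3 * exp (- real (card Sstar) * ln (real p)))"
    by (simp add: L_def flip: ennreal_plus)
  finally show ?thesis .
qed

section \<open>The ratio of prior masses and the choice of the constants\<close>

lemma prior_mass_ratio:
  assumes p: "p \<ge> 2" and norm: "design_norm n p X > 0" and Ss: "Sstar \<subseteq> {1..p}"
    and \<tau>: "\<tau> = real p powr (- \<zeta>) * design_norm n p X" and \<zeta>: "\<zeta> > 0"
    and compat: "compat_number n p X Sstar \<ge> ereal (real p powr (- \<zeta>))"
    and ts: "\<theta>star \<in> Theta p Sstar" and S: "S \<subseteq> {1..p}"
  shows "measure (Gam p \<tau> S) {\<theta>\<in>Theta p S. (pred_dist n p X \<theta> \<theta>star)\<^sup>2 \<le> \<epsilon>\<^sup>2} /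
      measure (Gam p \<tau> Sstar)
        {\<theta>\<in>Theta p Sstar. renyi_div 2 (sampling n p X \<theta>star) (sampling n p X \<theta>)
           \<le> ereal (3 / 2 * real (card Sstar) * ln (real p))}
    \<le> exp (1 / 16 * \<epsilon>\<^sup>2 + (\<zeta> + 17) * (real (card S) * ln (real p) + real (card Sstar) * ln (real p)))"
    (is "?num / ?den \<le> _")
proof -
  let ?l = "ln (real p)"
  let ?n1 = "\<Sum>j\<in>{1..p}. \<bar>\<theta>star j\<bar>"
  have l: "?l \<ge> 2 / 3" by (rule two_thirds_le_ln[OF p])
  have \<tau>0: "\<tau> > 0" using p norm by (simp add: \<tau>)
  have "?num / ?den \<le> exp (3 / 2 * \<bar>\<epsilon>\<bar> * sqrt (real (card Sstar)) + real (card S) * ln 2 - \<tau> * ?n1)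
      / exp (- \<tau> * ?n1 - (\<zeta> + 3) * (real (card Sstar) * ?l))"
    by (intro frac_le prior_mass_upper[OF \<tau> \<tau>0 compat norm Ss ts S]
        prior_mass_lower[OF p \<tau> \<zeta> norm Ss ts]) auto
  \<comment> \<open>The l1 norm of \<theta>star cancels. For \<open>Sstar\<close>, \<zeta> + 3 from
    the box and 9 * 3/2 from the quadratic inequality add up to less than \<zeta> + 17.\<close>
  also have "\<dots> \<le> exp (1 / 16 * \<epsilon>\<^sup>2 + (\<zeta> + 17) * (real (card S) * ?l + real (card Sstar) * ?l))"
  proof -
    have "ln 2 \<le> ?l" using p by simp
    then have s: "real (card S) * ln 2 \<le> real (card S) * ?l" by (intro mult_left_mono) auto
    have t: "real (card Sstar) * 1 \<le> real (card Sstar) * (3 / 2 * ?l)"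
      using l by (intro mult_left_mono) auto
    have "0 \<le> (\<zeta> + 16) * (real (card S) * ?l)" "0 \<le> real (card Sstar) * ?l"
      using l \<zeta> by auto
    then show ?thesis
      using am_gm_quarter(1)[of "real (card Sstar)" "\<bar>\<epsilon>\<bar>"] s t
      unfolding exp_diff[symmetric] exp_le_cancel_iff by (simp add: algebra_simps)
  qed
  finally show ?thesis .
qed

text \<open>Settles the contraction for empty \<open>Sstar\<close>, where the bound to be shown is
  4.\<close>

lemma eb_posterior_le_1:
  assumes \<tau>: "\<tau> > 0" and eb: "eb_estimator n p X \<tau> \<alpha> \<beta> lhat"
  shows "(\<integral>\<^sup>+y. emeasure (posterior n p X \<tau> (lhat y) y)
      {\<theta> \<in> {1..p} \<rightarrow>\<^sub>E UNIV. (pred_dist n p X \<theta> \<theta>star)\<^sup>2 > r} \<partial>sampling n p X \<theta>star) \<le> 1"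
proof -
  interpret prob_space "sampling n p X \<theta>star" by (rule prob_space_sampling)
  let ?A = "{\<theta> \<in> {1..p} \<rightarrow>\<^sub>E UNIV. (pred_dist n p X \<theta> \<theta>star)\<^sup>2 > r}"
  have "?A = {\<theta> \<in> space (\<Pi>\<^sub>M j\<in>{1..p}. borel). (pred_dist n p X \<theta> \<theta>star)\<^sup>2 > r}"
    by (simp add: space_PiM)
  also have "\<dots> \<in> sets (\<Pi>\<^sub>M j\<in>{1..p}. borel)" by measurable
  finally have A: "?A \<in> sets (\<Pi>\<^sub>M j\<in>{1..p}. borel)" .
  have "(\<integral>\<^sup>+y. emeasure (posterior n p X \<tau> (lhat y) y) ?A \<partial>sampling n p X \<theta>star)
      \<le> (\<integral>\<^sup>+y. 1 \<partial>sampling n p X \<theta>star)"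
  proof (rule nn_integral_mono)
    fix y assume "y \<in> space (sampling n p X \<theta>star)"
    then have "lhat y \<in> {0..1}"
      using eb unfolding eb_estimator_def is_arg_max_def space_sampling by blast
    then show "emeasure (posterior n p X \<tau> (lhat y) y) ?A \<le> 1"
      by (rule emeasure_posterior_le_1[OF \<tau> _ A])
  qed
  then show ?thesis by (simp only: nn_integral_const emeasure_space_1 mult_1)
qed

text \<open>Positivity of the denominators in (2) and (3) is part of the claim, because a quotient
  by 0 would be 0 and its bound void. Condition (2) is claimed for nonempty \<open>Sstar\<close>:
  for the empty set its right side is 1, a value that the term of the empty support alone already
  reaches.\<close>

theorem theorem4p3:
  fixes \<zeta> :: real
  assumes "\<zeta> > 0"
  shows "\<exists>K>0. \<forall>C1' C2' :: real. C2' \<ge> K \<and> C1' > C2' \<longrightarrow>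
    (\<exists>C C1 C2 C3 C4 C5 \<rho> M C' :: real.
       C > 0 \<and> C1 > 0 \<and> C2 > 0 \<and> C3 > 0 \<and> C4 > 0 \<and> C5 > 0 \<and> C > 2 * C5 \<and> \<rho> > 1 \<and> M > 0 \<and> C' > 0 \<and>
       (\<forall>(n::nat) (p::nat) (X :: nat \<Rightarrow> nat \<Rightarrow> real) (Sstar :: nat set) (\<tau>::real) (\<alpha>::real) (\<beta>::real).
          p \<ge> 2 \<and> design_norm n p X > 0 \<and> Sstar \<subseteq> {1..p} \<and>
          \<tau> = real p powr (- \<zeta>) * design_norm n p X \<and>
          \<alpha> \<ge> 1 \<and> real p powr C1' \<ge> \<beta> / \<alpha> \<and> \<beta> / \<alpha> \<ge> real p powr C2' \<and>
          compat_number n p X Sstar \<ge> ereal (real p powr (- \<zeta>)) \<longrightarrow>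
          (\<exists>lstar\<in>{0..1}. \<forall>\<theta>star\<in>Theta p Sstar.
             (\<exists>\<phi>. test_function n \<phi> \<and>
                (\<integral>\<^sup>+ y. ennreal (\<phi> y) \<partial>sampling n p X \<theta>star)
                  \<le> ennreal (exp (- C1 * real (card Sstar) * ln (real p))) \<and>
                (\<forall>(\<epsilon>::real) S. \<epsilon>\<^sup>2 \<ge> real (card Sstar) * ln (real p) \<and> S \<subseteq> {1..p} \<longrightarrow>
                   (SUP \<theta>\<in>{\<theta>\<in>Theta p S. (pred_dist n p X \<theta> \<theta>star)\<^sup>2 \<ge> \<epsilon>\<^sup>2}.
                      \<integral>\<^sup>+ y. ennreal (1 - \<phi> y) \<partial>sampling n p X \<theta>)
                   \<le> ennreal (exp (- C * \<epsilon>\<^sup>2 +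
                        C2 * (real (card S) * ln (real p) + real (card Sstar) * ln (real p)))))) \<and>
             (Sstar \<noteq> {} \<longrightarrow>
                weight \<alpha> \<beta> lstar * nu p lstar Sstar > 0 \<and>
                (\<Sum>S\<in>Pow {1..p}. eff_weight p \<alpha> \<beta> S / (weight \<alpha> \<beta> lstar * nu p lstar Sstar) *
                   exp (2 * C2 * real (card S) * ln (real p)))
                \<le> exp (C4 * real (card Sstar) * ln (real p))) \<and>
             measure (Gam p \<tau> Sstar)
               {\<theta>\<in>Theta p Sstar. renyi_div \<rho> (sampling n p X \<theta>star) (sampling n p X \<theta>)
                  \<le> ereal (C3 * real (card Sstar) * ln (real p))} > 0 \<and>
             (\<forall>(\<epsilon>::real) S. \<epsilon>\<^sup>2 \<ge> real (card Sstar) * ln (real p) \<and> S \<subseteq> {1..p} \<longrightarrow>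
                measure (Gam p \<tau> S) {\<theta>\<in>Theta p S. (pred_dist n p X \<theta> \<theta>star)\<^sup>2 \<le> \<epsilon>\<^sup>2} /
                measure (Gam p \<tau> Sstar)
                  {\<theta>\<in>Theta p Sstar. renyi_div \<rho> (sampling n p X \<theta>star) (sampling n p X \<theta>)
                     \<le> ereal (C3 * real (card Sstar) * ln (real p))}
                \<le> exp (C5 * \<epsilon>\<^sup>2 +
                     C2 * (real (card S) * ln (real p) + real (card Sstar) * ln (real p)))) \<and>
             (\<forall>lhat. eb_estimator n p X \<tau> \<alpha> \<beta> lhat \<longrightarrow>
                (\<integral>\<^sup>+ y. emeasure (posterior n p X \<tau> (lhat y) y)
                     {\<theta> \<in> {1..p} \<rightarrow>\<^sub>E UNIV.
                        (pred_dist n p X \<theta> \<theta>star)\<^sup>2 > M * real (card Sstar) * ln (real p)}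
                   \<partial>sampling n p X \<theta>star)
                \<le> ennreal (4 * exp (- C' * real (card Sstar) * ln (real p)))))))"
proof (rule exI[of _ "2 * (\<zeta> + 17) + 3"], intro conjI allI impI, goal_cases)
  case 1
  show ?case using assms by simp
next
  case (2 C1' C2')
  then have C2': "C2' \<ge> 2 * (\<zeta> + 17) + 3" and C1': "C1' > C2'" by auto
  \<comment> \<open>\<open>C2\<close> is the largest requirement among the conditions, \<zeta> + 17
    from the prior masses; the threshold for \<open>C2'\<close> is then 2 * \<open>C2\<close> + 3,
    as \<open>eff_weight_sum\<close> demands. \<open>C\<close> = 1/4 is the decay of the test, and
    \<open>C5\<close> = 1/16 keeps \<open>C\<close> above 2 * \<open>C5\<close>.\<close>
  show ?case
  proof (rule exI[of _ "1 / 4"], rule exI[of _ 1], rule exI[of _ "\<zeta> + 17"], rule exI[of _ "3 / 2"],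
      rule exI[of _ "C1' + 4"], rule exI[of _ "1 / 16"], rule exI[of _ 2],
      rule exI[of _ "8 * (\<zeta> + (C1' + 4) + 19)"], rule exI[of _ 1], intro conjI allI impI, goal_cases)
    case (11 n p X Sstar \<tau> \<alpha> \<beta>)
    then have p: "p \<ge> 2" and norm: "design_norm n p X > 0" and Ss: "Sstar \<subseteq> {1..p}"
      and \<tau>: "\<tau> = real p powr (- \<zeta>) * design_norm n p X" and \<alpha>: "\<alpha> \<ge> 1"
      and up: "real p powr C1' \<ge> \<beta> / \<alpha>" and lo: "\<beta> / \<alpha> \<ge> real p powr C2'"
      and compat: "compat_number n p X Sstar \<ge> ereal (real p powr (- \<zeta>))"
      by blast+
    have \<tau>0: "\<tau> > 0" using p norm by (simp add: \<tau>)
    \<comment> \<open>The maximizer for supports of the size of \<open>Sstar\<close>, so it does not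
      depend on \<theta>star; 0 is a default value for empty \<open>Sstar\<close>.\<close>
    define l where "l = (if Sstar = {} then 0 else mode_weight p \<alpha> \<beta> (card Sstar))"
    have eff: "\<beta> > 1" "weight \<alpha> \<beta> l * nu p l Sstar > 0"
      "(\<Sum>S\<in>Pow {1..p}. eff_weight p \<alpha> \<beta> S / (weight \<alpha> \<beta> l * nu p l Sstar) *
          exp (2 * (\<zeta> + 17) * real (card S) * ln (real p)))
        \<le> exp ((C1' + 4) * real (card Sstar) * ln (real p))" if ne: "Sstar \<noteq> {}"
      using eff_weight_sum[OF p \<alpha> up lo C2' _ C1' Ss ne] ne assms by (simp_all add: l_def)
    have l: "l \<in> {0..1}"
    proof (cases "Sstar = {}")
      case False
      have "card Sstar \<le> p" using Ss card_mono[of "{1..p}" Sstar] by simp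
      then show ?thesis using mode_weight_in[OF \<alpha> eff(1)[OF False]] False by (simp add: l_def)
    qed (simp add: l_def)
    show ?case
    proof (rule bexI[OF _ l], intro ballI conjI, goal_cases)
      case (1 \<theta>star)
      have ln: "ln (real p) \<ge> 2 / 3" by (rule two_thirds_le_ln[OF p])
      obtain \<phi> where \<phi>: "test_function n \<phi>"
        "(\<integral>\<^sup>+y. ennreal (\<phi> y) \<partial>sampling n p X \<theta>star) \<le> ennreal (exp (- real (card Sstar) * ln (real p)))"
        "\<And>S \<theta>. S \<subseteq> {1..p} \<Longrightarrow> \<theta> \<in> Theta p S \<Longrightarrow>
          (\<integral>\<^sup>+y. ennreal (1 - \<phi> y) \<partial>sampling n p X \<theta>)
            \<le> ennreal (exp (- (pred_dist n p X \<theta> \<theta>star)\<^sup>2 / 4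
                + 5 * (real (card S) * ln (real p) + real (card Sstar) * ln (real p))))"
        using sparse_test_exists[OF p Ss 1, of n X] by blast
      show ?case
      proof (intro exI[of _ \<phi>] conjI allI impI SUP_least)
        fix \<epsilon> S \<theta>
        assume S: "real (card Sstar) * ln (real p) \<le> \<epsilon>\<^sup>2 \<and> S \<subseteq> {1..p}"
          and \<theta>: "\<theta> \<in> {\<theta> \<in> Theta p S. \<epsilon>\<^sup>2 \<le> (pred_dist n p X \<theta> \<theta>star)\<^sup>2}"
        let ?s = "real (card S) * ln (real p) + real (card Sstar) * ln (real p)"
        \<comment> \<open>The test gives the constant 5, enlarged here to the \<open>C2\<close>
          shared by the three conditions.\<close>
        have "5 * ?s \<le> (\<zeta> + 17) * ?s" using assms ln by (intro mult_right_mono) auto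
        then have "- (pred_dist n p X \<theta> \<theta>star)\<^sup>2 / 4 + 5 * ?s \<le> - (1 / 4) * \<epsilon>\<^sup>2 + (\<zeta> + 17) * ?s"
          using \<theta> by simp
        then show "(\<integral>\<^sup>+y. ennreal (1 - \<phi> y) \<partial>sampling n p X \<theta>) \<le> ennreal (exp (- (1 / 4) * \<epsilon>\<^sup>2 + (\<zeta> + 17) * ?s))"
          using \<phi>(3)[of S \<theta>] S \<theta> by (intro order_trans[OF \<phi>(3) ennreal_leI]) auto
      qed (use \<phi> in simp_all)
    next
      case (2 \<theta>star)
      show ?case using eff by blast
    next
      case (3 \<theta>star)
      show ?case
        by (rule less_le_trans[OF exp_gt_zero prior_mass_lower[OF p \<tau> assms norm Ss 3]])
    next
      case (4 \<theta>star)
      show ?case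
        using prior_mass_ratio[OF p norm Ss \<tau> assms compat 4] by blast
    next
      case (5 \<theta>star)
      show ?case
      proof (intro allI impI)
        fix lhat assume eb: "eb_estimator n p X \<tau> \<alpha> \<beta> lhat"
        let ?post = "\<integral>\<^sup>+y. emeasure (posterior n p X \<tau> (lhat y) y)
            {\<theta> \<in> {1..p} \<rightarrow>\<^sub>E UNIV. (pred_dist n p X \<theta> \<theta>star)\<^sup>2
              > 8 * (\<zeta> + (C1' + 4) + 19) * real (card Sstar) * ln (real p)} \<partial>sampling n p X \<theta>star"
        show "?post \<le> ennreal (4 * exp (- 1 * real (card Sstar) * ln (real p)))"
        proof (cases "Sstar = {}")
          case True
          have "?post \<le> 1" by (rule eb_posterior_le_1[OF \<tau>0 eb])
          also have "\<dots> \<le> ennreal (4 * exp (- 1 * real (card Sstar) * ln (real p)))"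
            using True by simp
          finally show ?thesis .
        next
          case False
          obtain \<phi> where \<phi>: "test_function n \<phi>"
            "(\<integral>\<^sup>+y. ennreal (\<phi> y) \<partial>sampling n p X \<theta>star) \<le> ennreal (exp (- real (card Sstar) * ln (real p)))"
            "\<And>S \<theta>. S \<subseteq> {1..p} \<Longrightarrow> \<theta> \<in> Theta p S \<Longrightarrow>
              (\<integral>\<^sup>+y. ennreal (1 - \<phi> y) \<partial>sampling n p X \<theta>)
                \<le> ennreal (exp (- (pred_dist n p X \<theta> \<theta>star)\<^sup>2 / 4
                    + 5 * (real (card S) * ln (real p) + real (card Sstar) * ln (real p))))"
            using sparse_test_exists[OF p Ss 5, of n X] by blast
          have "\<zeta> + 17 \<ge> 3" using assms by simp
          then have "?post \<le> ennreal (3 * exp (- real (card Sstar) * ln (real p)))"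
            by (rule eb_posterior_contraction[OF p norm Ss False \<tau> assms \<alpha> eff(1)[OF False] compat 5 l
                  refl eff(2)[OF False] eff(3)[OF False] _ \<phi> eb refl])
          also have "\<dots> \<le> ennreal (4 * exp (- 1 * real (card Sstar) * ln (real p)))"
            by (intro ennreal_leI) simp
          finally show ?thesis .
        qed
      qed
    qed
  qed (use assms C2' C1' in auto)
qed

end
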